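(* Assume (H1)–(H3) as written out in the context, and let $0<\bar\eta<\min(\bar\theta,\nu)$. Let $\Lambda_r$ be a domain of hyperbolicity of $A^0_\infty$ and let $K\subset\Lambda_r$ be compact. Let $\eta>0$ be any number smaller than $\bar\eta$ and smaller than the spectral gap of $A^0_\infty(\lambda)$ for $\lambda\in K$ (i.e. smaller than $\min_{\lambda\in K}\min\{|\Re\mu|:\mu\in\sigma(A^0_\infty(\lambda))\}$). Then there exists $C>0$ (independent of $\varepsilon$) such that $$|D^\varepsilon_r(\lambda,\gamma)-D^0_r(\lambda)|\le C e^{-\eta X^\varepsilon/2}\qquad\text{for all }\lambda\in K,\ \gamma\in\mathbb C \text{ with } |\gamma|=1,\ \text{and } \varepsilon>0.$$
   Context: Setting. For $\varepsilon\ge 0$ in a one-parameter family, consider first-order $N\times N$ systems $W'=A^\varepsilon(x,\lambda)W$, $\lambda\in\mathbb C$, where $A^\varepsilon$ is analytic in $\lambda$, $C^1$ in $x$, continuous in $\varepsilon$ for $\varepsilon>0$, and, for $\varepsilon>0$, periodic in $x$ with period $X^\varepsilon>0$. Hypotheses (for each $M>0$, with $C(M)>0$ and $\nu,\bar\theta>0$ independent of $\varepsilon$): (H1) $X^\varepsilon\to\infty$ as $\varepsilon\to0$. (H2) There is a matrix $A^0_\infty(\lambda)$, independent of $x$, with $|A^0(x,\lambda)-A^0_\infty(\lambda)|\le C(M)e^{-\nu|x|}$ for all $x\in\mathbb R$, $|\lambda|\le M$. (H3) $|A^\varepsilon(x,\lambda)-A^0(x,\lambda)|\le C(M)e^{-\bar\theta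 X^\varepsilon/2}$ for $|\lambda|\le M$, $|x|\le X^\varepsilon/2$. Domains of hyperbolicity. The set of $\lambda$ for which $A^0_\infty(\lambda)$ has a purely imaginary eigenvalue $ik$, $k\in\mathbb R$, is a finite union of curves $\lambda_j(k)$; the open connected components $\Lambda_r$ of the complement of these curves are the domains of hyperbolicity. On $\Lambda_r$, $n_r$ is the number of eigenvalues of $A^0_\infty$ with negative real part (with multiplicity), and $\Pi_u(\lambda),\Pi_s(\lambda)$ are the spectral projections of $A^0_\infty(\lambda)$ onto its unstable (positive real part) and stable (negative real part) subspaces. Conjugators. $P^0_\pm(x,\lambda)$ ($x\ge0$, resp. $x\le 0$) denote bounded, uniformly invertible matrix functions, locally analytic in $\lambda$, with $(P^0_\pm)'=A^0P^0_\pm-P^0_\pm A^0_\infty$ and $|P^0_\pm(x,\lambda)-\mathrm{Id}|\le Ce^{-\bar\eta|x|}$; thus $W=P^0_\pm Z$ conjugates $W'=A^0W$ to $Z'=A^0_\infty Z$ on $x\gtrless0$. (Such $P^0_\pm$ exist.) Homoclinic Evans function on $\Lambda_r$: $$D^0_r(\lambda)=\frac{\det(P^0_-R^-_\infty,\;P^0_+R^+_\infty)|_{x=0}}{\det(R^-_\infty,R^+_\infty)},$$ where the columns of $R^-_\infty$ (resp. $R^+_\infty$) are any basis of the unstable (resp. stable) subspace of $A^0_\infty(\lambda)$. Periodic Evans function. Let $\Psi^\varepsilon(x,\lambda)$ be the solution operator of $W'=A^\varepsilon W$ with $\Psi^\varepsilon(0,\lambda)=\mathrm{Id}$. The balanced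 periodic Evans function is $$\tilde E^\varepsilon(\lambda,\gamma)=\det\big(\Psi^\varepsilon(0,\lambda)\Psi^\varepsilon(-X^\varepsilon/2,\lambda)^{-1}-\gamma\,\Psi^\varepsilon(0,\lambda)\Psi^\varepsilon(X^\varepsilon/2,\lambda)^{-1}\big),$$ and the rescaled balanced periodic Evans function on $\Lambda_r$ is $$D^\varepsilon_r(\lambda,\gamma)=e^{-\operatorname{tr}(A^0_\infty\Pi_u)X^\varepsilon/2}\,e^{\operatorname{tr}(A^0_\infty\Pi_s)X^\varepsilon/2}\,(-\gamma)^{-n_r}\,\tilde E^\varepsilon(\lambda,\gamma).$$ *)

theory Defs
  imports "HOL-Analysis.Analysis" "HOL-Computational_Algebra.Polynomial"
begin

text \<open>Throughout, the spectral parameter (usually called lambda) is written \<open>z\<close>, and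
  \<open>\<mu>\<close> ranges over eigenvalues.\<close>

section \<open>Spectral theory of a complex matrix\<close>

definition eigenvalues :: "complex^'n^'n \<Rightarrow> complex set" where
  "eigenvalues M = {\<mu>. \<exists>v. v \<noteq> 0 \<and> M *v v = \<mu> *s v}"

definition char_poly :: "complex^'n^'n \<Rightarrow> complex poly" where
  "char_poly M = det (\<chi> i j. (if i = j then [:0, 1:] else 0) - [:M $ i $ j:])"

text \<open>The eigenvalues are counted with their algebraic multiplicity.\<close>

definition num_stable_eigenvalues :: "complex^'n^'n \<Rightarrow> nat" where
  "num_stable_eigenvalues M = (\<Sum>\<mu> | \<mu> \<in> eigenvalues M \<and> Re \<mu> < 0. order \<mu> (char_poly M))"

definition spectral_gap :: "complex^'n^'n \<Rightarrow> real" where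
  "spectral_gap M = Min ((\<lambda>\<mu>. \<bar>Re \<mu>\<bar>) ` eigenvalues M)"

definition generalized_eigenspace :: "complex^'n^'n \<Rightarrow> complex \<Rightarrow> (complex^'n) set" where
  "generalized_eigenspace M \<mu> = {v. \<exists>k. ((\<lambda>w. (M - mat \<mu>) *v w) ^^ k) v = 0}"

text \<open>Sum of the generalized eigenspaces of the eigenvalues lying in \<open>S\<close> (the generalized
  eigenspace of a non-eigenvalue is zero); \<open>vec.span\<close> is the span over the complex numbers.\<close>

definition spectral_subspace :: "complex^'n^'n \<Rightarrow> complex set \<Rightarrow> (complex^'n) set" where
  "spectral_subspace M S = vec.span (\<Union>\<mu>\<in>S. generalized_eigenspace M \<mu>)"

definition spectral_projection :: "complex^'n^'n \<Rightarrow> complex set \<Rightarrow> complex^'n^'n" where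
  "spectral_projection M S = (THE Q. (\<forall>v \<in> spectral_subspace M S. Q *v v = v) \<and>
                                     (\<forall>v \<in> spectral_subspace M (- S). Q *v v = 0))"

abbreviation unstable_subspace :: "complex^'n^'n \<Rightarrow> (complex^'n) set" where
  "unstable_subspace M \<equiv> spectral_subspace M {\<mu>. Re \<mu> > 0}"

abbreviation stable_subspace :: "complex^'n^'n \<Rightarrow> (complex^'n) set" where
  "stable_subspace M \<equiv> spectral_subspace M {\<mu>. Re \<mu> < 0}"

abbreviation unstable_projection :: "complex^'n^'n \<Rightarrow> complex^'n^'n" where
  "unstable_projection M \<equiv> spectral_projection M {\<mu>. Re \<mu> > 0}"

abbreviation stable_projection :: "complex^'n^'n \<Rightarrow> complex^'n^'n" where
  "stable_projection M \<equiv> spectral_projection M {\<mu>. Re \<mu> < 0}"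

section \<open>Domains of hyperbolicity\<close>

definition nonhyperbolic_set :: "(complex \<Rightarrow> complex^'n^'n) \<Rightarrow> complex set" where
  "nonhyperbolic_set Ainf = {z. \<exists>k::real. \<i> * of_real k \<in> eigenvalues (Ainf z)}"

definition domains_of_hyperbolicity :: "(complex \<Rightarrow> complex^'n^'n) \<Rightarrow> complex set set" where
  "domains_of_hyperbolicity Ainf = components (- nonhyperbolic_set Ainf)"

section \<open>Conjugators and the homoclinic Evans function\<close>

text \<open>\<open>H\<close> is the half-line in \<open>x\<close> on which \<open>P\<close> is considered, \<open>U\<close> a set of spectral parameters;
  all bounds are uniform in \<open>x \<in> H\<close> and \<open>z \<in> U\<close>.\<close>

definition conjugator_on :: "real set \<Rightarrow> complex set \<Rightarrow> (real \<Rightarrow> complex \<Rightarrow> complex^'n^'n) \<Rightarrow>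
    (complex \<Rightarrow> complex^'n^'n) \<Rightarrow> real \<Rightarrow> (real \<Rightarrow> complex \<Rightarrow> complex^'n^'n) \<Rightarrow> bool" where
  "conjugator_on H U A0 Ainf \<eta>' P \<longleftrightarrow>
     (\<forall>x\<in>H. \<forall>i j. (\<lambda>z. P x z $ i $ j) analytic_on U) \<and>
     (\<exists>B. \<forall>x\<in>H. \<forall>z\<in>U. norm (P x z) \<le> B \<and> invertible (P x z) \<and> norm (matrix_inv (P x z)) \<le> B) \<and>
     (\<forall>x\<in>H. \<forall>z\<in>U. ((\<lambda>y. P y z) has_vector_derivative (A0 x z ** P x z - P x z ** Ainf z))
                      (at x within H)) \<and>
     (\<exists>C. \<forall>x\<in>H. \<forall>z\<in>U. norm (P x z - mat 1) \<le> C * exp (- \<eta>' * \<bar>x\<bar>))"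

text \<open>Conjugators need only exist locally in the spectral parameter: \<open>P z0\<close> is the one used near
  \<open>z0\<close>. A single \<open>P\<close> that works near every point is the case of a constant family.\<close>

definition local_conjugators :: "real set \<Rightarrow> complex set \<Rightarrow> (real \<Rightarrow> complex \<Rightarrow> complex^'n^'n) \<Rightarrow>
    (complex \<Rightarrow> complex^'n^'n) \<Rightarrow> real \<Rightarrow>
    (complex \<Rightarrow> real \<Rightarrow> complex \<Rightarrow> complex^'n^'n) \<Rightarrow> bool" where
  "local_conjugators H \<Lambda> A0 Ainf \<eta>' P \<longleftrightarrow>
     (\<forall>z0\<in>\<Lambda>. \<exists>U. open U \<and> z0 \<in> U \<and> conjugator_on H U A0 Ainf \<eta>' (P z0))"

definition columns_basis :: "complex^'n^'n \<Rightarrow> 'n set \<Rightarrow> (complex^'n) set \<Rightarrow> bool" where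
  "columns_basis R J V \<longleftrightarrow> inj_on (\<lambda>j. column j R) J \<and>
     vec.independent ((\<lambda>j. column j R) ` J) \<and> vec.span ((\<lambda>j. column j R) ` J) = V"

text \<open>The two bases are stored as the columns of one square matrix \<open>R\<close>: those with index in \<open>J\<close>
  span the unstable subspace, the others the stable one.\<close>

definition hyperbolic_frame :: "complex^'n^'n \<Rightarrow> complex^'n^'n \<Rightarrow> 'n set \<Rightarrow> bool" where
  "hyperbolic_frame M R J \<longleftrightarrow>
     columns_basis R J (unstable_subspace M) \<and> columns_basis R (- J) (stable_subspace M)"

text \<open>\<open>P\<^sub>m\<close>, \<open>P\<^sub>p\<close> are the values at \<open>x = 0\<close> of the conjugators on the left and right half-line.
  Columns occur in the same order in numerator and denominator, so the quotient does
  not depend on listing the unstable columns first.\<close>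

definition homoclinic_evans ::
    "complex^'n^'n \<Rightarrow> complex^'n^'n \<Rightarrow> complex^'n^'n \<Rightarrow> 'n set \<Rightarrow> complex" where
  "homoclinic_evans P\<^sub>m P\<^sub>p R J =
     det (\<chi> i j. if j \<in> J then (P\<^sub>m ** R) $ i $ j else (P\<^sub>p ** R) $ i $ j) / det R"

section \<open>Periodic Evans function\<close>

definition solution_operator ::
    "(real \<Rightarrow> complex^'n^'n) \<Rightarrow> (real \<Rightarrow> complex^'n^'n) \<Rightarrow> bool" where
  "solution_operator a \<Psi> \<longleftrightarrow> \<Psi> 0 = mat 1 \<and> (\<forall>x. (\<Psi> has_vector_derivative (a x ** \<Psi> x)) (at x))"

definition balanced_periodic_evans ::
    "(real \<Rightarrow> complex^'n^'n) \<Rightarrow> real \<Rightarrow> complex \<Rightarrow> complex" where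
  "balanced_periodic_evans \<Psi> X \<gamma> =
     det (\<Psi> 0 ** matrix_inv (\<Psi> (- X / 2)) - mat \<gamma> ** (\<Psi> 0 ** matrix_inv (\<Psi> (X / 2))))"

text \<open>\<open>M\<close> is the limiting matrix at the spectral parameter under consideration.\<close>

definition rescaled_periodic_evans ::
    "complex^'n^'n \<Rightarrow> (real \<Rightarrow> complex^'n^'n) \<Rightarrow> real \<Rightarrow> complex \<Rightarrow> complex" where
  "rescaled_periodic_evans M \<Psi> X \<gamma> =
     exp (- trace (M ** unstable_projection M) * of_real X / 2) *
     exp (trace (M ** stable_projection M) * of_real X / 2) *
     (- \<gamma>) powi (- int (num_stable_eigenvalues M)) *
     balanced_periodic_evans \<Psi> X \<gamma>"

end

theory Submission
  imports Defs
begin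

text \<open>In coordinates given by a conjugator on each half-line, the two factors of the balanced periodic
  Evans function solve \<open>Y' = (T + \<Theta>) Y\<close> and \<open>Y' = - (T + \<Theta>) Y\<close> on \<open>[0, X/2]\<close>, where \<open>T\<close> is similar
  to the limiting matrix and \<open>\<Theta>\<close> is exponentially small in \<open>X\<close>. Stacking both solutions gives a
  \<open>2n\<close> by \<open>n\<close> matrix whose maximal minors satisfy a linear system again. The minor that takes the
  unstable rows from the first and the stable rows from the second solution grows fastest, and its
  growth is exactly the factor by which the Evans function is rescaled; all others are
  exponentially smaller. Hence the rescaled Evans function converges, and only the spectral projections survive
  in the limit. The constants are uniform in the spectral parameter because the matrices conjugating
  the limiting matrix to \<open>T\<close> can be bounded by compactness, in terms of the norm and the spectral gap
  alone.\<close>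

section \<open>Determinants\<close>

text \<open>Both factors of the Evans function grow exponentially, at rates that differ from
  direction to direction, whereas the rescaling removes a single rate; estimating the factors entry
  by entry therefore cannot produce a limit. The determinant of
  \<open>Lm Ym - \<gamma> Lp Yp\<close> is however linear in the maximal minors of the stacked pair,
  so that each minor can be treated as one scalar quantity with its own rate. Eigenvectors of the
  limiting matrix may merge as the spectral parameter varies, so diagonalization would give
  unbounded conjugations. A triangular \<open>T\<close> is enough if its off-diagonal entries are
  small against the gap, and scaling the columns by powers of a small number makes them so. Before
  that scaling the columns are orthonormal within the unstable and within the stable block; the only
  possible degeneration is then that the two blocks approach each other, which the gap excludes.
  With \<open>h\<close> half the period, the perturbation contributes
  \<open>h * exp (- \<theta>' * h)\<close>; the factor \<open>h\<close> is absorbed because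
  \<open>\<eta> < \<theta>'\<close>. Replacing the conjugators at \<open>h\<close> and
  \<open>-h\<close> by the identity costs \<open>exp (- \<eta>' * h)\<close>.\<close>

lemma permutes_id_if_rank_le:
  fixes r :: "'n::finite \<Rightarrow> nat"
  assumes "p permutes UNIV" "inj r" "\<And>i. r (p i) \<le> r i"
  shows "p = id"
proof -
  have "(\<Sum>i\<in>UNIV. r (p i)) = (\<Sum>i\<in>UNIV. r i)"
    using sum.permute[OF assms(1), of r] by (simp add: o_def)
  then have "r (p i) = r i" for i
    using sum_mono_inv[of "\<lambda>i. r (p i)" UNIV r i] assms(3) by simp
  then show ?thesis
    using assms(2) by (auto simp: inj_def fun_eq_iff)
qed

text \<open>The index type carries no order, so an injective rank \<open>r\<close> takes its place;
  later it is the position in a flag. Any permutation other than the identity lowers the rank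
  somewhere and so picks an entry below the diagonal.\<close>

lemma det_triangular:
  fixes A :: "'a::comm_ring_1^'n^'n" and r :: "'n \<Rightarrow> nat"
  assumes "inj r" "\<And>i j. r j < r i \<Longrightarrow> A $ i $ j = 0"
  shows "det A = (\<Prod>i\<in>UNIV. A $ i $ i)"
proof -
  let ?f = "\<lambda>p. of_int (sign p) * (\<Prod>i\<in>UNIV. A $ i $ p i)"
  have "?f p = 0" if "p permutes UNIV" "p \<noteq> id" for p
  proof -
    have "\<exists>i. r (p i) < r i"
    proof (rule ccontr)
      assume "\<not> ?thesis"
      then have le: "r i \<le> r (p i)" for i by (simp add: not_less)
      have "r (inv p i) \<le> r i" for i
        using le[of "inv p i"] that(1) by (simp add: permutes_inverses)
      then have "inv p = id"
        using permutes_id_if_rank_le[OF permutes_inv[OF that(1)] assms(1)] by blast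
      then show False
        using that by (metis permutes_inv_inv inv_id)
    qed
    then obtain i where "r (p i) < r i" by blast
    then have "(\<Prod>i\<in>UNIV. A $ i $ p i) = 0"
      using assms(2) by (intro prod_zero) auto
    then show ?thesis by simp
  qed
  then have "(\<Sum>p | p permutes UNIV. ?f p) = (\<Sum>p\<in>{id}. ?f p)"
    by (intro sum.mono_neutral_right) (auto simp: permutes_id)
  then show ?thesis
    by (simp add: det_def)
qed

text \<open>Telescoping: one factor is exchanged at a time. Because \<open>B \<ge> 1\<close>, the
  exponent may be rounded up to the full cardinality, which keeps the induction uniform.\<close>

lemma norm_prod_diff_le:
  fixes a b :: "'i \<Rightarrow> complex"
  assumes "finite S" "\<And>i. i \<in> S \<Longrightarrow> norm (a i) \<le> B" "\<And>i. i \<in> S \<Longrightarrow> norm (b i) \<le> B"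
    and "\<And>i. i \<in> S \<Longrightarrow> norm (a i - b i) \<le> e" and "B \<ge> 1" "e \<ge> 0"
  shows "norm ((\<Prod>i\<in>S. a i) - (\<Prod>i\<in>S. b i)) \<le> real (card S) * B ^ card S * e"
  using assms
proof (induction S rule: finite_induct)
  case empty
  then show ?case by simp
next
  case (insert x F)
  have pb: "norm (\<Prod>i\<in>F. b i) \<le> B ^ card F"
    unfolding prod_norm[symmetric] using insert by (intro prod_le_power) auto
  have "(\<Prod>i\<in>insert x F. a i) - (\<Prod>i\<in>insert x F. b i) =
      a x * ((\<Prod>i\<in>F. a i) - (\<Prod>i\<in>F. b i)) + (a x - b x) * (\<Prod>i\<in>F. b i)"
    using insert by (simp add: algebra_simps)
  also have "norm \<dots> \<le> B * (real (card F) * B ^ card F * e) + e * B ^ card F"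
    using insert pb
    by (intro norm_triangle_mono) (auto simp: norm_mult intro!: mult_mono)
  also have "\<dots> \<le> B * (real (card F) * B ^ card F * e) + e * (B * B ^ card F)"
    using insert.prems by (intro add_left_mono mult_left_mono) (auto intro: mult_left_mono[of 1 B, simplified] order_trans)
  finally show ?case
    using insert by (simp add: algebra_simps)
qed

lemma norm_det_diff_le:
  fixes A A' :: "complex^'n^'n" and B e :: real
  assumes "\<And>i j. norm (A $ i $ j) \<le> B" "\<And>i j. norm (A' $ i $ j) \<le> B"
    and "\<And>i j. norm (A $ i $ j - A' $ i $ j) \<le> e" and "B \<ge> 1" "e \<ge> 0"
  shows "norm (det A - det A') \<le> fact CARD('n) * (CARD('n) * B ^ CARD('n)) * e"
proof -
  have "norm (det A - det A') = norm (\<Sum>p | p permutes UNIV.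
      of_int (sign p) * ((\<Prod>i\<in>UNIV. A $ i $ p i) - (\<Prod>i\<in>UNIV. A' $ i $ p i)))"
    by (simp add: det_def sum_subtractf[symmetric] algebra_simps)
  also have "\<dots> \<le> (\<Sum>p | p permutes (UNIV::'n set). real CARD('n) * B ^ CARD('n) * e)"
  proof (rule sum_norm_le)
    fix p :: "'n \<Rightarrow> 'n"
    have "norm (of_int (sign p) :: complex) = 1"
      by (simp add: sign_def)
    then show "norm (of_int (sign p) * ((\<Prod>i\<in>UNIV. A $ i $ p i) - (\<Prod>i\<in>UNIV. A' $ i $ p i)))
        \<le> real CARD('n) * B ^ CARD('n) * e"
      using norm_prod_diff_le[of UNIV "\<lambda>i. A $ i $ p i" B "\<lambda>i. A' $ i $ p i" e] assms
      by (simp add: norm_mult)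
  qed
  also have "\<dots> = fact CARD('n) * (CARD('n) * B ^ CARD('n)) * e"
    by (simp add: card_permutations)
  finally show ?thesis .
qed

lemma norm_det_le:
  fixes A :: "complex^'n^'n" and B :: real
  assumes "\<And>i j. norm (A $ i $ j) \<le> B"
  shows "norm (det A) \<le> fact CARD('n) * B ^ CARD('n)"
proof -
  have "norm (det A) \<le> (\<Sum>p | p permutes (UNIV::'n set). B ^ CARD('n))"
    unfolding det_def
  proof (rule sum_norm_le)
    fix p :: "'n \<Rightarrow> 'n"
    have "norm (of_int (sign p) :: complex) = 1"
      by (simp add: sign_def)
    moreover have "norm (\<Prod>i\<in>UNIV. A $ i $ p i) \<le> B ^ CARD('n)"
      using prod_mono[of UNIV "\<lambda>i. norm (A $ i $ p i)" "\<lambda>_. B"] assms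
      by (simp add: prod_norm[symmetric])
    ultimately show "norm (of_int (sign p) * (\<Prod>i\<in>UNIV. A $ i $ p i)) \<le> B ^ CARD('n)"
      by (simp add: norm_mult)
  qed
  then show ?thesis by (simp add: card_permutations)
qed

section \<open>Spectral subspaces\<close>

lemma mat_mult_vec [simp]: "mat c *v (v :: 'a::comm_semiring_1^'n) = c *s v"
  by (simp add: vec_eq_iff matrix_vector_mult_def mat_def if_distrib[where f = "\<lambda>x. x * _"] cong: if_cong)

text \<open>Membership in a spectral subspace is only used through an annihilating product of
  factors \<open>M - \<mu>\<close>.\<close>

primrec shift_prod :: "complex^'n^'n \<Rightarrow> complex list \<Rightarrow> complex^'n \<Rightarrow> complex^'n" where
  "shift_prod M [] v = v"
| "shift_prod M (\<mu> # \<mu>s) v = shift_prod M \<mu>s ((M - mat \<mu>) *v v)"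

lemma shift_prod_append: "shift_prod M (\<mu>s @ \<nu>s) v = shift_prod M \<nu>s (shift_prod M \<mu>s v)"
  by (induction \<mu>s arbitrary: v) auto

lemma shift_prod_add: "shift_prod M \<mu>s (v + w) = shift_prod M \<mu>s v + shift_prod M \<mu>s w"
  by (induction \<mu>s arbitrary: v w) (auto simp: matrix_vector_right_distrib)

lemma shift_prod_scale: "shift_prod M \<mu>s (c *s v) = c *s shift_prod M \<mu>s v"
  by (induction \<mu>s arbitrary: v) (auto simp: vec.scale)

lemma shift_prod_0 [simp]: "shift_prod M \<mu>s 0 = 0"
  by (induction \<mu>s) auto

lemma shift_commute: "(M - mat \<mu>) *v ((M - mat \<nu>) *v v) = (M - mat \<nu>) *v ((M - mat \<mu>) *v v)"
  for M :: "complex^'n^'n"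
  by (simp add: algebra_simps vec.scale vec.diff vector_smult_assoc)

lemma shift_prod_commute1: "shift_prod M \<mu>s ((M - mat \<mu>) *v v) = (M - mat \<mu>) *v shift_prod M \<mu>s v"
  by (induction \<mu>s arbitrary: v) (simp_all only: shift_prod.simps, metis shift_commute)

lemma shift_prod_commute: "shift_prod M \<mu>s (shift_prod M \<nu>s v) = shift_prod M \<nu>s (shift_prod M \<mu>s v)"
  by (induction \<nu>s arbitrary: v) (auto simp: shift_prod_commute1)

lemma shift_prod_replicate: "shift_prod M (replicate k \<mu>) v = ((\<lambda>w. (M - mat \<mu>) *v w) ^^ k) v"
  by (induction k arbitrary: v) (simp_all add: funpow_swap1)

text \<open>The factors \<open>M - mat \<mu>\<close> commute, so two annihilating lists can be
  concatenated to annihilate a sum. Hence the annihilated vectors form a subspace, and it contains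
  every generator of the span.\<close>

lemma spectral_subspace_annihilated:
  assumes "v \<in> spectral_subspace M S"
  shows "\<exists>\<mu>s. set \<mu>s \<subseteq> S \<and> shift_prod M \<mu>s v = 0"
proof -
  let ?V = "{v. \<exists>\<mu>s. set \<mu>s \<subseteq> S \<and> shift_prod M \<mu>s v = 0}"
  have "vec.subspace ?V"
  proof (rule vec.subspaceI)
    show "0 \<in> ?V" by (auto intro: exI[of _ "[]"])
  next
    fix v w assume "v \<in> ?V" "w \<in> ?V"
    then obtain \<mu>s \<nu>s where *: "set \<mu>s \<subseteq> S" "shift_prod M \<mu>s v = 0" "set \<nu>s \<subseteq> S" "shift_prod M \<nu>s w = 0"
      by blast
    then have "shift_prod M (\<mu>s @ \<nu>s) (v + w) = 0"
      using shift_prod_commute[of M \<mu>s \<nu>s w] by (simp add: shift_prod_append shift_prod_add)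
    with * show "v + w \<in> ?V"
      by (intro CollectI exI[of _ "\<mu>s @ \<nu>s"]) auto
  next
    fix c v assume "v \<in> ?V"
    then show "c *s v \<in> ?V"
      using shift_prod_scale[of M _ c v] by auto
  qed
  moreover have "generalized_eigenspace M \<mu> \<subseteq> ?V" if "\<mu> \<in> S" for \<mu>
  proof
    fix v assume "v \<in> generalized_eigenspace M \<mu>"
    then obtain k where "shift_prod M (replicate k \<mu>) v = 0"
      unfolding generalized_eigenspace_def shift_prod_replicate by blast
    then show "v \<in> ?V" using that
      by (intro CollectI exI[of _ "replicate k \<mu>"]) auto
  qed
  ultimately have "spectral_subspace M S \<subseteq> ?V"
    unfolding spectral_subspace_def by (intro vec.span_minimal) auto
  with assms show ?thesis by blast
qed

lemma spectral_subspace_invariant: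
  assumes "v \<in> spectral_subspace M S"
  shows "M *v v \<in> spectral_subspace M S"
proof -
  let ?G = "\<Union>\<mu>\<in>S. generalized_eigenspace M \<mu>"
  have "M *v w \<in> ?G" if w: "w \<in> ?G" for w
  proof -
    obtain \<mu> k where \<mu>: "\<mu> \<in> S" "((\<lambda>w. (M - mat \<mu>) *v w) ^^ k) w = 0"
      using w by (auto simp: generalized_eigenspace_def)
    have "((\<lambda>w. (M - mat \<mu>) *v w) ^^ k) (M *v w) = M *v (((\<lambda>w. (M - mat \<mu>) *v w) ^^ k) w)"
    proof (induction k)
      case (Suc k)
      then show ?case
        by (simp add: algebra_simps vec.scale vec.diff)
    qed auto
    then show ?thesis
      using \<mu> by (auto simp: generalized_eigenspace_def)
  qed
  then have "(*v) M ` ?G \<subseteq> ?G" by blast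
  then have "(*v) M ` vec.span ?G \<subseteq> vec.span ?G"
    using vec.span_image[of M ?G] by (metis vec.span_mono)
  with assms show ?thesis
    unfolding spectral_subspace_def by blast
qed

lemma subspace_shift_invariant:
  fixes M :: "complex^'n^'n"
  assumes "vec.subspace V" "\<And>v. v \<in> V \<Longrightarrow> M *v v \<in> V" "v \<in> V"
  shows "(M - mat \<mu>) *v v \<in> V"
  using assms by (simp add: matrix_vector_mult_diff_rdistrib vec.subspace_diff vec.subspace_scale)

text \<open>Apply the factors one at a time and stop at the first that carries the vector into
  \<open>W\<close>. The vector just before that step is an eigenvector of \<open>M\<close> modulo
  \<open>W\<close>; flags obtain their next member in this way.\<close>

lemma shift_prod_drop:
  fixes M :: "complex^'n^'n"
  assumes "shift_prod M \<mu>s v \<in> W" "v \<notin> W" "v \<in> V"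
    and "vec.subspace V" "\<And>v. v \<in> V \<Longrightarrow> M *v v \<in> V"
  shows "\<exists>u \<mu>. \<mu> \<in> set \<mu>s \<and> u \<in> V \<and> u \<notin> W \<and> (M - mat \<mu>) *v u \<in> W"
  using assms(1-3)
proof (induction \<mu>s arbitrary: v)
  case (Cons \<mu> \<mu>s)
  show ?case
  proof (cases "(M - mat \<mu>) *v v \<in> W")
    case True
    then show ?thesis using Cons.prems by auto
  next
    case False
    then show ?thesis
      using Cons.IH[of "(M - mat \<mu>) *v v"] Cons.prems subspace_shift_invariant[OF assms(4,5)] by auto
  qed
qed auto

section \<open>Orthonormal flags of invariant subspaces\<close>

definition cinner :: "complex^'n \<Rightarrow> complex^'n \<Rightarrow> complex" where
  "cinner x y = (\<Sum>i\<in>UNIV. cnj (x $ i) * y $ i)"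

lemma cinner_add_right: "cinner x (y + z) = cinner x y + cinner x z"
  by (simp add: cinner_def algebra_simps sum.distrib)

lemma cinner_diff_right: "cinner x (y - z) = cinner x y - cinner x z"
  by (simp add: cinner_def algebra_simps sum_subtractf)

lemma cinner_scale_right: "cinner x (c *s y) = c * cinner x y"
  by (simp add: cinner_def sum_distrib_left mult_ac)

lemma cinner_scale_left: "cinner (c *s x) y = cnj c * cinner x y"
  by (simp add: cinner_def sum_distrib_left mult_ac)

lemma cinner_zero_right [simp]: "cinner x 0 = 0"
  by (simp add: cinner_def)

lemma cinner_sum_right: "cinner x (\<Sum>k\<in>S. f k) = (\<Sum>k\<in>S. cinner x (f k))"
  by (induction S rule: infinite_finite_induct) (auto simp: cinner_add_right)

lemma cinner_commute: "cinner y x = cnj (cinner x y)"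
  by (simp add: cinner_def mult.commute)

lemma cinner_self: "cinner x x = of_real ((norm x)\<^sup>2)"
proof -
  have "cinner x x = (\<Sum>i\<in>UNIV. of_real ((norm (x $ i))\<^sup>2))"
    unfolding cinner_def by (intro sum.cong refl) (metis complex_norm_square mult.commute)
  then show ?thesis
    by (simp add: norm_vec_def L2_set_def sum_nonneg)
qed

lemma cinner_expand:
  fixes v :: "nat \<Rightarrow> complex^'n"
  assumes "\<And>j k. j < m \<Longrightarrow> k < m \<Longrightarrow> cinner (v j) (v k) = of_bool (j = k)"
    and "w \<in> vec.span (v ` {..<m})"
  shows "w = (\<Sum>k<m. cinner (v k) w *s v k)"
  using assms(2)
proof (induction rule: vec.span_induct_alt)
  case base
  then show ?case by simp
next
  case (step c x y)
  from step(1) obtain j where j: "j < m" "x = v j" by blast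
  have "(\<Sum>k<m. cinner (v k) (c *s x + y) *s v k) =
      (\<Sum>k<m. (c * cinner (v k) (v j)) *s v k) + (\<Sum>k<m. cinner (v k) y *s v k)"
    by (simp add: cinner_add_right cinner_scale_right j sum.distrib vec.scale_left_distrib)
  also have "(\<Sum>k<m. (c * cinner (v k) (v j)) *s v k) = (\<Sum>k<m. if k = j then c *s v k else 0)"
    using assms(1) j by (intro sum.cong) auto
  finally show ?case
    using step(2) j by simp
qed

text \<open>Schur triangularization inside \<open>V\<close>. If \<open>W\<close> is the span of the
  vectors found so far, take an eigenvector modulo \<open>W\<close>, subtract its orthogonal
  projection onto \<open>W\<close>, and normalize. Since \<open>W\<close> is invariant, the
  subtraction does not spoil the eigenvector property modulo \<open>W\<close>. The eigenvalues lie
  in \<open>S\<close> because the annihilating lists do.\<close>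

lemma invariant_flag:
  fixes M :: "complex^'n^'n"
  assumes V: "vec.subspace V" "\<And>v. v \<in> V \<Longrightarrow> M *v v \<in> V"
    and ann: "\<And>v. v \<in> V \<Longrightarrow> \<exists>\<mu>s. set \<mu>s \<subseteq> S \<and> shift_prod M \<mu>s v = 0"
    and "m \<le> vec.dim V"
  shows "\<exists>v \<mu>. (\<forall>k<m. v k \<in> V \<and> \<mu> k \<in> S \<and> (M - mat (\<mu> k)) *v v k \<in> vec.span (v ` {..<k})) \<and>
    (\<forall>j<m. \<forall>k<m. cinner (v j) (v k) = of_bool (j = k))"
  using \<open>m \<le> vec.dim V\<close>
proof (induction m)
  case 0
  then show ?case by simp
next
  case (Suc m)
  then obtain v \<mu> where IH: "\<And>k. k < m \<Longrightarrow> v k \<in> V" "\<And>k. k < m \<Longrightarrow> \<mu> k \<in> S"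
      "\<And>k. k < m \<Longrightarrow> (M - mat (\<mu> k)) *v v k \<in> vec.span (v ` {..<k})"
      "\<And>j k. j < m \<Longrightarrow> k < m \<Longrightarrow> cinner (v j) (v k) = of_bool (j = k)"
    by (metis Suc_leD)
  define W where "W = vec.span (v ` {..<m})"
  have W: "vec.subspace W" by (simp add: W_def)
  have vW: "v k \<in> W" if "k < m" for k
    using that by (auto simp: W_def intro: vec.span_base)
  have MW: "M *v w \<in> W" if "w \<in> W" for w
  proof -
    have "M *v v k \<in> W" if k: "k < m" for k
    proof -
      have "(M - mat (\<mu> k)) *v v k \<in> W"
        using IH(3)[OF k] vec.span_mono[of "v ` {..<k}" "v ` {..<m}"] k
        by (auto simp: W_def image_mono)
      then have "(M - mat (\<mu> k)) *v v k + \<mu> k *s v k \<in> W"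
        using W vW[OF k] by (intro vec.subspace_add vec.subspace_scale)
      then show ?thesis by (simp add: matrix_vector_mult_diff_rdistrib)
    qed
    then have "(*v) M ` (v ` {..<m}) \<subseteq> W" by blast
    then have "vec.span ((*v) M ` (v ` {..<m})) \<subseteq> W"
      using W by (intro vec.span_minimal)
    then show ?thesis
      using that vec.span_image[of M "v ` {..<m}"] by (auto simp: W_def)
  qed
  have "vec.dim W \<le> card (v ` {..<m})"
    unfolding W_def by (simp add: vec.dim_le_card')
  also have "\<dots> \<le> m" using card_image_le[of "{..<m}" v] by simp
  also have "m < vec.dim V" using Suc.prems by simp
  finally have "\<not> V \<subseteq> W"
    using vec.dim_subset[of V W] by linarith
  then obtain x where x: "x \<in> V" "x \<notin> W" by blast
  obtain \<mu>s where \<mu>s: "set \<mu>s \<subseteq> S" "shift_prod M \<mu>s x = 0"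
    using ann[OF x(1)] by blast
  then have "shift_prod M \<mu>s x \<in> W" using W by (simp add: vec.subspace_0)
  then obtain u \<nu> where u: "\<nu> \<in> S" "u \<in> V" "u \<notin> W" "(M - mat \<nu>) *v u \<in> W"
    using shift_prod_drop[of M \<mu>s x W V] x V \<mu>s(1) by (metis subset_iff)
  define p where "p = (\<Sum>k<m. cinner (v k) u *s v k)"
  have p: "p \<in> W" "p \<in> V"
    unfolding p_def using W V(1) vW IH(1) by (auto intro!: vec.subspace_sum vec.subspace_scale)
  define y where "y = u - p"
  have y: "y \<in> V" "y \<noteq> 0"
    using u p V(1) by (auto simp: y_def vec.subspace_diff)
  have ortho: "cinner (v j) y = 0" if "j < m" for j
  proof -
    have "cinner (v j) p = (\<Sum>k<m. if k = j then cinner (v k) u else 0)"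
      unfolding p_def cinner_sum_right using IH(4) that
      by (intro sum.cong) (auto simp: cinner_scale_right)
    then show ?thesis
      using that by (simp add: y_def cinner_diff_right)
  qed
  define q where "q = complex_of_real (inverse (norm y)) *s y"
  have "(M - mat \<nu>) *v y \<in> W"
    unfolding y_def vec.diff by (rule vec.subspace_diff[OF W u(4) subspace_shift_invariant[OF W MW p(1)]])
  then have qW: "(M - mat \<nu>) *v q \<in> W"
    using W by (simp add: q_def vec.scale vec.subspace_scale)
  have qV: "q \<in> V"
    using V(1) y by (simp add: q_def vec.subspace_scale)
  have qq: "cinner q q = 1"
    unfolding q_def cinner_scale_left cinner_scale_right cinner_self[of y]
    using y(2) by (simp add: power2_eq_square field_simps)
  have vq: "cinner (v j) q = 0" if "j < m" for j
    using ortho[OF that] by (simp add: q_def cinner_scale_right)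
  then have qv: "cinner q (v j) = 0" if "j < m" for j
    using cinner_commute[of q "v j"] that by simp
  let ?v = "v(m := q)" and ?\<mu> = "\<mu>(m := \<nu>)"
  have im: "{..<k} \<inter> {x. x \<noteq> m} = {..<k}" if "k \<le> m" for k
    using that by auto
  have "\<forall>k<Suc m. ?v k \<in> V \<and> ?\<mu> k \<in> S \<and> (M - mat (?\<mu> k)) *v ?v k \<in> vec.span (?v ` {..<k})"
    using IH(1-3) u(1) qV qW im by (auto simp: less_Suc_eq W_def)
  moreover have "\<forall>j<Suc m. \<forall>k<Suc m. cinner (?v j) (?v k) = of_bool (j = k)"
    using IH(4) qq vq qv by (auto simp: less_Suc_eq)
  ultimately show ?case by blast
qed

text \<open>The given columns enter only through their number, which fixes the dimension. They are
  exchanged for orthonormal ones, so a badly conditioned basis cannot affect later constants. The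
  map \<open>\<rho>\<close> remembers the position in the flag after the vectors have been
  re-indexed by \<open>I\<close>.\<close>

lemma spectral_flag:
  fixes M R :: "complex^'n^'n"
  assumes "columns_basis R I (spectral_subspace M S)"
  shows "\<exists>\<rho> v. inj_on \<rho> I \<and> (\<forall>j\<in>I. \<rho> j < CARD('n)) \<and> (\<forall>j\<in>I. v j \<in> spectral_subspace M S) \<and>
    (\<forall>j\<in>I. \<forall>k\<in>I. cinner (v j) (v k) = of_bool (j = k)) \<and>
    (\<forall>k\<in>I. M *v v k = (\<Sum>j\<in>I. cinner (v j) (M *v v k) *s v j)) \<and>
    (\<forall>j\<in>I. \<forall>k\<in>I. \<rho> k < \<rho> j \<longrightarrow> cinner (v j) (M *v v k) = 0) \<and>
    (\<forall>k\<in>I. cinner (v k) (M *v v k) \<in> S)"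
proof -
  define V where "V = spectral_subspace M S"
  have V: "vec.subspace V" "\<And>v. v \<in> V \<Longrightarrow> M *v v \<in> V"
    using spectral_subspace_invariant by (auto simp: V_def spectral_subspace_def)
  have "vec.dim V = card ((\<lambda>j. column j R) ` I)"
    using assms unfolding columns_basis_def V_def by (metis vec.dim_span_eq_card_independent)
  then have dimV: "vec.dim V = card I"
    using assms by (simp add: columns_basis_def card_image)
  obtain v \<mu> where v: "\<And>k. k < card I \<Longrightarrow> v k \<in> V" "\<And>k. k < card I \<Longrightarrow> \<mu> k \<in> S"
      "\<And>k. k < card I \<Longrightarrow> (M - mat (\<mu> k)) *v v k \<in> vec.span (v ` {..<k})"
      "\<And>j k. j < card I \<Longrightarrow> k < card I \<Longrightarrow> cinner (v j) (v k) = of_bool (j = k)"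
    using invariant_flag[OF V, of S "card I"] spectral_subspace_annihilated[of _ M S]
    unfolding V_def[symmetric] dimV by (metis order_refl)
  have inj: "inj_on v {..<card I}"
  proof (rule inj_onI)
    fix j k assume "j \<in> {..<card I}" "k \<in> {..<card I}" "v j = v k"
    then show "j = k"
      using v(4)[of j k] v(4)[of j j] by (auto split: if_splits)
  qed
  have indep: "vec.independent (v ` {..<card I})"
  proof (rule vec.independent_if_scalars_zero)
    fix f x assume sum0: "(\<Sum>x\<in>v ` {..<card I}. f x *s x) = 0" and "x \<in> v ` {..<card I}"
    then obtain j where j: "j < card I" "x = v j" by blast
    have "0 = cinner (v j) (\<Sum>k<card I. f (v k) *s v k)"
      using sum0 by (simp add: sum.reindex[OF inj])
    also have "\<dots> = (\<Sum>k<card I. if k = j then f (v k) else 0)"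
      unfolding cinner_sum_right using v(4) j
      by (intro sum.cong) (auto simp: cinner_scale_right)
    finally show "f x = 0" using j by simp
  qed simp
  have "v ` {..<card I} \<subseteq> V"
    using v(1) by blast
  then have "V \<subseteq> vec.span (v ` {..<card I})"
    using indep dimV card_image[OF inj] by (intro vec.card_ge_dim_independent) auto
  then have expand: "w = (\<Sum>k<card I. cinner (v k) w *s v k)" if "w \<in> V" for w
    using that v(4) by (intro cinner_expand) auto
  obtain \<rho> where \<rho>: "bij_betw \<rho> I {..<card I}"
    using ex_bij_betw_finite_nat[of I] by (auto simp: atLeast0LessThan)
  have \<rho>I: "\<rho> j < card I" if "j \<in> I" for j
    using \<rho> that by (auto simp: bij_betw_def)
  have \<rho>_eq: "\<rho> j = \<rho> k \<longleftrightarrow> j = k" if "j \<in> I" "k \<in> I" for j k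
    using \<rho> that by (metis bij_betw_imp_inj_on inj_on_eq_iff)
  \<comment> \<open>Membership of \<open>(M - mat (\<mu> k)) *v v k\<close> in the span of the
    earlier vectors makes all of its coefficients from position \<open>k\<close> onward
    vanish.\<close>
  have tri: "cinner (v j) (M *v v k) = (if j = k then \<mu> k else 0)"
    if "k \<le> j" "j < card I" for j k
  proof -
    have "cinner (v j) w = 0" if "w \<in> vec.span (v ` {..<k})" for w
      using that
    proof (induction rule: vec.span_induct_alt)
      case (step c x y)
      then show ?case
        using v(4) \<open>k \<le> j\<close> \<open>j < card I\<close> by (auto simp: cinner_add_right cinner_scale_right)
    qed simp
    then have "cinner (v j) ((M - mat (\<mu> k)) *v v k) = 0"
      using v(3)[of k] that by simp
    then have "cinner (v j) (M *v v k) = \<mu> k * cinner (v j) (v k)"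
      by (simp add: matrix_vector_mult_diff_rdistrib cinner_diff_right cinner_scale_right)
    then show ?thesis
      using v(4) that by simp
  qed
  have "card I \<le> CARD('n)"
    by (simp add: card_mono)
  then have \<rho>N: "\<forall>j\<in>I. \<rho> j < CARD('n)"
    using \<rho>I by (meson less_le_trans)
  have inj\<rho>: "inj_on \<rho> I"
    using \<rho> by (rule bij_betw_imp_inj_on)
  have exp: "\<forall>k\<in>I. M *v v (\<rho> k) = (\<Sum>j\<in>I. cinner (v (\<rho> j)) (M *v v (\<rho> k)) *s v (\<rho> j))"
  proof
    fix k assume "k \<in> I"
    show "M *v v (\<rho> k) = (\<Sum>j\<in>I. cinner (v (\<rho> j)) (M *v v (\<rho> k)) *s v (\<rho> j))"
      using expand[OF V(2)[OF v(1)[OF \<rho>I[OF \<open>k \<in> I\<close>]]]]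
        sum.reindex_bij_betw[OF \<rho>, of "\<lambda>j. cinner (v j) (M *v v (\<rho> k)) *s v j"] by simp
  qed
  have zero: "\<forall>j\<in>I. \<forall>k\<in>I. \<rho> k < \<rho> j \<longrightarrow> cinner (v (\<rho> j)) (M *v v (\<rho> k)) = 0"
    using tri \<rho>I by (simp add: less_imp_le)
  have diag: "\<forall>k\<in>I. cinner (v (\<rho> k)) (M *v v (\<rho> k)) \<in> S"
    using tri \<rho>I v(2) by simp
  have on: "\<forall>j\<in>I. \<forall>k\<in>I. cinner (v (\<rho> j)) (v (\<rho> k)) = of_bool (j = k)"
    using v(4) \<rho>I \<rho>_eq by simp
  show ?thesis
    unfolding V_def[symmetric]
    using inj\<rho> \<rho>N exp zero diag on v(1) \<rho>I
    by (intro exI[of _ \<rho>] exI[of _ "\<lambda>j. v (\<rho> j)"] conjI) blast+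
qed

section \<open>Block triangular form\<close>

text \<open>\<open>R\<close> conjugates \<open>M\<close> to \<open>T\<close>, which is block diagonal with respect to \<open>J\<close> and upper triangular
  in the order of the ranks \<open>r\<close>; the columns of \<open>R\<close> are orthonormal within each block only.\<close>

definition block_flag where
  "block_flag M J r R T \<longleftrightarrow> M ** R = R ** T \<and>
     (\<forall>j k. (j \<in> J) \<noteq> (k \<in> J) \<longrightarrow> T $ j $ k = 0) \<and>
     (\<forall>j k. r k < r j \<longrightarrow> T $ j $ k = 0) \<and>
     (\<forall>j k. (j \<in> J) = (k \<in> J) \<longrightarrow> cinner (column j R) (column k R) = of_bool (j = k))"
  for r :: "'n::finite \<Rightarrow> nat" and M R T :: "complex^'n^'n"

definition diagonal_gap where
  "diagonal_gap \<eta> J T \<longleftrightarrow> (\<forall>j. (j \<in> J \<longrightarrow> \<eta> \<le> Re (T $ j $ j)) \<and> (j \<notin> J \<longrightarrow> Re (T $ j $ j) \<le> - \<eta>))"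
  for T :: "complex^'n^'n"

lemma mult_vec_columns: "(R :: complex^'n^'n) *v y = (\<Sum>j\<in>UNIV. y $ j *s column j R)"
  by (simp add: vec_eq_iff matrix_vector_mult_def column_def mult.commute)

lemma column_mult: "column k (A ** B) = A *v column k (B :: complex^'n^'n)"
  by (simp add: vec_eq_iff matrix_vector_mult_def matrix_matrix_mult_def column_def)

lemma matrix_eq_columns: "(A :: complex^'n^'n) = B \<longleftrightarrow> (\<forall>k. column k A = column k B)"
  by (auto simp: vec_eq_iff column_def)

text \<open>The ranks of the stable block are shifted by \<open>CARD('n)\<close>, so one injective
  rank triangularizes both blocks at once. The bound \<open>2 * CARD('n)\<close> leaves finitely
  many possible ranks, which is needed for a uniform constant.\<close>

lemma hyperbolic_frame_block_flag:
  fixes M R0 :: "complex^'n^'n"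
  assumes "hyperbolic_frame M R0 J"
  shows "\<exists>r R T. inj r \<and> (\<forall>j. r j < 2 * CARD('n)) \<and> block_flag M J r R T \<and>
    (\<forall>j\<in>J. 0 < Re (T $ j $ j) \<and> column j R \<in> unstable_subspace M) \<and>
    (\<forall>j\<in>-J. Re (T $ j $ j) < 0 \<and> column j R \<in> stable_subspace M)"
proof -
  obtain \<rho>1 v1 where 1: "inj_on \<rho>1 J" "\<And>j. j \<in> J \<Longrightarrow> \<rho>1 j < CARD('n)"
      "\<And>j. j \<in> J \<Longrightarrow> v1 j \<in> unstable_subspace M"
      "\<And>j k. j \<in> J \<Longrightarrow> k \<in> J \<Longrightarrow> cinner (v1 j) (v1 k) = of_bool (j = k)"
      "\<And>k. k \<in> J \<Longrightarrow> M *v v1 k = (\<Sum>j\<in>J. cinner (v1 j) (M *v v1 k) *s v1 j)"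
      "\<And>j k. j \<in> J \<Longrightarrow> k \<in> J \<Longrightarrow> \<rho>1 k < \<rho>1 j \<Longrightarrow> cinner (v1 j) (M *v v1 k) = 0"
      "\<And>k. k \<in> J \<Longrightarrow> cinner (v1 k) (M *v v1 k) \<in> {\<mu>. Re \<mu> > 0}"
    using spectral_flag[of R0 J M "{\<mu>. Re \<mu> > 0}"] assms unfolding hyperbolic_frame_def by blast
  obtain \<rho>2 v2 where 2: "inj_on \<rho>2 (-J)" "\<And>j. j \<in> -J \<Longrightarrow> \<rho>2 j < CARD('n)"
      "\<And>j. j \<in> -J \<Longrightarrow> v2 j \<in> stable_subspace M"
      "\<And>j k. j \<in> -J \<Longrightarrow> k \<in> -J \<Longrightarrow> cinner (v2 j) (v2 k) = of_bool (j = k)"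
      "\<And>k. k \<in> -J \<Longrightarrow> M *v v2 k = (\<Sum>j\<in>-J. cinner (v2 j) (M *v v2 k) *s v2 j)"
      "\<And>j k. j \<in> -J \<Longrightarrow> k \<in> -J \<Longrightarrow> \<rho>2 k < \<rho>2 j \<Longrightarrow> cinner (v2 j) (M *v v2 k) = 0"
      "\<And>k. k \<in> -J \<Longrightarrow> cinner (v2 k) (M *v v2 k) \<in> {\<mu>. Re \<mu> < 0}"
    using spectral_flag[of R0 "-J" M "{\<mu>. Re \<mu> < 0}"] assms unfolding hyperbolic_frame_def by blast
  define r where "r j = (if j \<in> J then \<rho>1 j else CARD('n) + \<rho>2 j)" for j
  define v where "v j = (if j \<in> J then v1 j else v2 j)" for j
  define R :: "complex^'n^'n" where "R = (\<chi> i j. v j $ i)"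
  define T :: "complex^'n^'n" where
    "T = (\<chi> j k. if (j \<in> J) = (k \<in> J) then cinner (v j) (M *v v k) else 0)"
  have col: "column j R = v j" for j
    by (simp add: R_def column_def vec_eq_iff)
  have "M *v v k = R *v column k T" for k
  proof -
    have "R *v column k T = (\<Sum>j\<in>UNIV. T $ j $ k *s v j)"
      by (simp add: mult_vec_columns col) (simp add: column_def)
    also have "\<dots> = (\<Sum>j\<in>(if k \<in> J then J else -J). cinner (v j) (M *v v k) *s v j)"
      by (intro sum.mono_neutral_cong_right) (auto simp: T_def)
    also have "\<dots> = M *v v k"
      using 1(5)[of k] 2(5)[of k] by (auto simp: v_def intro!: sum.cong)
    finally show ?thesis by simp
  qed
  then have "M ** R = R ** T"
    by (simp add: matrix_eq_columns column_mult col)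
  moreover have "T $ j $ k = 0" if "r k < r j" for j k
    using that 1(6)[of j k] 2(6)[of j k] by (auto simp: T_def r_def v_def)
  moreover have "T $ j $ k = 0" if "(j \<in> J) \<noteq> (k \<in> J)" for j k
    using that by (simp add: T_def)
  moreover have "cinner (column j R) (column k R) = of_bool (j = k)" if "(j \<in> J) = (k \<in> J)" for j k
    using that 1(4)[of j k] 2(4)[of j k] by (cases "j \<in> J") (simp_all add: col v_def)
  ultimately have "block_flag M J r R T"
    unfolding block_flag_def by blast
  moreover have "inj r"
  proof (rule injI)
    fix j k assume "r j = r k"
    then show "j = k"
      using 1(1) 1(2)[of j] 1(2)[of k] 2(1) by (auto simp: inj_on_def r_def split: if_splits)
  qed
  moreover have "r j < 2 * CARD('n)" for j
    using 1(2)[of j] 2(2)[of j] by (auto simp: r_def)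
  ultimately show ?thesis
    using 1(3,7) 2(3,7)
    by (intro exI[of _ r] exI[of _ R] exI[of _ T]) (auto simp: T_def v_def col)
qed

text \<open>In the row of a coordinate that has maximal rank in its block, a triangular matrix acts
  by its diagonal entry.\<close>

lemma triangular_top_row:
  fixes T :: "complex^'n^'n" and r :: "'n \<Rightarrow> nat"
  assumes "inj r" "\<And>j k. (j \<in> J) \<noteq> (k \<in> J) \<Longrightarrow> T $ j $ k = 0" "\<And>j k. r k < r j \<Longrightarrow> T $ j $ k = 0"
    and "\<And>l. (l \<in> J) = (k \<in> J) \<Longrightarrow> r k < r l \<Longrightarrow> y $ l = 0"
  shows "(T *v y) $ k = T $ k $ k * y $ k"
proof -
  have "(T *v y) $ k = (\<Sum>l\<in>UNIV. T $ k $ l * y $ l)"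
    by (simp add: matrix_vector_mult_def)
  also have "\<dots> = (\<Sum>l\<in>{k}. T $ k $ l * y $ l)"
  proof (intro sum.mono_neutral_right ballI)
    fix l assume "l \<in> UNIV - {k}"
    then have "r l \<noteq> r k" using assms(1) by (auto simp: inj_eq)
    then consider "(k \<in> J) \<noteq> (l \<in> J)" | "r l < r k" | "(l \<in> J) = (k \<in> J)" "r k < r l"
      using nat_neq_iff[of "r l" "r k"] by blast
    then show "T $ k $ l * y $ l = 0"
      using assms(2)[of k l] assms(3)[of l k] assms(4)[of l] by cases auto
  qed auto
  finally show ?thesis by simp
qed

lemma ex_max_rank:
  fixes r :: "'n::finite \<Rightarrow> nat"
  assumes "P k"
  shows "\<exists>k. P k \<and> (\<forall>l. P l \<longrightarrow> r l \<le> r k)"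
proof -
  have "Max (r ` Collect P) \<in> r ` Collect P"
    using assms by (intro Max_in) auto
  then obtain k where "P k" "r k = Max (r ` Collect P)" by auto
  then show ?thesis by auto
qed

lemma block_flag_block_zero:
  fixes M R T :: "complex^'n^'n"
  assumes "block_flag M J r R T" "R *v y = 0" "\<And>k. (k \<in> J) \<noteq> (j \<in> J) \<Longrightarrow> y $ k = 0"
  shows "y $ j = 0"
proof -
  have "0 = cinner (column j R) (\<Sum>k\<in>UNIV. y $ k *s column k R)"
    using assms(2) by (simp add: mult_vec_columns)
  also have "\<dots> = (\<Sum>k\<in>UNIV. if k = j then y $ k else 0)"
    unfolding cinner_sum_right
  proof (intro sum.cong refl)
    fix k
    show "cinner (column j R) (y $ k *s column k R) = (if k = j then y $ k else 0)"
      using assms(1,3) by (cases "(k \<in> J) = (j \<in> J)") (simp_all add: cinner_scale_right block_flag_def, blast)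
  qed
  finally show ?thesis by simp
qed

text \<open>Induction on a strict bound \<open>h\<close> for the ranks of the nonzero unstable
  coordinates of a kernel vector \<open>y\<close>. The kernel of \<open>R\<close> is invariant under
  \<open>T\<close>, and \<open>T - mat (T $ j $ j)\<close> removes the top unstable coordinate; by
  induction the result is zero, so \<open>y\<close> is an eigenvector of \<open>T\<close> with
  eigenvalue in the right half-plane. A nonzero top stable coordinate would force the same
  eigenvalue into the left half-plane. Hence \<open>y\<close> lives on the unstable block, where the
  columns of \<open>R\<close> are orthonormal.\<close>

lemma block_flag_det_nonzero:
  fixes M R T :: "complex^'n^'n"
  assumes "block_flag M J r R T" "inj r"
    and pos: "\<And>j. j \<in> J \<Longrightarrow> 0 < Re (T $ j $ j)" and neg: "\<And>j. j \<notin> J \<Longrightarrow> Re (T $ j $ j) < 0"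
  shows "det R \<noteq> 0"
proof -
  have MR: "M ** R = R ** T" and blk: "\<And>j k. (j \<in> J) \<noteq> (k \<in> J) \<Longrightarrow> T $ j $ k = 0"
    and tri: "\<And>j k. r k < r j \<Longrightarrow> T $ j $ k = 0"
    using assms(1) unfolding block_flag_def by blast+
  note top = triangular_top_row[OF assms(2) blk tri]
  have "y = 0" if "R *v y = 0" "\<And>k. k \<in> J \<Longrightarrow> y $ k \<noteq> 0 \<Longrightarrow> r k < h" for y h
    using that
  proof (induction h arbitrary: y)
    case 0
    then have J: "y $ k = 0" if "k \<in> J" for k using that by blast
    moreover have "y $ j = 0" if "j \<notin> J" for j
      using block_flag_block_zero[OF assms(1) 0(1), of j] that J by blast
    ultimately show ?case
      by (auto simp: vec_eq_iff)
  next
    case (Suc h)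
    show ?case
    proof (cases "\<exists>j\<in>J. r j = h \<and> y $ j \<noteq> 0")
      case False
      then show ?thesis
        using Suc.prems(2) by (intro Suc.IH[OF Suc.prems(1)]) (auto simp: less_Suc_eq)
    next
      case True
      then obtain j where j: "j \<in> J" "r j = h" "y $ j \<noteq> 0" by blast
      define y' where "y' = (T - mat (T $ j $ j)) *v y"
      have "R *v (T *v y) = M *v (R *v y)"
        by (simp add: matrix_vector_mul_assoc MR)
      then have "R *v y' = 0"
        using Suc.prems(1) by (simp add: y'_def matrix_vector_mult_diff_rdistrib vec.diff vec.scale)
      moreover have "y' $ k = 0" if "k \<in> J" "\<not> r k < h" for k
      proof -
        have "(T *v y) $ k = T $ k $ k * y $ k"
        proof (rule top)
          fix l assume "(l \<in> J) = (k \<in> J)" "r k < r l"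
          then show "y $ l = 0"
            using that Suc.prems(2)[of l] by (cases "y $ l = 0") auto
        qed
        moreover have "k = j \<or> y $ k = 0"
          using that Suc.prems(2)[of k] j \<open>inj r\<close> by (auto simp: less_Suc_eq inj_eq)
        ultimately show ?thesis
          by (auto simp: y'_def matrix_vector_mult_diff_rdistrib)
      qed
      ultimately have "y' = 0"
        using Suc.IH[of y'] by blast
      then have Ty: "T *v y = T $ j $ j *s y"
        by (simp add: y'_def matrix_vector_mult_diff_rdistrib)
      have "y $ k = 0" if "k \<notin> J" for k
      proof (rule ccontr)
        assume "y $ k \<noteq> 0"
        with that obtain k where k: "k \<notin> J" "y $ k \<noteq> 0" "\<And>l. l \<notin> J \<Longrightarrow> y $ l \<noteq> 0 \<Longrightarrow> r l \<le> r k"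
          using ex_max_rank[of "\<lambda>k. k \<notin> J \<and> y $ k \<noteq> 0" k r] by blast
        have "(T *v y) $ k = T $ k $ k * y $ k"
        proof (rule top)
          fix l assume "(l \<in> J) = (k \<in> J)" "r k < r l"
          then show "y $ l = 0"
            using k(1) k(3)[of l] by (cases "y $ l = 0") auto
        qed
        then have "T $ k $ k = T $ j $ j"
          using Ty k(2) by simp
        then show False
          using pos[OF j(1)] neg[OF k(1)] by simp
      qed
      then have "y $ j = 0"
        using block_flag_block_zero[OF assms(1) Suc.prems(1), of j] j(1) by blast
      then show ?thesis using j(3) by simp
    qed
  qed
  from this[where h = "Suc (Max (range r))"] have "y = 0" if "R *v y = 0" for y
    using that by (simp add: less_Suc_eq_le)
  then have "\<exists>B. B ** R = mat 1"
    using matrix_left_invertible_ker by blast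
  then show ?thesis
    by (simp add: invertible_det_nz[symmetric] invertible_left_inverse)
qed

section \<open>Uniform bounds for block triangular forms by compactness\<close>

lemma norm_matrix_le:
  fixes A :: "complex^'n^'n"
  assumes "\<And>i j. norm (A $ i $ j) \<le> b"
  shows "norm A \<le> real CARD('n) * (real CARD('n) * b)"
proof -
  have vec: "norm (x :: 'x::real_normed_vector^'n) \<le> (\<Sum>i\<in>UNIV. norm (x $ i))" for x
    unfolding norm_vec_def by (rule L2_set_le_sum) simp
  have "norm A \<le> (\<Sum>i\<in>UNIV. norm (A $ i))" by (rule vec)
  also have "\<dots> \<le> (\<Sum>i\<in>(UNIV::'n set). real CARD('n) * b)"
  proof (rule sum_mono)
    fix i
    have "norm (A $ i) \<le> (\<Sum>j\<in>UNIV. norm (A $ i $ j))" by (rule vec)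
    also have "\<dots> \<le> (\<Sum>j\<in>(UNIV::'n set). b)" by (intro sum_mono assms)
    finally show "norm (A $ i) \<le> real CARD('n) * b" by simp
  qed
  finally show ?thesis by simp
qed

lemma norm_matrix_nth_le: "norm ((A :: complex^'n^'n) $ i $ j) \<le> norm A"
  using Finite_Cartesian_Product.norm_nth_le[where x = "A $ i" and i = j] Finite_Cartesian_Product.norm_nth_le[where x = A and i = i] by linarith

lemma norm_matrix_mult_nth_le:
  fixes A B :: "complex^'n^'n"
  assumes "\<And>i j. norm (A $ i $ j) \<le> a" "\<And>i j. norm (B $ i $ j) \<le> b"
  shows "norm ((A ** B) $ i $ j) \<le> real CARD('n) * (a * b)"
proof -
  have "0 \<le> a" using assms(1) norm_ge_zero order_trans by blast
  have "norm ((A ** B) $ i $ j) \<le> (\<Sum>k\<in>(UNIV::'n set). a * b)"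
    unfolding matrix_matrix_mult_def vec_lambda_beta
    by (rule sum_norm_le) (auto simp: norm_mult intro!: mult_mono assms \<open>0 \<le> a\<close>)
  then show ?thesis by simp
qed

lemma norm_vec_eq_1_if_cinner: "cinner x x = 1 \<Longrightarrow> norm x = 1"
  by (simp add: cinner_self power2_eq_1_iff flip: of_real_power)
    (metis norm_ge_zero not_one_le_zero le_minus_one_simps(3))

text \<open>Within a block, \<open>T $ i $ j\<close> is the product of column \<open>i\<close> of
  \<open>R\<close> with \<open>M\<close> applied to column \<open>j\<close>. Columns from the other
  block are not orthogonal to column \<open>i\<close>, but \<open>T\<close> has zero coefficients
  there.\<close>

lemma block_flag_entries:
  fixes M R T :: "complex^'n^'n"
  assumes "block_flag M J r R T" "norm M \<le> L"
  shows "norm (R $ i $ j) \<le> 1"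
    and "norm (T $ i $ j) \<le> real CARD('n) * (real CARD('n) * L)"
proof -
  have MR: "M ** R = R ** T" and blk: "\<And>j k. (j \<in> J) \<noteq> (k \<in> J) \<Longrightarrow> T $ j $ k = 0"
    and on: "\<And>j k. (j \<in> J) = (k \<in> J) \<Longrightarrow> cinner (column j R) (column k R) = of_bool (j = k)"
    using assms(1) unfolding block_flag_def by blast+
  have L: "norm (M $ i $ j) \<le> L" for i j
    using norm_matrix_nth_le assms(2) order_trans by blast
  have R: "norm (R $ i $ j) \<le> 1" for i j
  proof -
    have "norm (column j R) = 1"
      using on[of j j] by (intro norm_vec_eq_1_if_cinner) simp
    then show ?thesis
      using Finite_Cartesian_Product.norm_nth_le[where x = "column j R" and i = i] by (simp add: column_def)
  qed
  then show "norm (R $ i $ j) \<le> 1" .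
  show "norm (T $ i $ j) \<le> real CARD('n) * (real CARD('n) * L)"
  proof (cases "(i \<in> J) = (j \<in> J)")
    case True
    have "T $ i $ j = (\<Sum>k\<in>UNIV. if k = i then T $ k $ j else 0)" by simp
    also have "\<dots> = (\<Sum>k\<in>UNIV. T $ k $ j * cinner (column i R) (column k R))"
    proof (intro sum.cong refl)
      fix k
      show "(if k = i then T $ k $ j else 0) = T $ k $ j * cinner (column i R) (column k R)"
        using on[of i k] blk[of k j] True by (cases "(k \<in> J) = (j \<in> J)") auto
    qed
    also have "\<dots> = cinner (column i R) (column j (R ** T))"
      by (simp add: column_mult mult_vec_columns[of R] cinner_sum_right cinner_scale_right) (simp add: column_def)
    also have "\<dots> = (\<Sum>k\<in>UNIV. cnj (R $ k $ i) * (M ** R) $ k $ j)"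
      by (simp add: MR[symmetric] cinner_def) (simp add: column_def)
    also have "norm \<dots> \<le> (\<Sum>k\<in>(UNIV::'n set). 1 * (real CARD('n) * (L * 1)))"
    proof (rule sum_norm_le)
      fix k
      have "norm ((M ** R) $ k $ j) \<le> real CARD('n) * (L * 1)"
        using L R by (rule norm_matrix_mult_nth_le)
      then show "norm (cnj (R $ k $ i) * (M ** R) $ k $ j) \<le> 1 * (real CARD('n) * (L * 1))"
        unfolding norm_mult complex_mod_cnj using R by (intro mult_mono) auto
    qed
    finally show ?thesis by simp
  next
    case False
    then show ?thesis
      using blk[of i j] order_trans[OF norm_ge_zero L] by simp
  qed
qed

text \<open>The triples \<open>(M, R, T)\<close> form a compact set on which
  \<open>norm (det R)\<close> is continuous and positive, so it attains a positive minimum. The weak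
  inequalities in \<open>diagonal_gap\<close> keep the set closed; strict sign conditions alone
  would not.\<close>

lemma block_flag_det_bound:
  fixes J :: "'n::finite set" and r :: "'n \<Rightarrow> nat"
  assumes "\<eta> > 0" "inj r"
  shows "\<exists>c>0. \<forall>(M :: complex^'n^'n) R T. norm M \<le> L \<longrightarrow> block_flag M J r R T \<longrightarrow> diagonal_gap \<eta> J T
    \<longrightarrow> c \<le> norm (det R)"
proof -
  define K where "K = {(M :: complex^'n^'n, R, T). norm M \<le> L \<and> block_flag M J r R T \<and> diagonal_gap \<eta> J T}"
  \<comment> \<open>Each condition is an equation, a weak inequality, or an implication whose
    premise does not involve the triple; written as a disjunction with a constant, the last kind is
    closed as well.\<close>
  have clo: "closed K"
    unfolding K_def block_flag_def diagonal_gap_def case_prod_unfold cinner_def column_def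
      matrix_matrix_mult_def vec_eq_iff vec_lambda_beta imp_conv_disj
    by (intro closed_Collect_conj closed_Collect_all closed_Collect_disj closed_Collect_const
        closed_Collect_le closed_Collect_eq continuous_intros)
  have bdd: "bounded K"
  proof -
    define b where "b = real CARD('n) * (real CARD('n) * L)"
    define b' where "b' = real CARD('n) * (real CARD('n) * b)"
    define b1 where "b1 = real CARD('n) * (real CARD('n) * 1)"
    have "K \<subseteq> cball 0 L \<times> cball 0 b1 \<times> cball 0 b'"
    proof
      fix p assume "p \<in> K"
      then obtain M R T where p: "p = (M, R, T)" and M: "norm M \<le> L" and flag: "block_flag M J r R T"
        by (auto simp: K_def)
      have "norm R \<le> b1" "norm T \<le> b'"
        using norm_matrix_le[OF block_flag_entries(1)[OF flag M]]
          norm_matrix_le[OF block_flag_entries(2)[OF flag M]] by (simp_all add: b1_def b'_def b_def)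
      then show "p \<in> cball 0 L \<times> cball 0 b1 \<times> cball 0 b'"
        using M by (simp add: p)
    qed
    then show ?thesis
      by (rule bounded_subset[OF bounded_Times[OF bounded_cball bounded_Times[OF bounded_cball bounded_cball]]])
  qed
  have cont: "continuous_on K (\<lambda>(M, R, T). norm (det R))"
    unfolding det_def case_prod_unfold by (intro continuous_intros)
  have pos: "norm (det R) > 0" if "(M, R, T) \<in> K" for M R T
  proof -
    have flag: "block_flag M J r R T" and gap: "diagonal_gap \<eta> J T"
      using that by (auto simp: K_def)
    have "det R \<noteq> 0"
    proof (rule block_flag_det_nonzero[OF flag assms(2)])
      show "0 < Re (T $ j $ j)" if "j \<in> J" for j
        using gap that assms(1) unfolding diagonal_gap_def by (meson less_le_trans)
      show "Re (T $ j $ j) < 0" if "j \<notin> J" for j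
        using gap that assms(1) unfolding diagonal_gap_def by (meson le_less_trans neg_less_0_iff_less)
    qed
    then show ?thesis by simp
  qed
  show ?thesis
  proof (cases "K = {}")
    case True
    then show ?thesis unfolding K_def by (intro exI[of _ 1]) auto
  next
    case False
    have "compact K" using clo bdd by (simp add: compact_eq_bounded_closed)
    then obtain p where p: "p \<in> K" "\<And>q. q \<in> K \<Longrightarrow> (\<lambda>(M, R, T). norm (det R)) p \<le> (\<lambda>(M, R, T). norm (det R)) q"
      using continuous_attains_inf[OF _ False cont] by blast
    obtain M0 R0 T0 where p0: "p = (M0, R0, T0)" by (cases p)
    have "norm (det R0) \<le> norm (det R)"
      if "norm M \<le> L" "block_flag M J r R T" "diagonal_gap \<eta> J T" for M R T :: "complex^'n^'n"
      using p(2)[of "(M, R, T)"] that by (simp add: p0 K_def)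
    then show ?thesis
      using pos p(1) unfolding p0 by blast
  qed
qed

text \<open>The constant depends on \<open>J\<close> and \<open>r\<close> only, and there are
  finitely many of these: take the minimum.\<close>

lemma block_flag_det_bound_uniform:
  assumes "\<eta> > 0"
  shows "\<exists>c>0. \<forall>(M :: complex^'n^'n) J r R T. norm M \<le> L \<longrightarrow> inj r \<longrightarrow> (\<forall>j. r j < 2 * CARD('n)) \<longrightarrow>
    block_flag M J r R T \<longrightarrow> diagonal_gap \<eta> J T \<longrightarrow> c \<le> norm (det R)"
proof -
  define F where "F = (UNIV :: 'n set set) \<times> {r. inj r \<and> r \<in> PiE (UNIV::'n set) (\<lambda>_. {..<2 * CARD('n)})}"
  have "finite F"
    unfolding F_def by (intro finite_cartesian_product finite_subset[OF _ finite_PiE[of UNIV "\<lambda>_. {..<2 * CARD('n)}"]]) auto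
  have "\<forall>p\<in>F. \<exists>c>0. \<forall>(M :: complex^'n^'n) R T. norm M \<le> L \<longrightarrow> block_flag M (fst p) (snd p) R T \<longrightarrow>
      diagonal_gap \<eta> (fst p) T \<longrightarrow> c \<le> norm (det R)"
    using block_flag_det_bound[OF assms] by (auto simp: F_def)
  then obtain c where c: "\<And>p. p \<in> F \<Longrightarrow> c p > 0"
      "\<And>p M R T. p \<in> F \<Longrightarrow> norm (M :: complex^'n^'n) \<le> L \<Longrightarrow> block_flag M (fst p) (snd p) R T \<Longrightarrow>
        diagonal_gap \<eta> (fst p) T \<Longrightarrow> c p \<le> norm (det R)"
    by metis
  define c0 where "c0 = Min (insert 1 (c ` F))"
  have "c0 > 0"
    unfolding c0_def using \<open>finite F\<close> c(1) by (subst Min_gr_iff) auto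
  moreover have "c0 \<le> norm (det R)"
    if "norm (M :: complex^'n^'n) \<le> L" "inj r" "\<forall>j. r j < 2 * CARD('n)" "block_flag M J r R T" "diagonal_gap \<eta> J T"
    for M J r R T
  proof -
    have F: "(J, r) \<in> F" using that by (auto simp: F_def)
    then have "c0 \<le> c (J, r)"
      unfolding c0_def using \<open>finite F\<close> by (intro Min_le) auto
    also have "\<dots> \<le> norm (det R)"
      using c(2)[OF F that(1)] that(4,5) by simp
    finally show ?thesis .
  qed
  ultimately show ?thesis by blast
qed

text \<open>Retains from \<open>block_flag\<close> what survives a rescaling of the columns, which
  destroys orthonormality, and adds the inverse \<open>S\<close>.\<close>

definition block_form where
  "block_form M J R S T \<longleftrightarrow> R ** S = mat 1 \<and> S ** R = mat 1 \<and> M ** R = R ** T \<and>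
     (\<forall>j k. (j \<in> J) \<noteq> (k \<in> J) \<longrightarrow> T $ j $ k = 0) \<and>
     (\<exists>r :: 'n \<Rightarrow> nat. inj r \<and> (\<forall>j k. r k < r j \<longrightarrow> T $ j $ k = 0)) \<and>
     (\<forall>j\<in>J. column j R \<in> unstable_subspace M) \<and> (\<forall>j\<in>-J. column j R \<in> stable_subspace M)"
  for M R S T :: "complex^'n^'n"

text \<open>Cramer's rule: each entry of the inverse is a determinant with entries bounded by 1,
  divided by \<open>det R\<close>.\<close>

lemma matrix_inverse_entries:
  fixes R S :: "complex^'n^'n"
  assumes "R ** S = mat 1" "\<And>i j. norm (R $ i $ j) \<le> 1" "c \<le> norm (det R)" "c > 0"
  shows "norm (S $ i $ j) \<le> fact CARD('n) / c"
proof -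
  have d: "det R \<noteq> 0" using assms(3,4) by auto
  have "R *v column j S = axis j 1"
    by (simp add: column_mult[symmetric] assms(1)) (simp add: column_def mat_def axis_def vec_eq_iff)
  then have "column j S = (\<chi> k. det (\<chi> i l. if l = k then axis j 1 $ i else R $ i $ l) / det R)"
    using cramer[OF d] by blast
  then have "S $ i $ j = det (\<chi> i' l. if l = i then axis j 1 $ i' else R $ i' $ l) / det R"
    by (simp add: vec_eq_iff column_def)
  moreover have "norm (det (\<chi> i' l. if l = i then axis j 1 $ i' else R $ i' $ l)) \<le> fact CARD('n) * 1 ^ CARD('n)"
    using assms(2) by (intro norm_det_le) (auto simp: axis_def)
  ultimately show ?thesis
    using assms(3,4) by (auto simp: norm_divide intro!: frac_le)
qed

lemma eigenvalues_conj:
  fixes M R S T :: "complex^'n^'n" and r :: "'n \<Rightarrow> nat"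
  assumes "R ** S = mat 1" "S ** R = mat 1" "M ** R = R ** T" "inj r" "\<And>j k. r k < r j \<Longrightarrow> T $ j $ k = 0"
  shows "eigenvalues M = range (\<lambda>j. T $ j $ j)"
proof -
  have ev: "\<mu> \<in> eigenvalues M \<longleftrightarrow> (\<exists>y. y \<noteq> 0 \<and> (T - mat \<mu>) *v y = 0)" for \<mu>
  proof
    assume "\<mu> \<in> eigenvalues M"
    then obtain v where v: "v \<noteq> 0" "M *v v = \<mu> *s v" by (auto simp: eigenvalues_def)
    have RSv: "R *v (S *v v) = v" by (simp add: matrix_vector_mul_assoc assms)
    have "T *v (S *v v) = S *v (R *v (T *v (S *v v)))"
      by (simp add: matrix_vector_mul_assoc matrix_mul_assoc assms)
    also have "R *v (T *v (S *v v)) = M *v (R *v (S *v v))"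
      unfolding matrix_vector_mul_assoc matrix_mul_assoc assms(3) ..
    also have "\<dots> = \<mu> *s v" by (simp add: RSv v)
    finally have "(T - mat \<mu>) *v (S *v v) = 0"
      by (simp add: matrix_vector_mult_diff_rdistrib vec.scale)
    moreover have "S *v v \<noteq> 0" using RSv v(1) by auto
    ultimately show "\<exists>y. y \<noteq> 0 \<and> (T - mat \<mu>) *v y = 0" by blast
  next
    assume "\<exists>y. y \<noteq> 0 \<and> (T - mat \<mu>) *v y = 0"
    then obtain y where y: "y \<noteq> 0" "T *v y = \<mu> *s y"
      by (auto simp: matrix_vector_mult_diff_rdistrib)
    have "S *v (R *v y) = y" by (simp add: matrix_vector_mul_assoc assms)
    then have "R *v y \<noteq> 0" using y(1) by auto
    moreover have "M *v (R *v y) = \<mu> *s (R *v y)"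
      by (simp add: matrix_vector_mul_assoc assms(3)) (simp add: matrix_vector_mul_assoc[symmetric] y vec.scale)
    ultimately show "\<mu> \<in> eigenvalues M" by (auto simp: eigenvalues_def)
  qed
  have "(\<exists>y. y \<noteq> 0 \<and> (T - mat \<mu>) *v y = 0) \<longleftrightarrow> det (T - mat \<mu>) = 0" for \<mu>
    by (metis invertible_det_nz invertible_left_inverse matrix_left_invertible_ker)
  moreover have "det (T - mat \<mu>) = (\<Prod>j\<in>UNIV. T $ j $ j - \<mu>)" for \<mu>
    using assms(5) by (subst det_triangular[OF assms(4)]) (auto simp: mat_def)
  ultimately show ?thesis
    using ev by auto
qed

text \<open>Conjugation by the diagonal matrix of the powers \<open>\<rho> ^ r j\<close> multiplies
  \<open>T $ j $ k\<close> by \<open>\<rho> ^ (r k - r j)\<close>. The entries above the diagonal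
  shrink at least by the factor \<open>\<rho>\<close>, and the diagonal is unchanged. The price is a
  factor of at most \<open>(1 / \<rho>) ^ (2 * CARD('n))\<close> in the inverse.\<close>

lemma uniform_block_form:
  fixes L \<eta> \<kappa> :: real
  assumes "\<eta> > 0" "\<kappa> > 0"
  shows "\<exists>b\<ge>1. \<forall>(M :: complex^'n^'n) R0 J. norm M \<le> L \<longrightarrow> hyperbolic_frame M R0 J \<longrightarrow>
    (\<forall>\<mu>\<in>eigenvalues M. \<eta> \<le> \<bar>Re \<mu>\<bar>) \<longrightarrow>
    (\<exists>R S T. block_form M J R S T \<and> diagonal_gap \<eta> J T \<and> (\<forall>j k. j \<noteq> k \<longrightarrow> norm (T $ j $ k) \<le> \<kappa>) \<and>
      (\<forall>i j. norm (R $ i $ j) \<le> b) \<and> (\<forall>i j. norm (S $ i $ j) \<le> b))"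
proof -
  obtain c where c: "c > 0" "\<And>(M :: complex^'n^'n) J r R T. norm M \<le> L \<Longrightarrow> inj r \<Longrightarrow> (\<And>j. r j < 2 * CARD('n)) \<Longrightarrow>
    block_flag M J r R T \<Longrightarrow> diagonal_gap \<eta> J T \<Longrightarrow> c \<le> norm (det R)"
    using block_flag_det_bound_uniform[OF assms(1), where 'n = 'n and L = L] by metis
  define b1 where "b1 = real CARD('n) * (real CARD('n) * L)"
  \<comment> \<open>\<open>b1\<close> bounds the entries of \<open>T\<close> before the scaling, so
    this choice brings them below \<open>\<kappa>\<close>; the summand 1 makes
    \<open>\<rho> < 1\<close>.\<close>
  define \<rho> where "\<rho> = \<kappa> / (\<bar>b1\<bar> + \<kappa> + 1)"
  have \<rho>: "0 < \<rho>" "\<rho> < 1" "\<rho> * \<bar>b1\<bar> \<le> \<kappa>"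
    using assms(2) by (auto simp: \<rho>_def field_simps)
  define b where "b = max 1 (fact CARD('n) / c * (1 / \<rho>) ^ (2 * CARD('n)))"
  have "\<exists>R S T. block_form M J R S T \<and> diagonal_gap \<eta> J T \<and> (\<forall>j k. j \<noteq> k \<longrightarrow> norm (T $ j $ k) \<le> \<kappa>) \<and>
      (\<forall>i j. norm (R $ i $ j) \<le> b) \<and> (\<forall>i j. norm (S $ i $ j) \<le> b)"
    if M: "norm M \<le> L" and frame: "hyperbolic_frame M R0 J" and gap: "\<forall>\<mu>\<in>eigenvalues M. \<eta> \<le> \<bar>Re \<mu>\<bar>"
    for M R0 :: "complex^'n^'n" and J
  proof -
    obtain r R T where r: "inj r" "\<And>j. r j < 2 * CARD('n)" and flag: "block_flag M J r R T"
      and un: "\<And>j. j \<in> J \<Longrightarrow> 0 < Re (T $ j $ j)" "\<And>j. j \<in> J \<Longrightarrow> column j R \<in> unstable_subspace M"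
      and st: "\<And>j. j \<notin> J \<Longrightarrow> Re (T $ j $ j) < 0" "\<And>j. j \<notin> J \<Longrightarrow> column j R \<in> stable_subspace M"
      using hyperbolic_frame_block_flag[OF frame] by (metis ComplI)
    have "det R \<noteq> 0"
      using block_flag_det_nonzero[OF flag r(1)] un st by blast
    then obtain S where RS: "R ** S = mat 1" "S ** R = mat 1"
      unfolding invertible_det_nz[symmetric] invertible_def by blast
    have MR: "M ** R = R ** T" and blk: "\<And>j k. (j \<in> J) \<noteq> (k \<in> J) \<Longrightarrow> T $ j $ k = 0"
      and tri: "\<And>j k. r k < r j \<Longrightarrow> T $ j $ k = 0"
      using flag unfolding block_flag_def by blast+
    have "T $ j $ j \<in> eigenvalues M" for j
      using eigenvalues_conj[OF RS MR r(1) tri] by blast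
    then have gapT: "diagonal_gap \<eta> J T"
      unfolding diagonal_gap_def using gap un(1) st(1)
      by (smt (verit, best))
    have S: "norm (S $ i $ j) \<le> fact CARD('n) / c" for i j
      using matrix_inverse_entries[OF RS(1) block_flag_entries(1)[OF flag M] c(2)[OF M r flag gapT] c(1)] .
    define R' :: "complex^'n^'n" where "R' = (\<chi> i j. R $ i $ j * of_real (\<rho> ^ r j))"
    define S' :: "complex^'n^'n" where "S' = (\<chi> i j. S $ i $ j / of_real (\<rho> ^ r i))"
    define T' :: "complex^'n^'n" where "T' = (\<chi> i j. T $ i $ j * of_real (\<rho> ^ r j) / of_real (\<rho> ^ r i))"
    have \<rho>0: "complex_of_real \<rho> \<noteq> 0" using \<rho>(1) by simp
    have "R' ** S' = R ** S"
      using \<rho>0 by (simp add: R'_def S'_def matrix_matrix_mult_def vec_eq_iff)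
    moreover have "S' ** R' = S ** R"
    proof -
      have "(S' ** R') $ i $ j = (S ** R) $ i $ j * of_real (\<rho> ^ r j) / of_real (\<rho> ^ r i)" for i j
        by (simp add: R'_def S'_def matrix_matrix_mult_def sum_distrib_right sum_divide_distrib mult.assoc)
      then show ?thesis using \<rho>0 by (simp add: vec_eq_iff RS mat_def)
    qed
    moreover have "M ** R' = R' ** T'"
    proof -
      have "(M ** R') $ i $ j = (M ** R) $ i $ j * of_real (\<rho> ^ r j)" for i j
        by (simp add: R'_def matrix_matrix_mult_def sum_distrib_right sum_distrib_left mult_ac)
      moreover have "(R' ** T') $ i $ j = (R ** T) $ i $ j * of_real (\<rho> ^ r j)" for i j
        using \<rho>0 by (simp add: R'_def T'_def matrix_matrix_mult_def sum_distrib_right sum_distrib_left mult_ac)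
      ultimately show ?thesis by (simp add: vec_eq_iff MR)
    qed
    moreover have "column j R' = of_real (\<rho> ^ r j) *s column j R" for j
      by (simp add: R'_def column_def vec_eq_iff)
    then have "j \<in> J \<Longrightarrow> column j R' \<in> unstable_subspace M" "j \<notin> J \<Longrightarrow> column j R' \<in> stable_subspace M" for j
      using un(2) st(2) unfolding spectral_subspace_def by (auto intro: vec.span_scale)
    ultimately have form: "block_form M J R' S' T'"
      using blk tri r(1) RS unfolding block_form_def by (auto simp: T'_def intro!: exI[of _ r])
    have "T' $ j $ j = T $ j $ j" for j
      using \<rho>0 by (simp add: T'_def)
    then have "diagonal_gap \<eta> J T'"
      using gapT by (simp add: diagonal_gap_def)
    moreover have "norm (T' $ j $ k) \<le> \<kappa>" if "j \<noteq> k" for j k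
    proof (cases "r k < r j")
      case True
      then show ?thesis using tri assms(2) by (simp add: T'_def)
    next
      case False
      then have less: "r j < r k" using that r(1) by (metis injD nat_neq_iff)
      have "norm (T' $ j $ k) = norm (T $ j $ k) * (\<rho> ^ r k / \<rho> ^ r j)"
        using \<rho>(1) by (simp add: T'_def norm_mult norm_divide norm_power)
      also have "\<rho> ^ r k / \<rho> ^ r j = \<rho> ^ (r k - r j)"
        using less \<rho>(1) by (simp add: power_diff)
      also have "norm (T $ j $ k) * \<rho> ^ (r k - r j) \<le> \<bar>b1\<bar> * \<rho>"
      proof (intro mult_mono)
        show "norm (T $ j $ k) \<le> \<bar>b1\<bar>"
          using block_flag_entries(2)[OF flag M, of j k] by (simp add: b1_def)
        show "\<rho> ^ (r k - r j) \<le> \<rho>"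
          using power_decreasing[of 1 "r k - r j" \<rho>] less \<rho> by simp
      qed (use \<rho> in auto)
      finally show ?thesis using \<rho>(3) by (simp add: mult.commute)
    qed
    moreover have "norm (R' $ i $ j) \<le> b" for i j
    proof -
      have "norm (R' $ i $ j) \<le> 1 * 1"
        using block_flag_entries(1)[OF flag M, of i j] \<rho>
        by (simp add: R'_def norm_mult norm_power mult_le_one power_le_one)
      then show ?thesis by (simp add: b_def)
    qed
    moreover have "norm (S' $ i $ j) \<le> b" for i j
    proof -
      have "norm (S' $ i $ j) = norm (S $ i $ j) * (1 / \<rho>) ^ r i"
        using \<rho>(1) by (simp add: S'_def norm_divide norm_power power_one_over)
      also have "\<dots> \<le> fact CARD('n) / c * (1 / \<rho>) ^ (2 * CARD('n))"
        using S[of i j] \<rho> r(2)[of i] c(1)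
        by (intro mult_mono power_increasing) auto
      finally show ?thesis by (simp add: b_def)
    qed
    ultimately show ?thesis using form by blast
  qed
  then show ?thesis
    by (intro exI[of _ b]) (auto simp: b_def)
qed

section \<open>Spectral projections, traces and multiplicities in block coordinates\<close>

definition block_proj :: "'n set \<Rightarrow> complex^'n^'n" where
  "block_proj I = (\<chi> i j. if i = j \<and> j \<in> I then 1 else 0)"

lemma mult_block_proj: "(A ** block_proj I) $ i $ j = (if j \<in> I then A $ i $ j else 0)"
  by (simp add: block_proj_def matrix_matrix_mult_def if_distrib cong: if_cong)

lemma block_proj_vec: "(block_proj I *v y) $ i = (if i \<in> I then y $ i else 0)"
proof -
  have "(block_proj I *v y) $ i = (\<Sum>j\<in>UNIV. if j = i then (if i \<in> I then y $ i else 0) else 0)"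
    unfolding block_proj_def matrix_vector_mult_def vec_lambda_beta by (intro sum.cong) auto
  then show ?thesis by simp
qed

lemma block_form_conj_vec:
  fixes M R S T :: "complex^'n^'n"
  assumes "block_form M J R S T"
  shows "R *v (S *v v) = v" "S *v (M *v v) = T *v (S *v v)"
proof -
  have RS: "R ** S = mat 1" "S ** R = mat 1" "M ** R = R ** T"
    using assms by (auto simp: block_form_def)
  show RSv: "R *v (S *v v) = v" for v by (simp add: matrix_vector_mul_assoc RS)
  have "S *v (M *v v) = S *v (M *v (R *v (S *v v)))" by (simp add: RSv)
  also have "M *v (R *v (S *v v)) = R *v (T *v (S *v v))"
    unfolding matrix_vector_mul_assoc matrix_mul_assoc RS(3) ..
  finally show "S *v (M *v v) = T *v (S *v v)"
    by (simp add: matrix_vector_mul_assoc matrix_mul_assoc RS)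
qed

text \<open>A factor \<open>M - \<mu>\<close> with \<open>\<mu>\<close> off the diagonal of a block cannot kill the top coordinate in
  that block.\<close>

lemma spectral_subspace_coordinate_zero:
  fixes M R S T :: "complex^'n^'n"
  assumes form: "block_form M J R S T" and v: "v \<in> spectral_subspace M \<Sigma>"
    and diag: "\<And>k. (k \<in> J) = (j \<in> J) \<Longrightarrow> T $ k $ k \<notin> \<Sigma>"
  shows "(S *v v) $ j = 0"
proof (rule ccontr)
  assume nz: "(S *v v) $ j \<noteq> 0"
  have blk: "\<And>j k. (j \<in> J) \<noteq> (k \<in> J) \<Longrightarrow> T $ j $ k = 0"
    using form unfolding block_form_def by blast
  obtain r :: "'n \<Rightarrow> nat" where r: "inj r" and tri: "\<And>j k. r k < r j \<Longrightarrow> T $ j $ k = 0"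
    using form unfolding block_form_def by blast
  obtain k where k: "(k \<in> J) = (j \<in> J)" "(S *v v) $ k \<noteq> 0"
      "\<And>l. (l \<in> J) = (k \<in> J) \<Longrightarrow> r k < r l \<Longrightarrow> (S *v v) $ l = 0"
    using ex_max_rank[of "\<lambda>k. (k \<in> J) = (j \<in> J) \<and> (S *v v) $ k \<noteq> 0" j r] nz by (metis not_less)
  have "(S *v shift_prod M \<mu>s v) $ k \<noteq> 0" if "set \<mu>s \<subseteq> \<Sigma>" for \<mu>s
    using that k(2,3)
  proof (induction \<mu>s arbitrary: v)
    case (Cons \<mu> \<mu>s)
    let ?v' = "(M - mat \<mu>) *v v"
    have S': "S *v ?v' = T *v (S *v v) - \<mu> *s (S *v v)"
      by (simp add: matrix_vector_mult_diff_rdistrib vec.diff vec.scale block_form_conj_vec(2)[OF form])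
    have top: "(S *v ?v') $ l = (T $ l $ l - \<mu>) * (S *v v) $ l"
      if "(l \<in> J) = (k \<in> J)" "r k \<le> r l" for l
    proof -
      have "(T *v (S *v v)) $ l = T $ l $ l * (S *v v) $ l"
        using that Cons.prems(3) by (intro triangular_top_row[OF r blk tri]) auto
      then show ?thesis unfolding S' by (simp add: algebra_simps)
    qed
    have "T $ k $ k \<noteq> \<mu>" using diag[OF k(1)] Cons.prems(1) by auto
    then have "(S *v ?v') $ k \<noteq> 0" using top[of k] Cons.prems(2) by simp
    moreover have "(S *v ?v') $ l = 0" if "(l \<in> J) = (k \<in> J)" "r k < r l" for l
      using top[of l] that Cons.prems(3)[of l] by simp
    ultimately show ?case
      using Cons.IH[of ?v'] Cons.prems(1) by simp
  qed simp
  then show False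
    using spectral_subspace_annihilated[OF v] by fastforce
qed

lemma spectral_subspace_mono: "A \<subseteq> B \<Longrightarrow> spectral_subspace M A \<subseteq> spectral_subspace M B"
  unfolding spectral_subspace_def by (intro vec.span_mono) auto

text \<open>In the coordinates \<open>S *v v\<close>, vectors of the subspace for
  \<open>\<Sigma>\<close> vanish outside \<open>I\<close> and those for the complement vanish on
  \<open>I\<close>; the coordinate argument works for whole blocks, hence \<open>I\<close> is one of
  the two. The description by \<open>THE\<close> is unique because every column of \<open>R\<close>
  lies in one of the two subspaces and \<open>R\<close> is invertible.\<close>

lemma spectral_projection_block:
  fixes M R S T :: "complex^'n^'n"
  assumes form: "block_form M J R S T"
    and ins: "\<And>j. j \<in> I \<Longrightarrow> T $ j $ j \<in> \<Sigma> \<and> column j R \<in> spectral_subspace M \<Sigma>"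
    and outs: "\<And>j. j \<notin> I \<Longrightarrow> T $ j $ j \<notin> \<Sigma> \<and> column j R \<in> spectral_subspace M (- \<Sigma>)"
    and I: "I = J \<or> I = - J"
  shows "spectral_projection M \<Sigma> = R ** block_proj I ** S"
    and "\<And>v. v \<in> spectral_subspace M \<Sigma> \<Longrightarrow> (R ** block_proj I ** S) *v v = v"
    and "\<And>v. v \<in> spectral_subspace M (- \<Sigma>) \<Longrightarrow> (R ** block_proj I ** S) *v v = 0"
proof -
  let ?Q = "R ** block_proj I ** S"
  have Q: "?Q *v v = R *v (block_proj I *v (S *v v))" for v
    by (simp add: matrix_vector_mul_assoc matrix_mul_assoc)
  have z1: "(S *v v) $ j = 0" if "v \<in> spectral_subspace M \<Sigma>" "j \<notin> I" for v j
    using outs that I by (intro spectral_subspace_coordinate_zero[OF form that(1)]) auto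
  have z2: "(S *v v) $ j = 0" if "v \<in> spectral_subspace M (- \<Sigma>)" "j \<in> I" for v j
    using ins that I by (intro spectral_subspace_coordinate_zero[OF form that(1)]) auto
  show 1: "?Q *v v = v" if "v \<in> spectral_subspace M \<Sigma>" for v
  proof -
    have "block_proj I *v (S *v v) = S *v v"
      using z1[OF that] by (auto simp: vec_eq_iff block_proj_vec)
    then show ?thesis by (simp add: Q block_form_conj_vec(1)[OF form])
  qed
  show 2: "?Q *v v = 0" if "v \<in> spectral_subspace M (- \<Sigma>)" for v
  proof -
    have "block_proj I *v (S *v v) = 0"
      using z2[OF that] by (auto simp: vec_eq_iff block_proj_vec)
    then show ?thesis by (simp add: Q)
  qed
  show "spectral_projection M \<Sigma> = ?Q"
    unfolding spectral_projection_def
  proof (rule the_equality)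
    fix Q'
    assume Q': "(\<forall>v\<in>spectral_subspace M \<Sigma>. Q' *v v = v) \<and> (\<forall>v\<in>spectral_subspace M (- \<Sigma>). Q' *v v = 0)"
    have "Q' *v column j R = ?Q *v column j R" for j
      using Q' ins[of j] outs[of j] 1 2 by (cases "j \<in> I") auto
    then have "Q' ** R = ?Q ** R"
      by (simp add: matrix_eq_columns column_mult)
    then have "Q' ** R ** S = ?Q ** R ** S" by simp
    then show "Q' = ?Q"
      using form by (simp add: matrix_mul_assoc[symmetric] block_form_def)
  qed (use 1 2 in blast)
qed

text \<open>The complement of an open half-plane also contains the imaginary axis, so the kernel of
  each projection is reached from the opposite subspace by monotonicity.\<close>

lemma hyperbolic_block_projections:
  fixes M R S T :: "complex^'n^'n"
  assumes form: "block_form M J R S T" and gap: "diagonal_gap \<eta> J T" "\<eta> > 0"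
  shows "unstable_projection M = R ** block_proj J ** S"
    and "stable_projection M = R ** block_proj (- J) ** S"
    and "\<And>v. v \<in> unstable_subspace M \<Longrightarrow> (R ** block_proj J ** S) *v v = v"
    and "\<And>v. v \<in> unstable_subspace M \<Longrightarrow> (R ** block_proj (- J) ** S) *v v = 0"
    and "\<And>v. v \<in> stable_subspace M \<Longrightarrow> (R ** block_proj J ** S) *v v = 0"
    and "\<And>v. v \<in> stable_subspace M \<Longrightarrow> (R ** block_proj (- J) ** S) *v v = v"
proof -
  have pos: "0 < Re (T $ j $ j)" if "j \<in> J" for j
    using gap that unfolding diagonal_gap_def by (meson less_le_trans)
  have neg: "Re (T $ j $ j) < 0" if "j \<notin> J" for j
    using gap that unfolding diagonal_gap_def by (meson le_less_trans neg_less_0_iff_less)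
  have un: "column j R \<in> unstable_subspace M" if "j \<in> J" for j
    using form that by (auto simp: block_form_def)
  have st: "column j R \<in> stable_subspace M" if "j \<notin> J" for j
    using form that by (auto simp: block_form_def)
  have sub1: "stable_subspace M \<subseteq> spectral_subspace M (- {\<mu>. Re \<mu> > 0})"
    and sub2: "unstable_subspace M \<subseteq> spectral_subspace M (- {\<mu>. Re \<mu> < 0})"
    by (auto intro!: spectral_subspace_mono)
  note U = spectral_projection_block[OF form, of J "{\<mu>. Re \<mu> > 0}"]
  note V = spectral_projection_block[OF form, of "-J" "{\<mu>. Re \<mu> < 0}"]
  have a: "T $ j $ j \<in> {\<mu>. Re \<mu> > 0} \<and> column j R \<in> unstable_subspace M" if "j \<in> J" for j
    using pos un that by auto
  have b: "T $ j $ j \<notin> {\<mu>. Re \<mu> > 0} \<and> column j R \<in> spectral_subspace M (- {\<mu>. Re \<mu> > 0})" if "j \<notin> J" for j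
    using neg[OF that] st[OF that] sub1 by auto
  have c: "T $ j $ j \<in> {\<mu>. Re \<mu> < 0} \<and> column j R \<in> stable_subspace M" if "j \<in> -J" for j
    using neg st that by auto
  have d: "T $ j $ j \<notin> {\<mu>. Re \<mu> < 0} \<and> column j R \<in> spectral_subspace M (- {\<mu>. Re \<mu> < 0})" if "j \<notin> -J" for j
    using pos[of j] un[of j] that sub2 by auto
  show "unstable_projection M = R ** block_proj J ** S"
    "\<And>v. v \<in> unstable_subspace M \<Longrightarrow> (R ** block_proj J ** S) *v v = v"
    "\<And>v. v \<in> stable_subspace M \<Longrightarrow> (R ** block_proj J ** S) *v v = 0"
    using U a b sub1 by blast+
  show "stable_projection M = R ** block_proj (- J) ** S"
    "\<And>v. v \<in> stable_subspace M \<Longrightarrow> (R ** block_proj (- J) ** S) *v v = v"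
    "\<And>v. v \<in> unstable_subspace M \<Longrightarrow> (R ** block_proj (- J) ** S) *v v = 0"
    using V c d sub2 by blast+
qed

lemma trace_block_projection:
  fixes M R S T :: "complex^'n^'n"
  assumes "block_form M J R S T"
  shows "trace (M ** (R ** block_proj I ** S)) = (\<Sum>j\<in>I. T $ j $ j)"
proof -
  have RS: "S ** R = mat 1" "M ** R = R ** T"
    using assms by (auto simp: block_form_def)
  have "trace (M ** (R ** block_proj I ** S)) = trace ((M ** R) ** block_proj I ** S)"
    by (simp add: matrix_mul_assoc)
  also have "\<dots> = trace (S ** (R ** T ** block_proj I))"
    unfolding RS by (rule trace_mul_sym)
  also have "S ** (R ** T ** block_proj I) = T ** block_proj I"
    by (simp add: matrix_mul_assoc RS)
  also have "trace (T ** block_proj I) = (\<Sum>j\<in>UNIV. if j \<in> I then T $ j $ j else 0)"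
    by (simp add: trace_def mult_block_proj)
  finally show ?thesis
    by (simp add: sum.If_cases)
qed

lemma poly_det:
  fixes A :: "('a::comm_ring_1) poly^'n^'n"
  shows "poly (det A) x = det (\<chi> i j. poly (A $ i $ j) x)"
  by (simp add: det_def poly_sum poly_prod)

lemma char_poly_triangular:
  fixes M R S T :: "complex^'n^'n"
  assumes "block_form M J R S T"
  shows "char_poly M = (\<Prod>j\<in>UNIV. [:- (T $ j $ j), 1:])"
proof -
  obtain r :: "'n \<Rightarrow> nat" where r: "inj r" and tri: "\<And>j k. r k < r j \<Longrightarrow> T $ j $ k = 0"
    using assms unfolding block_form_def by blast
  have RS: "R ** S = mat 1" "S ** R = mat 1" "M ** R = R ** T"
    using assms by (auto simp: block_form_def)
  have "poly (char_poly M) x = poly (\<Prod>j\<in>UNIV. [:- (T $ j $ j), 1:]) x" for x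
  proof -
    have "poly (char_poly M) x = det (mat x - M)"
      unfolding char_poly_def poly_det by (rule arg_cong[where f = det]) (simp add: vec_eq_iff mat_def)
    also have "mat x - M = R ** (mat x - T) ** S"
    proof -
      have "R ** (mat x ** S) = mat x"
        using RS(1) by (simp add: matrix_eq matrix_vector_mul_assoc[symmetric] vec.scale)
      moreover have "R ** (T ** S) = M"
        by (metis RS(1,3) matrix_mul_assoc matrix_mul_rid)
      moreover have "R ** (mat x - T) ** S = R ** (mat x ** S) - R ** (T ** S)"
        by (simp add: matrix_eq matrix_vector_mul_assoc[symmetric] algebra_simps vec.diff)
      ultimately show ?thesis by simp
    qed
    also have "det \<dots> = det (mat x - T) * (det R * det S)"
      by (simp add: det_mul)
    also have "det R * det S = 1"
      using RS(1) by (metis det_mul det_I)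
    also have "det (mat x - T) = (\<Prod>j\<in>UNIV. x - T $ j $ j)"
      using tri by (subst det_triangular[OF r]) (auto simp: mat_def)
    finally show ?thesis by (simp add: poly_prod)
  qed
  then show ?thesis by (simp add: poly_eq_poly_eq_iff[symmetric] fun_eq_iff)
qed

lemma order_linear_prod:
  fixes a :: "'i \<Rightarrow> complex"
  assumes "finite I"
  shows "order \<mu> (\<Prod>j\<in>I. [:- a j, 1:]) = card {j \<in> I. a j = \<mu>}"
  using assms
proof (induction I rule: finite_induct)
  case empty
  then show ?case by (simp add: order_0I)
next
  case (insert i I)
  have nz: "(\<Prod>j\<in>I. [:- a j, 1:]) \<noteq> 0" using insert by simp
  have "order \<mu> [:- a i, 1:] = (if a i = \<mu> then 1 else 0)"
  proof (cases "a i = \<mu>")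
    case True
    then show ?thesis using order_power_n_n[of \<mu> 1] by simp
  next
    case False
    then show ?thesis by (simp add: order_0I)
  qed
  moreover have "{j \<in> insert i I. a j = \<mu>} = (if a i = \<mu> then insert i {j \<in> I. a j = \<mu>} else {j \<in> I. a j = \<mu>})"
    by auto
  moreover have "[:- a i, 1:] * (\<Prod>j\<in>I. [:- a j, 1:]) \<noteq> 0"
    using nz by (simp del: mult_pCons_left)
  ultimately show ?case
    using insert by (simp add: order_mult del: mult_pCons_left)
qed

text \<open>Matches the exponent of \<open>- \<gamma>\<close> in the rescaling with the number of
  stable columns, which is the power of \<open>- \<gamma>\<close> produced by the good minors.
  Algebraic multiplicity is counted along the diagonal of \<open>T\<close>.\<close>

lemma num_stable_eigenvalues_block:
  fixes M R S T :: "complex^'n^'n"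
  assumes form: "block_form M J R S T" and gap: "diagonal_gap \<eta> J T" "\<eta> > 0"
  shows "num_stable_eigenvalues M = card (- J)"
proof -
  obtain r :: "'n \<Rightarrow> nat" where r: "inj r" and tri: "\<And>j k. r k < r j \<Longrightarrow> T $ j $ k = 0"
    using form unfolding block_form_def by blast
  have RS: "R ** S = mat 1" "S ** R = mat 1" "M ** R = R ** T"
    using form by (auto simp: block_form_def)
  have ev: "eigenvalues M = range (\<lambda>j. T $ j $ j)"
    by (rule eigenvalues_conj[OF RS r tri])
  have neg: "Re (T $ j $ j) < 0 \<longleftrightarrow> j \<notin> J" for j
    using gap unfolding diagonal_gap_def by (metis le_less_trans less_le_trans neg_less_0_iff_less not_less_iff_gr_or_eq)
  let ?E = "{\<mu>. \<mu> \<in> eigenvalues M \<and> Re \<mu> < 0}"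
  have "num_stable_eigenvalues M = (\<Sum>\<mu>\<in>?E. card {j. T $ j $ j = \<mu>})"
    unfolding num_stable_eigenvalues_def char_poly_triangular[OF form] by (simp add: order_linear_prod)
  also have "\<dots> = card (\<Union>\<mu>\<in>?E. {j. T $ j $ j = \<mu>})"
    by (intro card_UN_disjoint[symmetric]) (auto simp: ev)
  also have "(\<Union>\<mu>\<in>?E. {j. T $ j $ j = \<mu>}) = - J"
    using neg by (auto simp: ev)
  finally show ?thesis .
qed

section \<open>The given frame and the homoclinic Evans function\<close>

text \<open>\<open>Min\<close> is meaningful only for finite sets; finiteness of the spectrum comes
  from the triangular form, whose diagonal lists it.\<close>

lemma spectral_gap_le_eigenvalue:
  fixes M R0 :: "complex^'n^'n"
  assumes "hyperbolic_frame M R0 J" "\<mu> \<in> eigenvalues M"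
  shows "spectral_gap M \<le> \<bar>Re \<mu>\<bar>"
proof -
  obtain r R T where r: "inj r" and flag: "block_flag M J r R T"
    and T: "\<And>j. j \<in> J \<Longrightarrow> 0 < Re (T $ j $ j)" "\<And>j. j \<notin> J \<Longrightarrow> Re (T $ j $ j) < 0"
    using hyperbolic_frame_block_flag[OF assms(1)] by (metis ComplI)
  have "det R \<noteq> 0"
    using block_flag_det_nonzero[OF flag r] T by blast
  then obtain S where RS: "R ** S = mat 1" "S ** R = mat 1"
    unfolding invertible_det_nz[symmetric] invertible_def by blast
  have MR: "M ** R = R ** T" and tri: "\<And>j k. r k < r j \<Longrightarrow> T $ j $ k = 0"
    using flag unfolding block_flag_def by blast+
  have "finite (eigenvalues M)"
    using eigenvalues_conj[OF RS MR r tri] by simp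
  then show ?thesis
    unfolding spectral_gap_def using assms(2) by (intro Min_le) auto
qed

text \<open>The two projections split a vanishing combination of the columns into its unstable and
  its stable part, and each part has independent columns. This legitimates the division by
  \<open>det R\<close> in \<open>homoclinic_evans\<close>.\<close>

lemma hyperbolic_frame_det_nonzero:
  fixes M R0 R S T :: "complex^'n^'n"
  assumes frame: "hyperbolic_frame M R0 J"
    and form: "block_form M J R S T" and gap: "diagonal_gap \<eta> J T" "\<eta> > 0"
  shows "det R0 \<noteq> 0"
proof -
  note proj = hyperbolic_block_projections[OF form gap]
  have coeff: "y $ j = 0"
    if "columns_basis R0 I V" "(\<Sum>k\<in>I. y $ k *s column k R0) = 0" "j \<in> I" for I V y j
  proof -
    let ?c = "\<lambda>k. column k R0"
    have inj: "inj_on ?c I" and ind: "vec.independent (?c ` I)"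
      using that(1) by (auto simp: columns_basis_def)
    have "(\<Sum>v\<in>?c ` I. y $ (inv_into I ?c v) *s v) = 0"
      using that(2) by (simp add: sum.reindex[OF inj] inv_into_f_f[OF inj])
    then have "y $ (inv_into I ?c (?c j)) = 0"
      using that(3) by (intro vec.independentD[OF ind _ subset_refl]) auto
    then show ?thesis using inv_into_f_f[OF inj that(3)] by simp
  qed
  have un: "column j R0 \<in> unstable_subspace M" if "j \<in> J" for j
    using frame that unfolding hyperbolic_frame_def columns_basis_def by (metis imageI vec.span_base)
  have st: "column j R0 \<in> stable_subspace M" if "j \<in> - J" for j
    using frame that unfolding hyperbolic_frame_def columns_basis_def by (metis imageI vec.span_base)
  have "y = 0" if "R0 *v y = 0" for y
  proof -
    have "0 = (R ** block_proj J ** S) *v (\<Sum>k\<in>UNIV. y $ k *s column k R0)"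
      using that by (simp add: mult_vec_columns)
    also have "\<dots> = (\<Sum>k\<in>UNIV. if k \<in> J then y $ k *s column k R0 else 0)"
      unfolding vec.sum vec.scale using proj(3)[OF un] proj(5)[OF st] by (intro sum.cong) auto
    finally have sJ: "(\<Sum>k\<in>J. y $ k *s column k R0) = 0"
      by (simp add: sum.If_cases)
    have "0 = (R ** block_proj (-J) ** S) *v (\<Sum>k\<in>UNIV. y $ k *s column k R0)"
      using that by (simp add: mult_vec_columns)
    also have "\<dots> = (\<Sum>k\<in>UNIV. if k \<in> -J then y $ k *s column k R0 else 0)"
      unfolding vec.sum vec.scale using proj(4)[OF un] proj(6)[OF st] by (intro sum.cong) auto
    finally have sJ': "(\<Sum>k\<in>-J. y $ k *s column k R0) = 0"
      by (simp add: sum.If_cases del: Compl_iff)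
    show "y = 0"
      using coeff[OF _ sJ] coeff[OF _ sJ'] frame unfolding hyperbolic_frame_def
      by (metis ComplI vec_eq_iff zero_index)
  qed
  then have "\<exists>B. B ** R0 = mat 1"
    using matrix_left_invertible_ker by blast
  then show ?thesis
    by (simp add: invertible_det_nz[symmetric] invertible_left_inverse)
qed

text \<open>The projections fix or kill the columns of the frame, so the matrix in the numerator is
  the one on the right-hand side times \<open>R0\<close>, and \<open>det R0\<close> cancels. The
  homoclinic function thus no longer depends on the chosen bases, which allows passing from the
  given frame to the bounded one.\<close>

lemma homoclinic_evans_projections:
  fixes M R0 R S T P\<^sub>m P\<^sub>p :: "complex^'n^'n"
  assumes frame: "hyperbolic_frame M R0 J"
    and form: "block_form M J R S T" and gap: "diagonal_gap \<eta> J T" "\<eta> > 0"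
  shows "homoclinic_evans P\<^sub>m P\<^sub>p R0 J =
    det (P\<^sub>m ** (R ** block_proj J ** S) + P\<^sub>p ** (R ** block_proj (- J) ** S))"
proof -
  note proj = hyperbolic_block_projections[OF form gap]
  let ?Qu = "R ** block_proj J ** S" and ?Qs = "R ** block_proj (- J) ** S"
  have un: "column j R0 \<in> unstable_subspace M" if "j \<in> J" for j
    using frame that unfolding hyperbolic_frame_def columns_basis_def by (metis imageI vec.span_base)
  have st: "column j R0 \<in> stable_subspace M" if "j \<notin> J" for j
    using frame that unfolding hyperbolic_frame_def columns_basis_def by (metis ComplI imageI vec.span_base)
  have "column k (\<chi> i j. if j \<in> J then (P\<^sub>m ** R0) $ i $ j else (P\<^sub>p ** R0) $ i $ j) =
      column k ((P\<^sub>m ** ?Qu + P\<^sub>p ** ?Qs) ** R0)" for k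
  proof -
    have "column k (\<chi> i j. if j \<in> J then (P\<^sub>m ** R0) $ i $ j else (P\<^sub>p ** R0) $ i $ j) =
        (if k \<in> J then P\<^sub>m *v column k R0 else P\<^sub>p *v column k R0)"
      by (simp add: column_mult[symmetric]) (simp add: column_def)
    moreover have "column k ((P\<^sub>m ** ?Qu + P\<^sub>p ** ?Qs) ** R0) =
        P\<^sub>m *v (?Qu *v column k R0) + P\<^sub>p *v (?Qs *v column k R0)"
      by (simp only: column_mult matrix_vector_mult_add_rdistrib matrix_vector_mul_assoc)
    ultimately show ?thesis
      using proj(3,4)[OF un] proj(5,6)[OF st] by simp
  qed
  then have "(\<chi> i j. if j \<in> J then (P\<^sub>m ** R0) $ i $ j else (P\<^sub>p ** R0) $ i $ j) =
      (P\<^sub>m ** ?Qu + P\<^sub>p ** ?Qs) ** R0"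
    unfolding matrix_eq_columns by blast
  then show ?thesis
    unfolding homoclinic_evans_def using hyperbolic_frame_det_nonzero[OF frame form gap]
    by (simp add: det_mul)
qed

section \<open>Linear differential equations\<close>

text \<open>\<open>exp (a * x) * (\<phi> x - b / a)\<close> does not increase. The last assumption
  admits \<open>a = 0\<close>, where \<open>b / a\<close> is 0 by convention and the bound holds
  only with \<open>b = 0\<close>; this case occurs when the perturbation vanishes.\<close>

lemma gronwall:
  fixes \<phi> \<phi>' :: "real \<Rightarrow> real"
  assumes "h \<ge> 0"
    and deriv: "\<And>x. x \<in> {0..h} \<Longrightarrow> (\<phi> has_real_derivative \<phi>' x) (at x within {0..h})"
    and le: "\<And>x. x \<in> {0..h} \<Longrightarrow> \<phi>' x \<le> - a * \<phi> x + b"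
    and "a \<noteq> 0 \<or> b = 0"
  shows "\<phi> h \<le> exp (- a * h) * \<phi> 0 + b / a * (1 - exp (- a * h))"
proof -
  define \<psi> where "\<psi> x = exp (a * x) * (\<phi> x - b / a)" for x
  define \<psi>' where "\<psi>' x = exp (a * x) * (a * \<phi> x - b + \<phi>' x)" for x
  have d: "(\<psi> has_real_derivative \<psi>' x) (at x within {0..h})" if "x \<in> {0..h}" for x
  proof -
    have "a * (b / a) = b" using assms(4) by auto
    then have eq: "exp (a * x) * a * (\<phi> x - b / a) + exp (a * x) * \<phi>' x = \<psi>' x"
      by (simp only: \<psi>'_def distrib_left right_diff_distrib mult.assoc)
    have 1: "((\<lambda>x. exp (a * x)) has_real_derivative exp (a * x) * a) (at x within {0..h})"
      by (auto intro!: derivative_eq_intros)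
    have 2: "((\<lambda>x. \<phi> x - b / a) has_real_derivative \<phi>' x) (at x within {0..h})"
      using DERIV_diff[OF deriv[OF that] DERIV_const] by simp
    show ?thesis
      unfolding \<psi>_def eq[symmetric]
      by (rule DERIV_cong[OF DERIV_mult[OF 1 2]]) (simp only: mult.commute)
  qed
  have "\<psi> 0 \<ge> \<psi> h"
  proof (rule DERIV_nonpos_imp_decreasing_open[OF \<open>h \<ge> 0\<close>])
    fix x assume x: "0 < x" "x < h"
    then have "(\<psi> has_real_derivative \<psi>' x) (at x)"
      using d[of x] by (simp add: at_within_Icc_at)
    moreover have "\<psi>' x \<le> 0"
      unfolding \<psi>'_def using le[of x] x by (intro mult_nonneg_nonpos) auto
    ultimately show "\<exists>y. (\<psi> has_real_derivative y) (at x) \<and> y \<le> 0" by blast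
  next
    show "continuous_on {0..h} \<psi>"
      using d by (meson DERIV_continuous_on)
  qed
  then have "\<phi> h - b / a \<le> exp (- (a * h)) * (\<phi> 0 - b / a)"
    by (simp add: \<psi>_def exp_minus field_simps)
  then show ?thesis by (simp add: algebra_simps)
qed

lemma norm_square_has_real_derivative:
  fixes u :: "real \<Rightarrow> complex"
  assumes "(u has_vector_derivative u') (at x within S)"
  shows "((\<lambda>x. (norm (u x))\<^sup>2) has_real_derivative 2 * Re (cnj (u x) * u')) (at x within S)"
proof -
  have *: "((\<lambda>x. Re (u x)) has_real_derivative Re u') (at x within S)"
    "((\<lambda>x. Im (u x)) has_real_derivative Im u') (at x within S)"
    using bounded_linear.has_vector_derivative[OF bounded_linear_Re assms]
      bounded_linear.has_vector_derivative[OF bounded_linear_Im assms]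
    by (simp_all add: has_real_derivative_iff_has_vector_derivative)
  show ?thesis
    unfolding cmod_power2
    by (rule DERIV_cong[OF DERIV_add[OF DERIV_power[OF *(1)] DERIV_power[OF *(2)]]])
      (simp add: algebra_simps)
qed

lemma has_vector_derivative_matrix_nth:
  fixes A :: "real \<Rightarrow> complex^'n^'m"
  assumes "(A has_vector_derivative A') F"
  shows "((\<lambda>x. A x $ i $ j) has_vector_derivative A' $ i $ j) F"
  using assms
  by (intro bounded_linear.has_vector_derivative[OF bounded_linear_vec_nth]) auto

lemma has_vector_derivative_matrix_mult_nth:
  fixes A B :: "real \<Rightarrow> complex^'n^'n"
  assumes "\<And>i j. ((\<lambda>x. A x $ i $ j) has_vector_derivative A' $ i $ j) (at x within S)"
    and "\<And>i j. ((\<lambda>x. B x $ i $ j) has_vector_derivative B' $ i $ j) (at x within S)"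
  shows "((\<lambda>x. (A x ** B x) $ i $ j) has_vector_derivative (A' ** B x + A x ** B') $ i $ j) (at x within S)"
  unfolding matrix_matrix_mult_def
  by (auto intro!: derivative_eq_intros assms simp: sum.distrib add.commute)

lemma has_vector_derivative_iff_quotient:
  fixes f :: "real \<Rightarrow> 'a::real_normed_vector"
  shows "(f has_vector_derivative D) (at x within S) \<longleftrightarrow>
    ((\<lambda>y. (f y - f x) /\<^sub>R (y - x)) \<longlongrightarrow> D) (at x within S)"
proof -
  have "norm (f y - f x - (y - x) *\<^sub>R D) / norm (y - x) = norm ((f y - f x) /\<^sub>R (y - x) - D)"
    if "y \<noteq> x" for y
  proof -
    have "(f y - f x) /\<^sub>R (y - x) - D = (f y - f x - (y - x) *\<^sub>R D) /\<^sub>R (y - x)"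
      using that by (simp add: scaleR_diff_right)
    then show ?thesis by (simp add: divide_inverse)
  qed
  then have "((\<lambda>y. norm (f y - f x - (y - x) *\<^sub>R D) / norm (y - x)) \<longlongrightarrow> 0) (at x within S) \<longleftrightarrow>
      ((\<lambda>y. norm ((f y - f x) /\<^sub>R (y - x) - D)) \<longlongrightarrow> 0) (at x within S)"
    by (intro tendsto_cong) (auto simp: eventually_at intro!: exI[of _ 1])
  then show ?thesis
    unfolding has_vector_derivative_def has_derivative_iff_norm
    by (simp add: tendsto_norm_zero_iff Lim_null[symmetric] bounded_linear_scaleR_left)
qed

text \<open>Everything follows from \<open>Q y - Q x = - (Q y ** (P y - P x) ** Q x)\<close>. With
  the bound \<open>B\<close> on the inverse this first yields continuity of \<open>Q\<close>, and
  then, after division by \<open>y - x\<close>, the limit of the difference quotient.\<close>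

lemma has_vector_derivative_matrix_inverse_nth:
  fixes P Q :: "real \<Rightarrow> complex^'n^'n"
  assumes inv: "\<And>y. y \<in> S \<Longrightarrow> Q y ** P y = mat 1" "\<And>y. y \<in> S \<Longrightarrow> P y ** Q y = mat 1"
    and bdd: "\<And>y i j. y \<in> S \<Longrightarrow> norm (Q y $ i $ j) \<le> B" and x: "x \<in> S"
    and P: "\<And>i j. ((\<lambda>y. P y $ i $ j) has_vector_derivative P' $ i $ j) (at x within S)"
  shows "((\<lambda>y. Q y $ i $ j) has_vector_derivative - (Q x ** P' ** Q x) $ i $ j) (at x within S)"
proof -
  have nth: "(A ** D ** E) $ i $ j = (\<Sum>l\<in>UNIV. \<Sum>k\<in>UNIV. A $ i $ k * D $ k $ l * E $ l $ j)"
    for A D E :: "complex^'n^'n" and i j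
    by (simp add: matrix_matrix_mult_def sum_distrib_right)
  have diff: "Q y - Q x = - (Q y ** (P y - P x) ** Q x)" if "y \<in> S" for y
  proof -
    have "Q y ** (P y - P x) ** Q x = (Q y ** P y) ** Q x - Q y ** (P x ** Q x)"
      by (simp add: matrix_eq matrix_vector_mul_assoc[symmetric] matrix_vector_mult_diff_rdistrib vec.diff)
    then show ?thesis using inv that x by simp
  qed
  have "0 \<le> B" using bdd[OF x] norm_ge_zero order_trans by blast
  have ev: "\<forall>\<^sub>F y in at x within S. y \<in> S"
    by (simp add: eventually_at_filter)
  have cont: "((\<lambda>y. Q y $ i $ j) \<longlongrightarrow> Q x $ i $ j) (at x within S)" for i j
  proof (rule LIM_zero_cancel)
    have Pc: "((\<lambda>y. P y $ i $ j) \<longlongrightarrow> P x $ i $ j) (at x within S)" for i j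
      using has_vector_derivative_continuous[OF P] by (simp add: continuous_within)
    have "((\<lambda>y. \<Sum>l\<in>UNIV. \<Sum>k\<in>UNIV. B * norm (P y $ k $ l - P x $ k $ l) * norm (Q x $ l $ j)) \<longlongrightarrow>
        (\<Sum>l\<in>(UNIV::'n set). \<Sum>k\<in>(UNIV::'n set). B * norm (P x $ k $ l - P x $ k $ l) * norm (Q x $ l $ j))) (at x within S)"
      by (intro tendsto_intros Pc)
    then have lim: "((\<lambda>y. \<Sum>l\<in>UNIV. \<Sum>k\<in>UNIV. B * norm (P y $ k $ l - P x $ k $ l) * norm (Q x $ l $ j)) \<longlongrightarrow> 0) (at x within S)"
      by simp
    show "((\<lambda>y. Q y $ i $ j - Q x $ i $ j) \<longlongrightarrow> 0) (at x within S)"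
    proof (rule Lim_null_comparison[OF _ lim], rule eventually_mono[OF ev])
      fix y assume y: "y \<in> S"
      have "norm (Q y $ i $ j - Q x $ i $ j) = norm ((Q y - Q x) $ i $ j)"
        by simp
      also have "\<dots> = norm (\<Sum>l\<in>UNIV. \<Sum>k\<in>UNIV. Q y $ i $ k * (P y - P x) $ k $ l * Q x $ l $ j)"
        by (simp only: diff[OF y] vector_uminus_component norm_minus_cancel nth)
      also have "\<dots> \<le> (\<Sum>l\<in>UNIV. \<Sum>k\<in>UNIV. B * norm (P y $ k $ l - P x $ k $ l) * norm (Q x $ l $ j))"
        using bdd[OF y] \<open>0 \<le> B\<close> by (intro sum_norm_le) (auto simp: norm_mult intro!: mult_mono)
      finally show "norm (Q y $ i $ j - Q x $ i $ j) \<le> \<dots>" .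
    qed
  qed
  have "((\<lambda>y. \<Sum>l\<in>UNIV. \<Sum>k\<in>UNIV. - (Q y $ i $ k * ((P y $ k $ l - P x $ k $ l) /\<^sub>R (y - x)) * Q x $ l $ j)) \<longlongrightarrow>
      (\<Sum>l\<in>UNIV. \<Sum>k\<in>UNIV. - (Q x $ i $ k * P' $ k $ l * Q x $ l $ j))) (at x within S)"
    using P unfolding has_vector_derivative_iff_quotient
    by (intro tendsto_intros cont) auto
  then have "((\<lambda>y. (Q y $ i $ j - Q x $ i $ j) /\<^sub>R (y - x)) \<longlongrightarrow>
      (\<Sum>l\<in>UNIV. \<Sum>k\<in>UNIV. - (Q x $ i $ k * P' $ k $ l * Q x $ l $ j))) (at x within S)"
  proof (rule Lim_transform_eventually, intro eventually_mono[OF ev])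
    fix y assume y: "y \<in> S"
    have "(Q y $ i $ j - Q x $ i $ j) /\<^sub>R (y - x) = ((Q y - Q x) $ i $ j) /\<^sub>R (y - x)"
      by simp
    also have "\<dots> = (\<Sum>l\<in>UNIV. \<Sum>k\<in>UNIV. - (Q y $ i $ k * ((P y $ k $ l - P x $ k $ l) /\<^sub>R (y - x)) * Q x $ l $ j))"
      by (simp only: diff[OF y] vector_uminus_component nth)
        (simp add: scaleR_sum_right sum_negf)
    finally show "(\<Sum>l\<in>UNIV. \<Sum>k\<in>UNIV. - (Q y $ i $ k * ((P y $ k $ l - P x $ k $ l) /\<^sub>R (y - x)) * Q x $ l $ j)) =
      (Q y $ i $ j - Q x $ i $ j) /\<^sub>R (y - x)" ..
  qed
  then show ?thesis
    unfolding has_vector_derivative_iff_quotient vector_uminus_component nth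
    by (simp add: sum_negf)
qed

text \<open>Run backwards from \<open>h\<close>, the squared length of the solution starts at 0 and
  satisfies a differential inequality with a linear right-hand side, so it stays 0 by
  Gronwall.\<close>

lemma solution_operator_injective_forward:
  fixes Y :: "real \<Rightarrow> complex^'n" and a :: "real \<Rightarrow> complex^'n^'n"
  assumes "h \<ge> 0" "Y h = 0"
    and Y: "\<And>x. x \<in> {0..h} \<Longrightarrow> (Y has_vector_derivative a x *v Y x) (at x within {0..h})"
    and a: "\<And>x i j. x \<in> {0..h} \<Longrightarrow> norm (a x $ i $ j) \<le> L"
  shows "Y 0 = 0"
proof -
  define \<phi> where "\<phi> x = (\<Sum>i\<in>UNIV. (norm (Y (h - x) $ i))\<^sup>2)" for x
  define \<phi>' where "\<phi>' x = (\<Sum>i\<in>UNIV. 2 * Re (cnj (Y (h - x) $ i) * - (a (h - x) *v Y (h - x)) $ i))" for x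
  define c where "c = real CARD('n) * (2 * (real CARD('n) * L))"
  have "norm (a 0 $ i $ i) \<le> L" for i
    using a[of 0] \<open>h \<ge> 0\<close> by simp
  then have "0 \<le> L"
    by (rule order_trans[OF norm_ge_zero])
  have d: "(\<phi> has_real_derivative \<phi>' x) (at x within {0..h})" if x: "x \<in> {0..h}" for x
    unfolding \<phi>_def \<phi>'_def
  proof (rule DERIV_sum, rule norm_square_has_real_derivative)
    fix i
    have im: "(\<lambda>y. h - y) ` {0..h} = {0..h}" by simp
    have "((\<lambda>y. h - y) has_vector_derivative -1) (at x within {0..h})"
      by (auto intro!: derivative_eq_intros)
    moreover have "((\<lambda>y. Y y $ i) has_vector_derivative (a (h - x) *v Y (h - x)) $ i) (at (h - x) within (\<lambda>y. h - y) ` {0..h})"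
      unfolding im using x
      by (intro bounded_linear.has_vector_derivative[OF bounded_linear_vec_nth Y]) simp
    ultimately show "((\<lambda>y. Y (h - y) $ i) has_vector_derivative - (a (h - x) *v Y (h - x)) $ i) (at x within {0..h})"
      by (auto dest: vector_diff_chain_within simp: o_def)
  qed
  have le: "\<phi>' x \<le> - (- c) * \<phi> x + 0" if x: "x \<in> {0..h}" for x
  proof -
    let ?y = "Y (h - x)"
    have comp: "norm (?y $ k) \<le> sqrt (\<phi> x)" for k
    proof (rule real_le_rsqrt)
      show "(norm (?y $ k))\<^sup>2 \<le> \<phi> x"
        unfolding \<phi>_def by (rule member_le_sum) auto
    qed
    have "\<phi>' x \<le> (\<Sum>i\<in>(UNIV::'n set). 2 * (real CARD('n) * L) * \<phi> x)"
      unfolding \<phi>'_def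
    proof (rule sum_mono)
      fix i
      have "norm ((a (h - x) *v ?y) $ i) \<le> (\<Sum>j\<in>(UNIV::'n set). L * sqrt (\<phi> x))"
        unfolding matrix_vector_mult_def vec_lambda_beta
      proof (rule sum_norm_le)
        fix j
        show "norm (a (h - x) $ i $ j * ?y $ j) \<le> L * sqrt (\<phi> x)"
          unfolding norm_mult using a[of "h - x" i j] x comp[of j] \<open>0 \<le> L\<close> by (intro mult_mono) auto
      qed
      then have "norm (?y $ i) * norm ((a (h - x) *v ?y) $ i) \<le> sqrt (\<phi> x) * (real CARD('n) * L * sqrt (\<phi> x))"
      proof (intro mult_mono comp)
        show "0 \<le> sqrt (\<phi> x)" by (simp add: \<phi>_def sum_nonneg)
      qed simp_all
      also have "\<dots> = real CARD('n) * L * \<phi> x"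
        by (simp add: \<phi>_def sum_nonneg)
      finally show "2 * Re (cnj (?y $ i) * - (a (h - x) *v ?y) $ i) \<le> 2 * (real CARD('n) * L) * \<phi> x"
        using complex_Re_le_cmod[of "cnj (?y $ i) * - (a (h - x) *v ?y) $ i"] by (simp add: norm_mult)
    qed
    then show ?thesis by (simp add: c_def)
  qed
  have "\<phi> h \<le> exp (- (- c) * h) * \<phi> 0 + 0 / (- c) * (1 - exp (- (- c) * h))"
    by (rule gronwall[OF \<open>h \<ge> 0\<close> d le]) simp_all
  then have "\<phi> h \<le> 0"
    using assms(2) by (simp add: \<phi>_def)
  then have "(\<Sum>i\<in>UNIV. (norm (Y 0 $ i))\<^sup>2) = 0"
    by (simp add: \<phi>_def sum_nonneg antisym)
  then show ?thesis
    by (simp add: sum_nonneg_eq_0_iff vec_eq_iff)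
qed

lemma scaleR_matrix_vector_mult: "(c *\<^sub>R A) *v v = c *\<^sub>R (A *v v)" for A :: "complex^'n^'n"
  by (simp add: vec_eq_iff matrix_vector_mult_def scaleR_sum_right)

text \<open>A kernel vector at \<open>x\<close> gives a solution that vanishes at \<open>x\<close>,
  hence also at 0, where \<open>\<Psi>\<close> is the identity. The sign \<open>s\<close> reflects
  the line if \<open>x < 0\<close>, so only positive times have to be treated.\<close>

lemma solution_operator_invertible:
  fixes a \<Psi> :: "real \<Rightarrow> complex^'n^'n"
  assumes sol: "solution_operator a \<Psi>" and cont: "continuous_on UNIV a"
  shows "invertible (\<Psi> x)"
proof -
  have "v = 0" if v: "\<Psi> x *v v = 0" for v
  proof -
    define s :: real where "s = (if x \<ge> 0 then 1 else - 1)"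
    have s: "s * \<bar>x\<bar> = x" by (simp add: s_def)
    let ?Y = "\<lambda>y. \<Psi> (s * y) *v v" and ?a = "\<lambda>y. s *\<^sub>R a (s * y)"
    have "continuous_on {0..\<bar>x\<bar>} ?a"
      by (intro continuous_intros continuous_on_compose2[OF cont]) auto
    then have "bounded (?a ` {0..\<bar>x\<bar>})"
      by (intro compact_imp_bounded compact_continuous_image) auto
    then have "\<exists>L. \<forall>y\<in>{0..\<bar>x\<bar>}. norm (?a y) \<le> L"
      unfolding bounded_iff by blast
    then obtain L where L: "\<And>y. y \<in> {0..\<bar>x\<bar>} \<Longrightarrow> norm (?a y) \<le> L"
      by blast
    have "?Y 0 = 0"
    proof (rule solution_operator_injective_forward[where h = "\<bar>x\<bar>" and a = ?a and L = L])
      show "\<Psi> (s * \<bar>x\<bar>) *v v = 0" by (simp add: s v)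
      fix y assume y: "y \<in> {0..\<bar>x\<bar>}"
      show "norm (?a y $ i $ j) \<le> L" for i j
        using L[OF y] norm_matrix_nth_le[of "?a y" i j] by linarith
      have "(\<Psi> has_vector_derivative a (s * y) ** \<Psi> (s * y)) (at (s * y) within (\<lambda>y. s * y) ` {0..\<bar>x\<bar>})"
        using sol by (auto simp: solution_operator_def intro: has_vector_derivative_at_within)
      moreover have "((\<lambda>y. s * y) has_vector_derivative s) (at y within {0..\<bar>x\<bar>})"
        by (auto intro!: derivative_eq_intros)
      ultimately have "((\<lambda>y. \<Psi> (s * y)) has_vector_derivative s *\<^sub>R (a (s * y) ** \<Psi> (s * y))) (at y within {0..\<bar>x\<bar>})"
        using vector_diff_chain_within[of "\<lambda>y. s * y" s y "{0..\<bar>x\<bar>}" \<Psi>] by (simp add: o_def)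
      moreover have "bounded_linear (\<lambda>A :: complex^'n^'n. A *v v)"
        unfolding linear_conv_bounded_linear[symmetric]
        by (rule linearI) (simp_all add: matrix_vector_mult_add_rdistrib scaleR_matrix_vector_mult)
      ultimately have "(?Y has_vector_derivative (s *\<^sub>R (a (s * y) ** \<Psi> (s * y))) *v v) (at y within {0..\<bar>x\<bar>})"
        by (rule bounded_linear.has_vector_derivative[rotated])
      then show "(?Y has_vector_derivative ?a y *v ?Y y) (at y within {0..\<bar>x\<bar>})"
        by (simp only: scaleR_matrix_vector_mult matrix_vector_mul_assoc[symmetric])
    qed auto
    then show "v = 0"
      using sol by (simp add: solution_operator_def)
  qed
  then have "\<exists>B. B ** \<Psi> x = mat 1"
    using matrix_left_invertible_ker by blast
  then show ?thesis
    by (simp add: invertible_left_inverse)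
qed

section \<open>Maximal minors of solutions\<close>

lemma has_vector_derivative_det:
  fixes A :: "real \<Rightarrow> complex^'n^'n"
  assumes "\<And>i j. ((\<lambda>x. A x $ i $ j) has_vector_derivative A' $ i $ j) (at x within S)"
  shows "((\<lambda>x. det (A x)) has_vector_derivative
    (\<Sum>i\<in>UNIV. det (\<chi> r. if r = i then A' $ i else A x $ r))) (at x within S)"
proof -
  have prod: "((\<lambda>x. \<Prod>i\<in>UNIV. A x $ i $ p i) has_vector_derivative
      (\<Sum>i\<in>UNIV. A' $ i $ p i * (\<Prod>r\<in>UNIV - {i}. A x $ r $ p r))) (at x within S)" for p :: "'n \<Rightarrow> 'n"
    unfolding has_vector_derivative_def
    by (rule has_derivative_eq_rhs[OF has_derivative_prod])
      (use assms in \<open>auto simp: has_vector_derivative_def scaleR_sum_right\<close>)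
  have row: "(\<Prod>r\<in>UNIV. (if r = i then A' $ i else A x $ r) $ p r) =
      A' $ i $ p i * (\<Prod>r\<in>UNIV - {i}. A x $ r $ p r)" for i and p :: "'n \<Rightarrow> 'n"
    by (subst prod.remove[of _ i]) (auto intro!: prod.cong)
  have "((\<lambda>x. det (A x)) has_vector_derivative
      (\<Sum>p | p permutes UNIV. of_int (sign p) * (\<Sum>i\<in>UNIV. A' $ i $ p i * (\<Prod>r\<in>UNIV - {i}. A x $ r $ p r)))) (at x within S)"
    unfolding det_def by (intro has_vector_derivative_sum has_vector_derivative_mult_right prod)
  also have "(\<Sum>p | p permutes UNIV. of_int (sign p) * (\<Sum>i\<in>UNIV. A' $ i $ p i * (\<Prod>r\<in>UNIV - {i}. A x $ r $ p r))) =
      (\<Sum>i\<in>UNIV. det (\<chi> r. if r = i then A' $ i else A x $ r))"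
    unfolding det_def vec_lambda_beta row sum_distrib_left by (rule sum.swap)
  finally show ?thesis .
qed

text \<open>The Cauchy-Binet expansion before selections with the same range are collected. Summing
  over maps instead of subsets avoids signs and any ordering of the rows.\<close>

lemma det_rows_expand:
  fixes L :: "'n::finite \<Rightarrow> 'k::finite \<Rightarrow> complex" and Y :: "'k \<Rightarrow> complex^'n"
  shows "det (\<chi> i j. \<Sum>k\<in>UNIV. L i k * Y k $ j) = (\<Sum>f\<in>UNIV. (\<Prod>i\<in>UNIV. L i (f i)) * det (\<chi> i. Y (f i)))"
proof -
  have "det (\<chi> i j. \<Sum>k\<in>UNIV. L i k * Y k $ j) =
      (\<Sum>p | p permutes UNIV. of_int (sign p) * (\<Sum>f\<in>UNIV. \<Prod>i\<in>UNIV. L i (f i) * Y (f i) $ p i))"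
    unfolding det_def by (simp add: prod_sum_PiE PiE_UNIV_domain)
  also have "\<dots> = (\<Sum>f\<in>UNIV. (\<Prod>i\<in>UNIV. L i (f i)) * det (\<chi> i. Y (f i)))"
    unfolding det_def sum_distrib_left
    by (subst sum.swap) (simp add: prod.distrib mult_ac)
  finally show ?thesis .
qed

text \<open>Indices are maps \<open>f\<close> selecting \<open>n\<close> rows of a matrix with rows indexed by \<open>'k\<close>.\<close>

definition minor :: "('k \<Rightarrow> complex^'n) \<Rightarrow> ('n \<Rightarrow> 'k) \<Rightarrow> complex" where
  "minor Y f = det (\<chi> i. Y (f i))"

lemma minor_not_inj: "\<not> inj f \<Longrightarrow> minor Y f = 0"
  unfolding minor_def inj_on_def by (auto intro!: det_identical_rows simp: row_def vec_eq_iff)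

text \<open>The system induced on the exterior power, with the additive compound of \<open>a\<close>
  as coefficient matrix: the derivative acts on one selected row at a time.\<close>

lemma minor_has_vector_derivative:
  fixes Y :: "real \<Rightarrow> 'k::finite \<Rightarrow> complex^'n"
  assumes "\<And>k j. ((\<lambda>x. Y x k $ j) has_vector_derivative (\<Sum>l\<in>UNIV. a k l * Y x l $ j)) (at x within S)"
  shows "((\<lambda>x. minor (Y x) f) has_vector_derivative
    (\<Sum>i\<in>UNIV. \<Sum>l\<in>UNIV. a (f i) l * minor (Y x) (f(i := l)))) (at x within S)"
proof -
  have "((\<lambda>x. minor (Y x) f) has_vector_derivative
      (\<Sum>i\<in>UNIV. det (\<chi> r. if r = i then (\<chi> i j. \<Sum>l\<in>UNIV. a (f i) l * Y x l $ j) $ i else (\<chi> i. Y x (f i)) $ r))) (at x within S)"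
    unfolding minor_def by (rule has_vector_derivative_det) (simp add: assms)
  also have "(\<Sum>i\<in>UNIV. det (\<chi> r. if r = i then (\<chi> i j. \<Sum>l\<in>UNIV. a (f i) l * Y x l $ j) $ i else (\<chi> i. Y x (f i)) $ r)) =
      (\<Sum>i\<in>UNIV. \<Sum>l\<in>UNIV. a (f i) l * minor (Y x) (f(i := l)))"
  proof (rule sum.cong[OF refl])
    fix i
    have row: "(\<chi> j. \<Sum>l\<in>UNIV. a (f i) l * Y x l $ j) = (\<Sum>l\<in>UNIV. a (f i) l *s Y x l)"
      by (simp add: vec_eq_iff)
    have "det (\<chi> r. if r = i then \<Sum>l\<in>UNIV. a (f i) l *s Y x l else Y x (f r)) =
        (\<Sum>l\<in>UNIV. det (\<chi> r. if r = i then a (f i) l *s Y x l else Y x (f r)))"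
      using det_linear_row_sum[of UNIV i "\<lambda>_ l. a (f i) l *s Y x l" "\<lambda>r. Y x (f r)"] by simp
    also have "\<dots> = (\<Sum>l\<in>UNIV. a (f i) l * minor (Y x) (f(i := l)))"
    proof (rule sum.cong[OF refl])
      fix l
      have "(\<chi> r. if r = i then Y x l else Y x (f r)) = (\<chi> r. Y x ((f(i := l)) r))"
        by (simp add: vec_eq_iff)
      then show "det (\<chi> r. if r = i then a (f i) l *s Y x l else Y x (f r)) = a (f i) l * minor (Y x) (f(i := l))"
        unfolding minor_def using det_row_mul[of i "a (f i) l" "\<lambda>_. Y x l" "\<lambda>r. Y x (f r)"] by simp
    qed
    finally show "det (\<chi> r. if r = i then (\<chi> i j. \<Sum>l\<in>UNIV. a (f i) l * Y x l $ j) $ i else (\<chi> i. Y x (f i)) $ r) =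
        (\<Sum>l\<in>UNIV. a (f i) l * minor (Y x) (f(i := l)))"
      unfolding vec_lambda_beta row .
  qed
  finally show ?thesis .
qed

text \<open>Among the sums of diagonal entries selected by injective \<open>f\<close>, the one over the good indices
  \<open>G\<close> has the largest real part, with gap \<open>2 \<eta>\<close>.\<close>

lemma diagonal_sum_gap:
  fixes f :: "'n::finite \<Rightarrow> 'k::finite" and d :: "'k \<Rightarrow> complex"
  assumes "inj f" "card G = CARD('n)" "\<eta> \<ge> 0"
    and "\<And>k. k \<in> G \<Longrightarrow> \<eta> \<le> Re (d k)" "\<And>k. k \<notin> G \<Longrightarrow> Re (d k) \<le> - \<eta>"
  shows "range f \<subseteq> G \<Longrightarrow> (\<Sum>i\<in>UNIV. d (f i)) = (\<Sum>k\<in>G. d k)"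
    and "\<not> range f \<subseteq> G \<Longrightarrow> Re ((\<Sum>i\<in>UNIV. d (f i)) - (\<Sum>k\<in>G. d k)) \<le> - 2 * \<eta>"
proof -
  have sum: "(\<Sum>i\<in>UNIV. d (f i)) = (\<Sum>k\<in>range f. d k)"
    using assms(1) by (simp add: sum.reindex)
  have card: "card (range f) = card G"
    using assms(1,2) by (simp add: card_image)
  show "(\<Sum>i\<in>UNIV. d (f i)) = (\<Sum>k\<in>G. d k)" if "range f \<subseteq> G"
    using card_subset_eq[of G "range f"] that card sum by simp
  assume "\<not> range f \<subseteq> G"
  then obtain k where k: "k \<in> range f - G" by blast
  have "card (range f - G) = card (G - range f)"
    using card by (simp add: card_Diff_subset_Int Int_commute)
  moreover have "card (range f - G) > 0"
    using k by (auto simp: card_gt_0_iff)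
  ultimately obtain k' where k': "k' \<in> G - range f"
    by (metis card_gt_0_iff ex_in_conv)
  have "(\<Sum>k\<in>range f. d k) - (\<Sum>k\<in>G. d k) = (\<Sum>k\<in>range f - G. d k) - (\<Sum>k\<in>G - range f. d k)"
    using sum.Int_Diff[of "range f" d G] sum.Int_Diff[of G d "range f"] by (simp add: Int_commute)
  moreover have "(\<Sum>k\<in>range f - G. Re (d k)) \<le> (\<Sum>l\<in>range f - G. if l = k then - \<eta> else 0)"
    using assms(3,5) by (intro sum_mono) (force intro: order_trans)
  moreover have "(\<Sum>l\<in>G - range f. if l = k' then \<eta> else 0) \<le> (\<Sum>k\<in>G - range f. Re (d k))"
    using assms(3,4) by (intro sum_mono) (force intro: order_trans)
  ultimately show "Re ((\<Sum>i\<in>UNIV. d (f i)) - (\<Sum>k\<in>G. d k)) \<le> - 2 * \<eta>"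
    using k k' by (simp add: sum)
qed

text \<open>Up to the factor \<open>exp (\<tau> x)\<close>, good minors are constant and the others decay. Couplings of
  size at most \<open>\<kappa>\<close> do not disturb this: they lead from good minors only to minors with a
  repeated row.\<close>

lemma minors_asymptotics:
  fixes Y :: "real \<Rightarrow> 'k::finite \<Rightarrow> complex^'n" and a :: "real \<Rightarrow> 'k \<Rightarrow> 'k \<Rightarrow> complex"
    and a0 :: "'k \<Rightarrow> 'k \<Rightarrow> complex" and G :: "'k set"
  defines "c \<equiv> 2 * real (CARD('n \<Rightarrow> 'k)) * (real CARD('n) * real CARD('k))"
    and "\<tau> \<equiv> (\<Sum>k\<in>G. a0 k k)"
  assumes "h > 0" "\<eta> > 0" "\<delta> \<ge> 0" "card G = CARD('n)"
    and ode: "\<And>x k j. x \<in> {0..h} \<Longrightarrow>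
      ((\<lambda>x. Y x k $ j) has_vector_derivative (\<Sum>l\<in>UNIV. a x k l * Y x l $ j)) (at x within {0..h})"
    and good: "\<And>k. k \<in> G \<Longrightarrow> \<eta> \<le> Re (a0 k k)" and bad: "\<And>k. k \<notin> G \<Longrightarrow> Re (a0 k k) \<le> - \<eta>"
    and block: "\<And>k l. (k \<in> G) \<noteq> (l \<in> G) \<Longrightarrow> a0 k l = 0"
    and off: "\<And>k l. k \<noteq> l \<Longrightarrow> norm (a0 k l) \<le> \<eta> / c"
    and pert: "\<And>x k l. x \<in> {0..h} \<Longrightarrow> norm (a x k l - a0 k l) \<le> \<delta>"
    and init: "\<And>f. norm (minor (Y 0) f) \<le> b"
  shows "norm (exp (- \<tau> * of_real h) * minor (Y h) f - (if range f \<subseteq> G then minor (Y 0) f else 0))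
    \<le> (exp (- \<eta> * h) + c * \<delta> * (h + 1 / \<eta>)) * (exp (c * \<delta> * h) * (c * b))"
proof -
  define N where "N = real CARD('n) * real CARD('k)"
  define F where "F = real (CARD('n \<Rightarrow> 'k))"
  have "CARD('n) \<ge> 1" "CARD('k) \<ge> 1" by (simp_all add: Suc_le_eq)
  then have "real CARD('n) * real CARD('k) \<ge> 1 * 1"
    by (intro mult_mono) (simp_all add: Suc_le_eq del: One_nat_def)
  then have N1: "N \<ge> 1" by (simp add: N_def)
  have F1: "F \<ge> 1" by (simp add: F_def Suc_le_eq)
  \<comment> \<open>\<open>N\<close> counts the terms of one coupling sum, \<open>F\<close> the
    selections of rows, and the 2 comes from differentiating a square.\<close>
  have c_eq: "c = 2 * F * N" by (simp add: c_def F_def N_def)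
  have c0: "c > 0" using N1 F1 by (simp add: c_eq)
  define Bad where "Bad = {f :: 'n \<Rightarrow> 'k. \<not> range f \<subseteq> G}"
  define u where "u x f = exp (- \<tau> * of_real x) * minor (Y x) f" for x and f :: "'n \<Rightarrow> 'k"
  define \<Theta> where "\<Theta> x f = (\<Sum>i\<in>UNIV. \<Sum>l\<in>UNIV. (a x (f i) l - a0 (f i) l) * u x (f(i := l)))"
    for x and f :: "'n \<Rightarrow> 'k"
  define \<Omega> where "\<Omega> x f = (\<Sum>i\<in>UNIV. \<Sum>l\<in>UNIV - {f i}. a0 (f i) l * u x (f(i := l)))"
    for x and f :: "'n \<Rightarrow> 'k"
  define lam where "lam f = (\<Sum>i\<in>UNIV. a0 (f i) (f i)) - \<tau>" for f :: "'n \<Rightarrow> 'k"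
  define u' where "u' x f = lam f * u x f + \<Omega> x f + \<Theta> x f" for x and f :: "'n \<Rightarrow> 'k"
  \<comment> \<open>Two energies: \<open>Z\<close> over all minors need only stay bounded up to
    \<open>exp (2 * c * \<delta> * h)\<close>; \<open>V\<close> over the bad ones decays and is fed
    by the rest solely through the perturbation.\<close>
  define Z where "Z x = (\<Sum>f\<in>UNIV. (norm (u x f))\<^sup>2)" for x
  define V where "V x = (\<Sum>f\<in>Bad. (norm (u x f))\<^sup>2)" for x
  have u_inj: "u x f = 0" if "\<not> inj f" for x f
    using that by (simp add: u_def minor_not_inj)
  have du: "((\<lambda>x. u x f) has_vector_derivative u' x f) (at x within {0..h})" if x: "x \<in> {0..h}" for x f
  proof -
    have e: "((\<lambda>x. exp (- \<tau> * of_real x)) has_vector_derivative - \<tau> * exp (- \<tau> * of_real x)) (at x within {0..h})"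
    proof -
      have "((\<lambda>z. exp (- \<tau> * z)) has_field_derivative - \<tau> * exp (- \<tau> * of_real x)) (at (of_real x))"
        by (auto intro!: derivative_eq_intros)
      then show ?thesis
        by (rule has_vector_derivative_real_field[where f = "\<lambda>z. exp (- \<tau> * z)"])
    qed
    have "((\<lambda>x. u x f) has_vector_derivative
        exp (- \<tau> * of_real x) * (\<Sum>i\<in>UNIV. \<Sum>l\<in>UNIV. a x (f i) l * minor (Y x) (f(i := l))) +
        - \<tau> * exp (- \<tau> * of_real x) * minor (Y x) f) (at x within {0..h})"
      unfolding u_def by (intro has_vector_derivative_mult e minor_has_vector_derivative ode x)
    also have "exp (- \<tau> * of_real x) * (\<Sum>i\<in>UNIV. \<Sum>l\<in>UNIV. a x (f i) l * minor (Y x) (f(i := l))) =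
        (\<Sum>i\<in>UNIV. \<Sum>l\<in>UNIV. a x (f i) l * u x (f(i := l)))"
      by (simp add: sum_distrib_left u_def mult_ac)
    also have "\<dots> = (\<Sum>i\<in>UNIV. \<Sum>l\<in>UNIV. a0 (f i) l * u x (f(i := l))) + \<Theta> x f"
      by (simp add: \<Theta>_def sum.distrib[symmetric] algebra_simps)
    also have "(\<Sum>i\<in>UNIV. \<Sum>l\<in>UNIV. a0 (f i) l * u x (f(i := l))) = (\<Sum>i\<in>UNIV. a0 (f i) (f i)) * u x f + \<Omega> x f"
    proof -
      have "(\<Sum>l\<in>UNIV. a0 (f i) l * u x (f(i := l))) =
          a0 (f i) (f i) * u x f + (\<Sum>l\<in>UNIV - {f i}. a0 (f i) l * u x (f(i := l)))" for i
        by (subst sum.remove[of _ "f i"]) auto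
      then show ?thesis by (simp add: \<Omega>_def sum.distrib sum_distrib_right)
    qed
    finally show ?thesis
      by (simp add: u'_def lam_def u_def algebra_simps)
  qed
  have dn: "((\<lambda>x. (norm (u x f))\<^sup>2) has_real_derivative 2 * Re (cnj (u x f) * u' x f)) (at x within {0..h})"
    if "x \<in> {0..h}" for x f
    by (rule norm_square_has_real_derivative[OF du[OF that]])
  have Z0: "Z x \<ge> 0" "V x \<ge> 0" for x
    by (auto simp: Z_def V_def sum_nonneg)
  have uZ: "norm (u x f) \<le> sqrt (Z x)" for x f
    unfolding Z_def by (rule real_le_rsqrt, rule member_le_sum) auto
  have uV: "norm (u x f) \<le> sqrt (V x)" if "f \<in> Bad" for x f
    unfolding V_def using that by (intro real_le_rsqrt member_le_sum) auto
  have \<Theta>_le: "norm (\<Theta> x f) \<le> N * \<delta> * sqrt (Z x)" if "x \<in> {0..h}" for x f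
  proof -
    have "norm (\<Theta> x f) \<le> (\<Sum>i\<in>(UNIV::'n set). \<Sum>l\<in>(UNIV::'k set). \<delta> * sqrt (Z x))"
      unfolding \<Theta>_def
    proof (intro sum_norm_le)
      fix i l
      show "norm ((a x (f i) l - a0 (f i) l) * u x (f(i := l))) \<le> \<delta> * sqrt (Z x)"
        unfolding norm_mult using pert[OF that] uZ \<open>\<delta> \<ge> 0\<close> by (intro mult_mono) auto
    qed
    then show ?thesis by (simp add: N_def mult_ac)
  qed
  have Re_le: "Re (cnj v * w) \<le> norm v * norm w" for v w
    using complex_Re_le_cmod[of "cnj v * w"] by (simp only: norm_mult complex_mod_cnj)
  have good_u': "norm (u' x f) \<le> N * \<delta> * sqrt (Z x)" if x: "x \<in> {0..h}" and f: "f \<notin> Bad" "inj f" for x f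
  proof -
    have fG: "range f \<subseteq> G" using f by (simp add: Bad_def)
    have "lam f = 0"
      unfolding lam_def \<tau>_def
      using diagonal_sum_gap(1)[OF \<open>inj f\<close> \<open>card G = CARD('n)\<close>, of \<eta> "\<lambda>k. a0 k k"] fG good bad \<open>\<eta> > 0\<close> by simp
    moreover have "a0 (f i) l * u x (f(i := l)) = 0" if "l \<noteq> f i" for i l
    proof (cases "l \<in> G")
      case True
      have "range f = G"
        using card_subset_eq[OF _ fG] \<open>card G = CARD('n)\<close> \<open>inj f\<close> by (simp add: card_image)
      then obtain r where r: "f r = l" using True by auto
      then have "r \<noteq> i" using that by auto
      then have "\<not> inj (f(i := l))"
        using r by (metis fun_upd_apply injD)
      then show ?thesis by (simp add: u_inj)
    next
      case False
      then show ?thesis using block[of "f i" l] fG by auto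
    qed
    then have "\<Omega> x f = 0"
      unfolding \<Omega>_def by (intro sum.neutral ballI) auto
    ultimately show ?thesis
      using \<Theta>_le[OF x, of f] by (simp add: u'_def)
  qed
  have good_d: "2 * Re (cnj (u x f) * u' x f) \<le> 2 * N * \<delta> * Z x" if x: "x \<in> {0..h}" and f: "f \<notin> Bad" for x f
  proof (cases "inj f")
    case True
    have "norm (u x f) * norm (u' x f) \<le> sqrt (Z x) * (N * \<delta> * sqrt (Z x))"
      using uZ good_u'[OF x f True] Z0 by (intro mult_mono) auto
    also have "\<dots> = N * \<delta> * Z x" using Z0(1)[of x] by simp
    finally show ?thesis
      using Re_le[of "u x f" "u' x f"] by linarith
  next
    case False
    then show ?thesis using Z0(1)[of x] N1 \<open>\<delta> \<ge> 0\<close> by (simp add: u_inj)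
  qed
  have bad_d: "2 * Re (cnj (u x f) * u' x f) \<le> - 4 * \<eta> * (norm (u x f))\<^sup>2 +
      2 * N * (\<eta> / c) * V x + 2 * N * \<delta> * (sqrt (V x) * sqrt (Z x))"
    if x: "x \<in> {0..h}" and f: "f \<in> Bad" for x f
  proof (cases "inj f")
    case True
    have "Re (lam f) \<le> - 2 * \<eta>"
      unfolding lam_def \<tau>_def
      using diagonal_sum_gap(2)[OF \<open>inj f\<close> \<open>card G = CARD('n)\<close>, of \<eta> "\<lambda>k. a0 k k"] f good bad \<open>\<eta> > 0\<close>
      by (simp add: Bad_def)
    then have l: "2 * Re (cnj (u x f) * (lam f * u x f)) \<le> - 4 * \<eta> * (norm (u x f))\<^sup>2"
    proof -
      have "cnj (u x f) * (lam f * u x f) = lam f * of_real ((norm (u x f))\<^sup>2)"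
        unfolding complex_norm_square by (simp only: mult_ac)
      then have "Re (cnj (u x f) * (lam f * u x f)) = Re (lam f * of_real ((norm (u x f))\<^sup>2))"
        by (simp only:)
      also have "\<dots> = Re (lam f) * (norm (u x f))\<^sup>2"
        by (simp del: of_real_power)
      also have "\<dots> \<le> - 2 * \<eta> * (norm (u x f))\<^sup>2"
        using \<open>Re (lam f) \<le> - 2 * \<eta>\<close> by (intro mult_right_mono) auto
      finally show ?thesis by simp
    qed
    \<comment> \<open>Nonzero couplings do not cross the boundary of \<open>G\<close>, so exchanging
      a row by coupling keeps a bad selection bad: either the bad row \<open>i0\<close> survives or
      it is replaced by another bad row. The couplings of bad minors are therefore controlled by
      \<open>V\<close> alone.\<close>
    obtain i0 where i0: "f i0 \<notin> G" using f by (auto simp: Bad_def)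
    have coupling: "norm (a0 (f i) k * u x (f(i := k))) \<le> \<eta> / c * sqrt (V x)" if "k \<noteq> f i" for i k
    proof (cases "(f i \<in> G) = (k \<in> G)")
      case True
      then have "(f(i := k)) i0 \<notin> G"
        using i0 by (cases "i = i0") auto
      then have "f(i := k) \<in> Bad" unfolding Bad_def by blast
      then show ?thesis
        unfolding norm_mult using off[of "f i" k] that uV c0 \<open>\<eta> > 0\<close> by (intro mult_mono) auto
    next
      case False
      then show ?thesis using block[of "f i" k] Z0 c0 \<open>\<eta> > 0\<close> by simp
    qed
    have "norm (\<Omega> x f) \<le> (\<Sum>i\<in>(UNIV::'n set). \<Sum>k\<in>UNIV - {f i}. \<eta> / c * sqrt (V x))"
      unfolding \<Omega>_def by (intro sum_norm_le coupling) auto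
    also have "\<dots> \<le> (\<Sum>i\<in>(UNIV::'n set). \<Sum>k\<in>(UNIV::'k set). \<eta> / c * sqrt (V x))"
      using Z0(2)[of x] c0 \<open>\<eta> > 0\<close> by (intro sum_mono sum_mono2) auto
    also have "\<dots> = N * (\<eta> / c) * sqrt (V x)" by (simp add: N_def)
    finally have "norm (u x f) * norm (\<Omega> x f) \<le> sqrt (V x) * (N * (\<eta> / c) * sqrt (V x))"
      using uV[OF f] Z0 by (intro mult_mono) auto
    also have "\<dots> = N * (\<eta> / c) * (sqrt (V x) * sqrt (V x))" by (simp only: mult_ac)
    also have "sqrt (V x) * sqrt (V x) = V x" using Z0(2)[of x] by simp
    finally have o: "Re (cnj (u x f) * \<Omega> x f) \<le> N * (\<eta> / c) * V x"
      using Re_le[of "u x f" "\<Omega> x f"] by linarith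
    have "norm (u x f) * norm (\<Theta> x f) \<le> sqrt (V x) * (N * \<delta> * sqrt (Z x))"
      using uV[OF f] \<Theta>_le[OF x] Z0 by (intro mult_mono) auto
    also have "\<dots> = N * \<delta> * (sqrt (V x) * sqrt (Z x))" by (simp only: mult_ac)
    finally have t: "Re (cnj (u x f) * \<Theta> x f) \<le> N * \<delta> * (sqrt (V x) * sqrt (Z x))"
      using Re_le[of "u x f" "\<Theta> x f"] by linarith
    have "2 * Re (cnj (u x f) * u' x f) = 2 * Re (cnj (u x f) * (lam f * u x f)) +
        2 * Re (cnj (u x f) * \<Omega> x f) + 2 * Re (cnj (u x f) * \<Theta> x f)"
      unfolding u'_def distrib_left by (simp only: plus_complex.sel distrib_left)
    with l o t show ?thesis by linarith
  next
    case False
    then show ?thesis using Z0 N1 c0 \<open>\<delta> \<ge> 0\<close> \<open>\<eta> > 0\<close> by (simp add: u_inj)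
  qed
  have cardB: "real (card Bad) \<le> F"
    unfolding F_def by (simp add: card_mono)
  define s where "s x = sqrt (V x) * sqrt (Z x)" for x
  have s0: "s x \<ge> 0" for x using Z0 by (simp add: s_def)
  have sZ: "s x \<le> Z x" for x
  proof -
    have "V x \<le> Z x" unfolding V_def Z_def by (intro sum_mono2) auto
    then have "s x \<le> sqrt (Z x) * sqrt (Z x)"
      unfolding s_def using Z0 by (intro mult_right_mono) auto
    then show ?thesis using Z0(1)[of x] by simp
  qed
  \<comment> \<open>The gap gives the rate \<open>4 * \<eta>\<close> for squares. Entries of size
    \<open>\<eta> / c\<close> summed over all couplings and selections consume just one
    \<open>\<eta>\<close> of it.\<close>
  have bad_sum: "(\<Sum>f\<in>Bad. 2 * Re (cnj (u x f) * u' x f)) \<le> - 3 * \<eta> * V x + c * \<delta> * s x" if x: "x \<in> {0..h}" for x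
  proof -
    have "(\<Sum>f\<in>Bad. 2 * Re (cnj (u x f) * u' x f)) \<le>
        (\<Sum>f\<in>Bad. - 4 * \<eta> * (norm (u x f))\<^sup>2 + (2 * N * (\<eta> / c) * V x + 2 * N * \<delta> * s x))"
    proof (rule sum_mono)
      fix f assume "f \<in> Bad"
      then show "2 * Re (cnj (u x f) * u' x f) \<le>
          - 4 * \<eta> * (norm (u x f))\<^sup>2 + (2 * N * (\<eta> / c) * V x + 2 * N * \<delta> * s x)"
        using bad_d[OF x, of f] unfolding s_def by linarith
    qed
    also have "\<dots> = - 4 * \<eta> * V x + real (card Bad) * (2 * N * (\<eta> / c) * V x + 2 * N * \<delta> * s x)"
      by (simp only: sum.distrib sum_constant sum_distrib_left[symmetric] V_def[symmetric] distrib_left)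
    also have "\<dots> \<le> - 4 * \<eta> * V x + F * (2 * N * (\<eta> / c) * V x + 2 * N * \<delta> * s x)"
      using cardB Z0(2)[of x] N1 c0 \<open>\<eta> > 0\<close> \<open>\<delta> \<ge> 0\<close> s0
      by (intro add_left_mono mult_right_mono) (auto intro!: add_nonneg_nonneg mult_nonneg_nonneg)
    also have "F * (2 * N * (\<eta> / c) * V x + 2 * N * \<delta> * s x) = c * (\<eta> / c) * V x + c * \<delta> * s x"
      by (simp only: c_eq) (simp add: algebra_simps)
    also have "c * (\<eta> / c) = \<eta>" using c0 by simp
    finally show ?thesis by simp
  qed
  \<comment> \<open>Good and bad minors each contribute at most \<open>c * \<delta> * Z x\<close> to
    the derivative; the couplings have already been absorbed by the decay of the bad ones.\<close>
  have Z_le: "Z y \<le> exp (2 * c * \<delta> * h) * Z 0" if y: "y \<in> {0..h}" for y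
  proof -
    define Z' where "Z' x = (\<Sum>f\<in>UNIV. 2 * Re (cnj (u x f) * u' x f))" for x
    have dZ: "(Z has_real_derivative Z' x) (at x within {0..y})" if "x \<in> {0..y}" for x
    proof (rule DERIV_subset)
      show "(Z has_real_derivative Z' x) (at x within {0..h})"
        unfolding Z_def Z'_def using that y by (intro DERIV_sum dn) auto
    qed (use y in auto)
    have "Z' x \<le> - (- 2 * c * \<delta>) * Z x + 0" if "x \<in> {0..y}" for x
    proof -
      have x: "x \<in> {0..h}" using that y by auto
      have "Z' x = (\<Sum>f\<in>-Bad. 2 * Re (cnj (u x f) * u' x f)) + (\<Sum>f\<in>Bad. 2 * Re (cnj (u x f) * u' x f))"
        unfolding Z'_def by (subst sum.subset_diff[of Bad]) (auto simp: Compl_eq_Diff_UNIV)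
      also have "(\<Sum>f\<in>-Bad. 2 * Re (cnj (u x f) * u' x f)) \<le> (\<Sum>f\<in>-Bad. 2 * N * \<delta> * Z x)"
        using good_d[OF x] by (intro sum_mono) auto
      also have "\<dots> \<le> (\<Sum>f\<in>(UNIV :: ('n \<Rightarrow> 'k) set). 2 * N * \<delta> * Z x)"
        using N1 \<open>\<delta> \<ge> 0\<close> Z0(1)[of x] by (intro sum_mono2) auto
      also have "\<dots> = c * \<delta> * Z x" by (simp add: c_eq F_def)
      also have "(\<Sum>f\<in>Bad. 2 * Re (cnj (u x f) * u' x f)) \<le> c * \<delta> * Z x"
      proof -
        have "c * \<delta> * s x \<le> c * \<delta> * Z x"
          using sZ c0 \<open>\<delta> \<ge> 0\<close> by (intro mult_left_mono) auto
        moreover have "- 3 * \<eta> * V x \<le> 0" using Z0(2)[of x] \<open>\<eta> > 0\<close> by simp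
        ultimately show ?thesis using bad_sum[OF x] by linarith
      qed
      finally show ?thesis by (simp add: algebra_simps)
    qed
    then have "Z y \<le> exp (- (- 2 * c * \<delta>) * y) * Z 0 + 0 / (- 2 * c * \<delta>) * (1 - exp (- (- 2 * c * \<delta>) * y))"
      using y by (intro gronwall[where \<phi>' = Z'] dZ) auto
    also have "\<dots> \<le> exp (2 * c * \<delta> * h) * Z 0"
      using y c0 \<open>\<delta> \<ge> 0\<close> Z0(1)[of 0] by (auto intro!: mult_right_mono mult_left_mono)
    finally show ?thesis .
  qed
  define Zm where "Zm = exp (2 * c * \<delta> * h) * Z 0"
  have Zm: "Z x \<le> Zm" if "x \<in> {0..h}" for x using Z_le[OF that] by (simp add: Zm_def)
  have Zm0: "Zm \<ge> 0" using Z0 by (simp add: Zm_def)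
  have V_le: "V h \<le> exp (- (2 * \<eta>) * h) * V 0 + ((c * \<delta>)\<^sup>2 / (4 * \<eta>) * Zm) / (2 * \<eta>) * (1 - exp (- (2 * \<eta>) * h))"
  proof (rule gronwall)
    fix x assume x: "x \<in> {0..h}"
    show "(V has_real_derivative (\<Sum>f\<in>Bad. 2 * Re (cnj (u x f) * u' x f))) (at x within {0..h})"
      unfolding V_def using x by (intro DERIV_sum dn)
    \<comment> \<open>Young's inequality, weighted so that it costs one more \<open>\<eta>\<close>
      of the remaining \<open>3 * \<eta>\<close>. The rate \<open>2 * \<eta>\<close> that is left
      for squares means the rate \<open>\<eta>\<close> for the minors themselves.\<close>
    have "c * \<delta> * s x = 2 * (sqrt \<eta> * sqrt (V x)) * (c * \<delta> * sqrt (Z x) / (2 * sqrt \<eta>))"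
      using \<open>\<eta> > 0\<close> by (simp add: s_def)
    also have "\<dots> \<le> (sqrt \<eta> * sqrt (V x))\<^sup>2 + (c * \<delta> * sqrt (Z x) / (2 * sqrt \<eta>))\<^sup>2"
      by (rule sum_squares_bound)
    also have "\<dots> = \<eta> * V x + (c * \<delta>)\<^sup>2 / (4 * \<eta>) * Z x"
      using \<open>\<eta> > 0\<close> Z0 by (simp add: power_mult_distrib power_divide)
    also have "\<dots> \<le> \<eta> * V x + (c * \<delta>)\<^sup>2 / (4 * \<eta>) * Zm"
      using Zm[OF x] \<open>\<eta> > 0\<close> by (intro add_left_mono mult_left_mono) auto
    finally show "(\<Sum>f\<in>Bad. 2 * Re (cnj (u x f) * u' x f)) \<le> - (2 * \<eta>) * V x + (c * \<delta>)\<^sup>2 / (4 * \<eta>) * Zm"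
      using bad_sum[OF x] by linarith
  qed (use \<open>h > 0\<close> \<open>\<eta> > 0\<close> in auto)
  have sqZm: "sqrt Zm \<le> exp (c * \<delta> * h) * (c * b)"
  proof -
    have b0: "b \<ge> 0" using init[of undefined] norm_ge_zero order_trans by blast
    have "Z 0 \<le> (\<Sum>f\<in>(UNIV::('n \<Rightarrow> 'k) set). b\<^sup>2)"
      unfolding Z_def u_def using init by (intro sum_mono power_mono) auto
    also have "\<dots> = F * b\<^sup>2" by (simp add: F_def)
    \<comment> \<open>Rounding \<open>F\<close> up to a square removes the root from the final
      bound.\<close>
    also have "\<dots> \<le> c\<^sup>2 * b\<^sup>2"
    proof (rule mult_right_mono)
      have "F * 1 \<le> F * (2 * N)"
        using F1 N1 by (intro mult_left_mono) auto
      then have "F \<le> c" by (simp add: c_eq)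
      moreover have "c * 1 \<le> c * c"
        using \<open>F \<le> c\<close> F1 by (intro mult_left_mono) auto
      ultimately show "F \<le> c\<^sup>2" by (simp add: power2_eq_square)
    qed simp
    finally have "Zm \<le> exp (2 * c * \<delta> * h) * (c\<^sup>2 * b\<^sup>2)"
      unfolding Zm_def by (intro mult_left_mono) auto
    also have "\<dots> = (exp (c * \<delta> * h) * (c * b))\<^sup>2"
      by (simp add: power_mult_distrib exp_double[symmetric] mult_ac)
    finally show ?thesis
      using b0 c0 by (intro real_le_lsqrt) auto
  qed
  have V0Z: "V 0 \<le> Zm"
  proof -
    have "V 0 \<le> Z 0" unfolding V_def Z_def by (intro sum_mono2) auto
    then show ?thesis using Zm[of 0] \<open>h > 0\<close> by simp
  qed
  have main: "norm (u h f - (if range f \<subseteq> G then u 0 f else 0)) \<le> (exp (- \<eta> * h) + c * \<delta> * (h + 1 / \<eta>)) * sqrt Zm"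
  proof (cases "f \<in> Bad")
    case True
    have q0: "0 \<le> c * \<delta> / \<eta>" using c0 \<open>\<delta> \<ge> 0\<close> \<open>\<eta> > 0\<close> by simp
    have "(norm (u h f))\<^sup>2 \<le> V h"
      unfolding V_def using True by (intro member_le_sum) auto
    also have "\<dots> \<le> exp (- (2 * \<eta>) * h) * Zm + ((c * \<delta>)\<^sup>2 / (4 * \<eta>) * Zm) / (2 * \<eta>) * 1"
    proof (rule order_trans[OF V_le], intro add_mono mult_left_mono V0Z)
      show "0 \<le> (c * \<delta>)\<^sup>2 / (4 * \<eta>) * Zm / (2 * \<eta>)" using Zm0 \<open>\<eta> > 0\<close> by simp
    qed auto
    also have "\<dots> \<le> (exp (- \<eta> * h))\<^sup>2 * Zm + (c * \<delta> / \<eta>)\<^sup>2 * Zm"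
    proof (rule add_mono)
      show "exp (- (2 * \<eta>) * h) * Zm \<le> (exp (- \<eta> * h))\<^sup>2 * Zm"
        by (simp add: exp_double[symmetric] mult_ac)
      have "((c * \<delta>)\<^sup>2 / (4 * \<eta>) * Zm) / (2 * \<eta>) * 1 = (c * \<delta> / \<eta>)\<^sup>2 * Zm / 8"
        using \<open>\<eta> > 0\<close> by (simp add: power2_eq_square)
      also have "\<dots> \<le> (c * \<delta> / \<eta>)\<^sup>2 * Zm"
        using Zm0 by simp
      finally show "((c * \<delta>)\<^sup>2 / (4 * \<eta>) * Zm) / (2 * \<eta>) * 1 \<le> (c * \<delta> / \<eta>)\<^sup>2 * Zm" .
    qed
    also have "\<dots> \<le> (exp (- \<eta> * h) + c * \<delta> / \<eta>)\<^sup>2 * Zm"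
    proof -
      have "v\<^sup>2 * Zm + w\<^sup>2 * Zm \<le> (v + w)\<^sup>2 * Zm" if "v \<ge> 0" "w \<ge> 0" for v w
        using Zm0 that by (simp add: power2_sum distrib_right)
      then show ?thesis using q0 by simp
    qed
    also have "\<dots> = ((exp (- \<eta> * h) + c * \<delta> / \<eta>) * sqrt Zm)\<^sup>2"
      using Zm0 by (simp add: power_mult_distrib)
    finally have "norm (u h f) \<le> (exp (- \<eta> * h) + c * \<delta> / \<eta>) * sqrt Zm"
      by (rule power2_le_imp_le) (intro mult_nonneg_nonneg add_nonneg_nonneg q0; simp add: Zm0)
    also have "\<dots> \<le> (exp (- \<eta> * h) + c * \<delta> * (h + 1 / \<eta>)) * sqrt Zm"
    proof (rule mult_right_mono)
      have "0 \<le> c * \<delta> * h" using c0 \<open>\<delta> \<ge> 0\<close> \<open>h > 0\<close> by simp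
      then show "exp (- \<eta> * h) + c * \<delta> / \<eta> \<le> exp (- \<eta> * h) + c * \<delta> * (h + 1 / \<eta>)"
        by (simp add: distrib_left)
    qed (simp add: Zm0)
    finally show ?thesis using True by (simp add: Bad_def)
  next
    case good: False
    show ?thesis
    proof (cases "inj f")
      case True
      \<comment> \<open>A good minor changes only through the perturbation, so its total drift is
        bounded by \<open>h\<close> times the size of that perturbation.\<close>
      have "\<exists>x\<in>{0<..<h}. norm (u h f - u 0 f) \<le> norm ((h - 0) *\<^sub>R u' x f)"
      proof (rule mvt_general[OF \<open>h > 0\<close>])
        show "continuous_on {0..h} (\<lambda>x. u x f)"
          using du by (intro continuous_on_vector_derivative) auto
        show "((\<lambda>x. u x f) has_derivative (\<lambda>t. t *\<^sub>R u' x f)) (at x)" if "0 < x" "x < h" for x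
          using du[of x f] that by (simp add: at_within_Icc_at has_vector_derivative_def)
      qed
      then obtain x where "x \<in> {0<..<h}" and le: "norm (u h f - u 0 f) \<le> norm ((h - 0) *\<^sub>R u' x f)"
        by blast
      then have x: "x \<in> {0..h}" by simp
      from le have "norm (u h f - u 0 f) \<le> h * norm (u' x f)"
        using \<open>h > 0\<close> by simp
      also have "h * norm (u' x f) \<le> h * (N * \<delta> * sqrt Zm)"
      proof (rule mult_left_mono)
        have "norm (u' x f) \<le> N * \<delta> * sqrt (Z x)" by (rule good_u'[OF x good True])
        also have "\<dots> \<le> N * \<delta> * sqrt Zm"
          using Zm[OF x] N1 \<open>\<delta> \<ge> 0\<close> by (intro mult_left_mono) auto
        finally show "norm (u' x f) \<le> N * \<delta> * sqrt Zm" .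
      qed (use \<open>h > 0\<close> in simp)
      also have "\<dots> = (N * (\<delta> * h)) * sqrt Zm" by simp
      also have "\<dots> \<le> (exp (- \<eta> * h) + c * \<delta> * (h + 1 / \<eta>)) * sqrt Zm"
      proof (rule mult_right_mono)
        have "1 * N \<le> (2 * F) * N" using F1 N1 by (intro mult_right_mono) auto
        then have "N * (\<delta> * h) \<le> c * (\<delta> * h)"
          using \<open>\<delta> \<ge> 0\<close> \<open>h > 0\<close> by (intro mult_right_mono) (auto simp: c_eq)
        also have "\<dots> \<le> c * \<delta> * (h + 1 / \<eta>)"
          using c0 \<open>\<delta> \<ge> 0\<close> \<open>\<eta> > 0\<close> by (simp add: distrib_left)
        finally show "N * (\<delta> * h) \<le> exp (- \<eta> * h) + c * \<delta> * (h + 1 / \<eta>)"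
          by (simp add: add_increasing)
      qed (use Zm0 in simp)
      finally show ?thesis using good by (simp add: Bad_def)
    next
      case False
      then show ?thesis
        using c0 \<open>\<delta> \<ge> 0\<close> \<open>\<eta> > 0\<close> \<open>h > 0\<close> Zm0 by (simp add: u_inj)
    qed
  qed
  also have "\<dots> \<le> (exp (- \<eta> * h) + c * \<delta> * (h + 1 / \<eta>)) * (exp (c * \<delta> * h) * (c * b))"
    using sqZm c0 \<open>\<delta> \<ge> 0\<close> \<open>\<eta> > 0\<close> \<open>h > 0\<close> by (intro mult_left_mono) auto
  finally show ?thesis
    by (simp add: u_def cong: if_cong)
qed

section \<open>The coordinates given by a conjugator\<close>

lemma matrix_vector_mult_minus: "(- A) *v v = - (A *v v)" for A :: "complex^'n^'n"
  by (simp add: vec_eq_iff matrix_vector_mult_def sum_negf)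

lemma has_vector_derivative_const_mult_nth:
  fixes A B C :: "complex^'n^'n" and Y :: "real \<Rightarrow> complex^'n^'n"
  assumes "\<And>i j. ((\<lambda>x. Y x $ i $ j) has_vector_derivative Y' $ i $ j) (at x within H)"
  shows "((\<lambda>x. (A ** Y x ** C) $ i $ j) has_vector_derivative (A ** Y' ** C) $ i $ j) (at x within H)"
proof -
  have const: "((\<lambda>x. D $ i $ j) has_vector_derivative (0 :: complex^'n^'n) $ i $ j) (at x within H)"
    for D :: "complex^'n^'n" and i j
    by simp
  have 1: "((\<lambda>x. (A ** Y x) $ i $ j) has_vector_derivative (A ** Y') $ i $ j) (at x within H)" for i j
    using has_vector_derivative_matrix_mult_nth[of "\<lambda>_. A" 0 x H Y Y' i j, OF const assms] by simp
  show ?thesis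
    using has_vector_derivative_matrix_mult_nth[of "\<lambda>x. A ** Y x" "A ** Y'" x H "\<lambda>_. C" 0 i j, OF 1 const] by simp
qed

text \<open>Inserting \<open>a0 x ** P x - P x ** M\<close> for the derivative of \<open>P\<close>
  into the derivative of the inverse, the terms with \<open>a0\<close> and \<open>a\<close> leave
  only their difference, while \<open>M\<close> moves to the left and becomes \<open>T\<close> under
  \<open>S\<close>. The constant \<open>C\<close> later holds the inverse of \<open>\<Psi>\<close>
  at an endpoint.\<close>

lemma conjugated_solution:
  fixes P Q \<Psi> a a0 :: "real \<Rightarrow> complex^'n^'n" and M R S T C :: "complex^'n^'n"
  assumes inv: "\<And>y. y \<in> H \<Longrightarrow> Q y ** P y = mat 1" "\<And>y. y \<in> H \<Longrightarrow> P y ** Q y = mat 1"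
    and bdd: "\<And>y i j. y \<in> H \<Longrightarrow> norm (Q y $ i $ j) \<le> B"
    and P: "(P has_vector_derivative (a0 x ** P x - P x ** M)) (at x within H)"
    and \<Psi>: "(\<Psi> has_vector_derivative (a x ** \<Psi> x)) (at x)"
    and RS: "R ** S = mat 1" "S ** R = mat 1" "M ** R = R ** T" and x: "x \<in> H"
  shows "((\<lambda>x. (S ** (Q x ** \<Psi> x) ** C) $ i $ j) has_vector_derivative
    ((T + S ** Q x ** (a x - a0 x) ** P x ** R) ** (S ** (Q x ** \<Psi> x) ** C)) $ i $ j) (at x within H)"
proof -
  define P' where "P' = a0 x ** P x - P x ** M"
  have "((\<lambda>y. Q y $ i $ j) has_vector_derivative (- (Q x ** P' ** Q x)) $ i $ j) (at x within H)" for i j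
    using has_vector_derivative_matrix_inverse_nth[OF inv bdd x has_vector_derivative_matrix_nth[OF P]]
    by (simp add: P'_def)
  moreover have "((\<lambda>y. \<Psi> y $ i $ j) has_vector_derivative (a x ** \<Psi> x) $ i $ j) (at x within H)" for i j
    using has_vector_derivative_matrix_nth[OF \<Psi>] by (rule has_vector_derivative_at_within)
  ultimately have "((\<lambda>y. (Q y ** \<Psi> y) $ i $ j) has_vector_derivative
      (- (Q x ** P' ** Q x) ** \<Psi> x + Q x ** (a x ** \<Psi> x)) $ i $ j) (at x within H)" for i j
    by (rule has_vector_derivative_matrix_mult_nth)
  then have "((\<lambda>x. (S ** (Q x ** \<Psi> x) ** C) $ i $ j) has_vector_derivative
      (S ** (- (Q x ** P' ** Q x) ** \<Psi> x + Q x ** (a x ** \<Psi> x)) ** C) $ i $ j) (at x within H)"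
    by (rule has_vector_derivative_const_mult_nth)
  also have "S ** (- (Q x ** P' ** Q x) ** \<Psi> x + Q x ** (a x ** \<Psi> x)) ** C =
      (T + S ** Q x ** (a x - a0 x) ** P x ** R) ** (S ** (Q x ** \<Psi> x) ** C)"
  proof -
    have rules: "Q x *v (P x *v w) = w" "P x *v (Q x *v w) = w" "R *v (S *v w) = w" for w
      by (simp_all add: matrix_vector_mul_assoc inv[OF x] RS)
    have TS: "T *v (S *v w) = S *v (M *v w)" for w
    proof -
      have "T ** S = S ** (R ** T) ** S" by (simp add: matrix_mul_assoc RS(2))
      also have "\<dots> = S ** M ** (R ** S)" by (simp only: RS(3)[symmetric] matrix_mul_assoc)
      finally show ?thesis by (simp add: matrix_vector_mul_assoc RS(1))
    qed
    show ?thesis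
      unfolding matrix_eq P'_def
      by (simp add: matrix_vector_mul_assoc[symmetric] matrix_vector_mult_add_rdistrib
          matrix_vector_mult_diff_rdistrib matrix_vector_mult_minus vec.add vec.diff vec.neg rules TS)
  qed
  finally show ?thesis .
qed

text \<open>A single spectral parameter with explicit constants, so that estimates can be quantified
  over all systems sharing them.\<close>

definition conjugator_at ::
    "real set \<Rightarrow> (real \<Rightarrow> complex^'n^'n) \<Rightarrow> complex^'n^'n \<Rightarrow> real \<Rightarrow> real \<Rightarrow> real \<Rightarrow> (real \<Rightarrow> complex^'n^'n) \<Rightarrow> bool" where
  "conjugator_at H a0 M \<eta>' B C P \<longleftrightarrow> (\<forall>x\<in>H. norm (P x) \<le> B \<and> invertible (P x) \<and> norm (matrix_inv (P x)) \<le> B \<and>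
     (P has_vector_derivative (a0 x ** P x - P x ** M)) (at x within H) \<and>
     norm (P x - mat 1) \<le> C * exp (- \<eta>' * \<bar>x\<bar>))"

lemma matrix_inv_inverse:
  assumes "invertible (A :: complex^'n^'n)"
  shows "matrix_inv A ** A = mat 1" "A ** matrix_inv A = mat 1"
  using someI_ex[OF assms[unfolded invertible_def]] unfolding matrix_inv_def by blast+

text \<open>\<open>Q - mat 1 = Q ** (mat 1 - P x)\<close> for the inverse \<open>Q\<close> of
  \<open>P x\<close>, and \<open>Q\<close> is bounded.\<close>

lemma conjugator_at_inverse_close:
  fixes P :: "real \<Rightarrow> complex^'n^'n"
  assumes "conjugator_at H a0 M \<eta>' B C P" "x \<in> H" "B \<ge> 0" "C \<ge> 0"
  shows "norm ((matrix_inv (P x) - mat 1) $ i $ j) \<le> real CARD('n) * (B * (C * exp (- \<eta>' * \<bar>x\<bar>)))"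
proof -
  let ?Q = "matrix_inv (P x)"
  have P: "invertible (P x)" "norm ?Q \<le> B" "norm (P x - mat 1) \<le> C * exp (- \<eta>' * \<bar>x\<bar>)"
    using assms by (auto simp: conjugator_at_def)
  have "?Q - mat 1 = ?Q ** (mat 1 - P x)"
    unfolding matrix_eq
    by (simp add: matrix_vector_mul_assoc[symmetric] matrix_vector_mult_diff_rdistrib vec.diff)
      (simp add: matrix_vector_mul_assoc matrix_inv_inverse[OF P(1)])
  moreover have "norm ((?Q ** (mat 1 - P x)) $ i $ j) \<le> real CARD('n) * (B * (C * exp (- \<eta>' * \<bar>x\<bar>)))"
  proof (rule norm_matrix_mult_nth_le)
    show "norm (?Q $ i $ j) \<le> B" for i j
      using norm_matrix_nth_le[of ?Q i j] P(2) by linarith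
    show "norm ((mat 1 - P x) $ i $ j) \<le> C * exp (- \<eta>' * \<bar>x\<bar>)" for i j
      using norm_matrix_nth_le[of "mat 1 - P x" i j] P(3) by (simp add: norm_minus_commute)
  qed
  ultimately show ?thesis by simp
qed

lemma UNIV_sum_Plus: "(\<Sum>k\<in>UNIV. g k) = (\<Sum>i\<in>UNIV. g (Inl i)) + (\<Sum>i\<in>UNIV. g (Inr i))"
  for g :: "'a::finite + 'b::finite \<Rightarrow> 'c::comm_monoid_add"
  by (simp add: UNIV_Plus_UNIV[symmetric] sum.Plus del: UNIV_Plus_UNIV)

section \<open>Convergence of the periodic Evans function\<close>

text \<open>Trades the linear factor of a drift over time \<open>h\<close> for part of the
  exponential rate, using \<open>t \<le> exp t\<close>.\<close>

lemma mult_exp_le: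
  fixes \<eta> \<theta> h :: real
  assumes "\<eta> < \<theta>"
  shows "h * exp (- \<theta> * h) \<le> exp (- \<eta> * h) / (\<theta> - \<eta>)"
proof -
  have "(\<theta> - \<eta>) * h \<le> exp ((\<theta> - \<eta>) * h)"
    using exp_ge_add_one_self[of "(\<theta> - \<eta>) * h"] by linarith
  then have "(\<theta> - \<eta>) * h * exp (- \<theta> * h) \<le> exp ((\<theta> - \<eta>) * h) * exp (- \<theta> * h)"
    by (intro mult_right_mono) auto
  also have "\<dots> = exp (- \<eta> * h)"
    by (simp add: exp_add[symmetric] algebra_simps)
  finally show ?thesis
    using assms by (simp add: field_simps)
qed

text \<open>The index \<open>Inl i\<close> stands for the solution on the left half-line, run from \<open>-h\<close> to \<open>0\<close>, and
  \<open>Inr i\<close> for the one on the right half-line, run from \<open>h\<close> to \<open>0\<close>. The first grows on the unstable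
  and the second on the stable block, so the good indices \<open>good_rows J\<close> are exactly as many as needed.\<close>

definition good_rows :: "'n set \<Rightarrow> ('n + 'n) set" where
  "good_rows J = Inl ` J \<union> Inr ` (- J)"

lemma card_good_rows: "card (good_rows J) = CARD('n)" for J :: "'n::finite set"
proof -
  have "card (good_rows J) = card J + card (- J)"
    unfolding good_rows_def by (subst card_Un_disjoint) (auto simp: card_image)
  also have "\<dots> = card (J \<union> - J)" by (subst card_Un_disjoint) auto
  finally show ?thesis by simp
qed

lemma good_rows_simps [simp]: "Inl i \<in> good_rows J \<longleftrightarrow> i \<in> J" "Inr i \<in> good_rows J \<longleftrightarrow> i \<notin> J"
  by (auto simp: good_rows_def)

text \<open>The time \<open>s\<close> runs over \<open>[0, h]\<close>, with \<open>x = s - h\<close>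
  on the left and \<open>x = h - s\<close> on the right half-line; the reversal on the right changes
  the sign of \<open>T\<close>, so the stable block grows there. At \<open>s = 0\<close> the
  solution operator cancels and the conjugators are close to the identity, so both halves start
  close to \<open>S\<close>; at \<open>s = h\<close> both have arrived at \<open>x = 0\<close>. The
  constant is chosen before all systems, lengths and selections.\<close>

lemma minors_limit:
  fixes \<eta> \<eta>' \<theta>' B b Cc Cd :: real
  assumes \<eta>: "0 < \<eta>" "\<eta> < \<eta>'" "\<eta>' < \<theta>'" and const: "B \<ge> 1" "b \<ge> 1" "Cc \<ge> 0" "Cd \<ge> 0"
  shows "\<exists>C\<ge>0. \<forall>(M :: complex^'n^'n) R S T J a0 a Pm Pp \<Psi> h f.
    block_form M J R S T \<longrightarrow> diagonal_gap \<eta> J T \<longrightarrow>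
    (\<forall>j k. j \<noteq> k \<longrightarrow> norm (T $ j $ k) \<le> \<eta> / (2 * real (CARD('n \<Rightarrow> 'n + 'n)) * (real CARD('n) * real CARD('n + 'n)))) \<longrightarrow>
    (\<forall>i j. norm (R $ i $ j) \<le> b) \<longrightarrow> (\<forall>i j. norm (S $ i $ j) \<le> b) \<longrightarrow> h > 0 \<longrightarrow>
    conjugator_at {..0} a0 M \<eta>' B Cc Pm \<longrightarrow> conjugator_at {0..} a0 M \<eta>' B Cc Pp \<longrightarrow>
    solution_operator a \<Psi> \<longrightarrow> continuous_on UNIV a \<longrightarrow>
    (\<forall>x. \<bar>x\<bar> \<le> h \<longrightarrow> norm (a x - a0 x) \<le> Cd * exp (- \<theta>' * h)) \<longrightarrow>
    norm (exp (- ((\<Sum>j\<in>J. T $ j $ j) - (\<Sum>j\<in>-J. T $ j $ j)) * of_real h) *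
        minor (case_sum (\<lambda>i. (S ** (matrix_inv (Pm 0) ** \<Psi> 0) ** matrix_inv (\<Psi> (- h))) $ i)
          (\<lambda>i. (S ** (matrix_inv (Pp 0) ** \<Psi> 0) ** matrix_inv (\<Psi> h)) $ i)) f -
      (if range f \<subseteq> good_rows J then minor (case_sum (\<lambda>i. S $ i) (\<lambda>i. S $ i)) f else 0))
    \<le> C * exp (- \<eta> * h)"
proof -
  define n where "n = real CARD('n)"
  have n1: "n \<ge> 1" by (simp add: n_def Suc_le_eq)
  \<comment> \<open>\<open>D\<close> bounds the product \<open>S ** Q ** (a - a0) ** P ** R\<close>
    without its exponential, one \<open>n\<close> for each matrix product; \<open>b2\<close> and
    \<open>b3\<close> bound the initial entries and the initial minors. \<open>C1\<close> accounts
    for the evolution and \<open>C2\<close> for replacing the initial values by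
    \<open>S\<close>.\<close>
  define D where "D = n * (n * (n * (n * (b * B) * Cd) * B) * b)"
  define c where "c = 2 * real (CARD('n \<Rightarrow> 'n + 'n)) * (real CARD('n) * real CARD('n + 'n))"
  define b2 where "b2 = n * (b * B)"
  define b3 where "b3 = fact CARD('n) * b2 ^ CARD('n)"
  define C1 where "C1 = (1 + c * D * (1 / (\<theta>' - \<eta>) + 1 / \<eta>)) * (exp (c * D / (\<theta>' - \<eta>)) * (c * b3))"
  define C2 where "C2 = fact CARD('n) * (CARD('n) * b2 ^ CARD('n)) * (n * (b * (n * (B * Cc))))"
  have D0: "D \<ge> 0" using n1 const by (simp add: D_def)
  have c0: "c \<ge> 0" by (simp add: c_def)
  have "b * 1 \<le> b * B" "1 * (b * B) \<le> n * (b * B)"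
    using n1 const by (intro mult_left_mono mult_right_mono; simp)+
  then have b2: "b2 \<ge> 1" "b \<le> b2" using const unfolding b2_def by linarith+
  have b30: "b3 \<ge> 0" using b2 by (simp add: b3_def)
  have C10: "C1 \<ge> 0" using D0 c0 b30 \<eta> by (simp add: C1_def)
  have C20: "C2 \<ge> 0" using n1 const b2 by (simp add: C2_def)
  have main: "norm (exp (- ((\<Sum>j\<in>J. T $ j $ j) - (\<Sum>j\<in>-J. T $ j $ j)) * of_real h) *
        minor (case_sum (\<lambda>i. (S ** (matrix_inv (Pm 0) ** \<Psi> 0) ** matrix_inv (\<Psi> (- h))) $ i)
          (\<lambda>i. (S ** (matrix_inv (Pp 0) ** \<Psi> 0) ** matrix_inv (\<Psi> h)) $ i)) f -
      (if range f \<subseteq> good_rows J then minor (case_sum (\<lambda>i. S $ i) (\<lambda>i. S $ i)) f else 0))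
    \<le> (C1 + C2) * exp (- \<eta> * h)"
    if form: "block_form M J R S T" and gap: "diagonal_gap \<eta> J T"
      and off: "\<And>j k. j \<noteq> k \<Longrightarrow> norm (T $ j $ k) \<le> \<eta> / c"
      and Rb: "\<And>i j. norm (R $ i $ j) \<le> b" and Sb: "\<And>i j. norm (S $ i $ j) \<le> b" and h: "h > 0"
      and Pm: "conjugator_at {..0} a0 M \<eta>' B Cc Pm" and Pp: "conjugator_at {0..} a0 M \<eta>' B Cc Pp"
      and sol: "solution_operator a \<Psi>" and cont: "continuous_on UNIV a"
      and close: "\<And>x. \<bar>x\<bar> \<le> h \<Longrightarrow> norm (a x - a0 x) \<le> Cd * exp (- \<theta>' * h)"
    for M R S T :: "complex^'n^'n" and J a0 a Pm Pp \<Psi> h and f :: "'n \<Rightarrow> 'n + 'n"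
  proof -
    have RS: "R ** S = mat 1" "S ** R = mat 1" "M ** R = R ** T"
      and blk: "\<And>j k. (j \<in> J) \<noteq> (k \<in> J) \<Longrightarrow> T $ j $ k = 0"
      using form unfolding block_form_def by blast+
    define Qm where "Qm x = matrix_inv (Pm x)" for x
    define Qp where "Qp x = matrix_inv (Pp x)" for x
    have Qm: "Qm x ** Pm x = mat 1" "Pm x ** Qm x = mat 1" "norm (Qm x $ i $ j) \<le> B" "norm (Pm x $ i $ j) \<le> B"
      "(Pm has_vector_derivative (a0 x ** Pm x - Pm x ** M)) (at x within {..0})" if "x \<in> {..0}" for x i j
      using Pm that matrix_inv_inverse[of "Pm x"] norm_matrix_nth_le[of "Qm x" i j] norm_matrix_nth_le[of "Pm x" i j]
      unfolding conjugator_at_def Qm_def by (blast intro: order_trans)+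
    have Qp: "Qp x ** Pp x = mat 1" "Pp x ** Qp x = mat 1" "norm (Qp x $ i $ j) \<le> B" "norm (Pp x $ i $ j) \<le> B"
      "(Pp has_vector_derivative (a0 x ** Pp x - Pp x ** M)) (at x within {0..})" if "x \<in> {0..}" for x i j
      using Pp that matrix_inv_inverse[of "Pp x"] norm_matrix_nth_le[of "Qp x" i j] norm_matrix_nth_le[of "Pp x" i j]
      unfolding conjugator_at_def Qp_def by (blast intro: order_trans)+
    have \<Psi>': "(\<Psi> has_vector_derivative (a x ** \<Psi> x)) (at x)" for x
      using sol by (simp add: solution_operator_def)
    have \<Psi>inv: "\<Psi> x ** matrix_inv (\<Psi> x) = mat 1" for x
      using matrix_inv_inverse(2)[OF solution_operator_invertible[OF sol cont]] .
    define Ym where "Ym x = S ** (Qm x ** \<Psi> x) ** matrix_inv (\<Psi> (- h))" for x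
    define Yp where "Yp x = S ** (Qp x ** \<Psi> x) ** matrix_inv (\<Psi> h)" for x
    define Em where "Em x = S ** Qm x ** (a x - a0 x) ** Pm x ** R" for x
    define Ep where "Ep x = S ** Qp x ** (a x - a0 x) ** Pp x ** R" for x
    have dYm: "((\<lambda>x. Ym x $ i $ j) has_vector_derivative ((T + Em x) ** Ym x) $ i $ j) (at x within {..0})"
      if "x \<in> {..0}" for x i j
      unfolding Ym_def Em_def
      using that by (intro conjugated_solution[where B = B, OF Qm(1,2,3) Qm(5) \<Psi>' RS]) auto
    have dYp: "((\<lambda>x. Yp x $ i $ j) has_vector_derivative ((T + Ep x) ** Yp x) $ i $ j) (at x within {0..})"
      if "x \<in> {0..}" for x i j
      unfolding Yp_def Ep_def
      using that by (intro conjugated_solution[where B = B, OF Qp(1,2,3) Qp(5) \<Psi>' RS]) auto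
    define \<delta> where "\<delta> = D * exp (- \<theta>' * h)"
    have \<delta>0: "\<delta> \<ge> 0" using D0 by (simp add: \<delta>_def)
    have close_nth: "norm ((a x - a0 x) $ i $ j) \<le> Cd * exp (- \<theta>' * h)" if "\<bar>x\<bar> \<le> h" for x i j
      using close[OF that] norm_matrix_nth_le[of "a x - a0 x" i j] by linarith
    have \<delta>_eq: "n * (n * (n * (n * (b * B) * (Cd * exp (- \<theta>' * h))) * B) * b) = \<delta>"
      by (simp add: \<delta>_def D_def mult_ac)
    have Em: "norm (Em x $ i $ j) \<le> \<delta>" if "x \<in> {-h..0}" for x i j
      unfolding \<delta>_eq[symmetric] n_def Em_def using that
      by (intro norm_matrix_mult_nth_le Rb Sb Qm close_nth) auto
    have Ep: "norm (Ep x $ i $ j) \<le> \<delta>" if "x \<in> {0..h}" for x i j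
      unfolding \<delta>_eq[symmetric] n_def Ep_def using that
      by (intro norm_matrix_mult_nth_le Rb Sb Qp close_nth) auto
    define Y where "Y s = case_sum (\<lambda>i. Ym (s - h) $ i) (\<lambda>i. Yp (h - s) $ i)" for s
    define A where "A s k l = (case k of
        Inl i \<Rightarrow> (case l of Inl j \<Rightarrow> (T + Em (s - h)) $ i $ j | Inr j \<Rightarrow> 0)
      | Inr i \<Rightarrow> (case l of Inl j \<Rightarrow> 0 | Inr j \<Rightarrow> - (T + Ep (h - s)) $ i $ j))" for s k l
    define A0 where "A0 k l = (case k of
        Inl i \<Rightarrow> (case l of Inl j \<Rightarrow> T $ i $ j | Inr j \<Rightarrow> 0)
      | Inr i \<Rightarrow> (case l of Inl j \<Rightarrow> 0 | Inr j \<Rightarrow> - T $ i $ j))" for k l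
    have \<tau>: "(\<Sum>k\<in>good_rows J. A0 k k) = (\<Sum>j\<in>J. T $ j $ j) - (\<Sum>j\<in>-J. T $ j $ j)"
      unfolding good_rows_def
      by (subst sum.union_disjoint) (auto simp: sum.reindex A0_def sum_negf)
    have ode: "((\<lambda>s. Y s k $ j) has_vector_derivative (\<Sum>l\<in>UNIV. A s k l * Y s l $ j)) (at s within {0..h})"
      if s: "s \<in> {0..h}" for s k j
    proof (cases k)
      case (Inl i)
      have "((\<lambda>s. s - h) has_vector_derivative 1) (at s within {0..h})"
        by (auto intro!: derivative_eq_intros)
      moreover have "((\<lambda>x. Ym x $ i $ j) has_vector_derivative ((T + Em (s - h)) ** Ym (s - h)) $ i $ j)
          (at (s - h) within (\<lambda>s. s - h) ` {0..h})"
        using s by (intro has_vector_derivative_within_subset[OF dYm]) auto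
      ultimately have "((\<lambda>x. Ym x $ i $ j) \<circ> (\<lambda>s. s - h) has_vector_derivative
          1 *\<^sub>R ((T + Em (s - h)) ** Ym (s - h)) $ i $ j) (at s within {0..h})"
        by (rule vector_diff_chain_within)
      then show ?thesis
        by (simp add: Inl o_def Y_def A_def UNIV_sum_Plus matrix_matrix_mult_def)
    next
      case (Inr i)
      have "((\<lambda>s. h - s) has_vector_derivative -1) (at s within {0..h})"
        by (auto intro!: derivative_eq_intros)
      moreover have "((\<lambda>x. Yp x $ i $ j) has_vector_derivative ((T + Ep (h - s)) ** Yp (h - s)) $ i $ j)
          (at (h - s) within (\<lambda>s. h - s) ` {0..h})"
        using s by (intro has_vector_derivative_within_subset[OF dYp]) auto
      ultimately have "((\<lambda>x. Yp x $ i $ j) \<circ> (\<lambda>s. h - s) has_vector_derivative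
          -1 *\<^sub>R ((T + Ep (h - s)) ** Yp (h - s)) $ i $ j) (at s within {0..h})"
        by (rule vector_diff_chain_within)
      then show ?thesis
        by (simp add: Inr o_def Y_def A_def UNIV_sum_Plus matrix_matrix_mult_def sum_negf[symmetric] algebra_simps)
    qed
    have Y0: "Y 0 = case_sum (\<lambda>i. (S ** Qm (- h)) $ i) (\<lambda>i. (S ** Qp h) $ i)"
    proof -
      have "Ym (- h) = S ** Qm (- h)" "Yp h = S ** Qp h"
        unfolding Ym_def Yp_def by (simp_all add: matrix_mul_assoc[symmetric] \<Psi>inv)
      then show ?thesis by (simp add: Y_def)
    qed
    have SQ: "norm ((S ** Qm (- h)) $ i $ j) \<le> b2" "norm ((S ** Qp h) $ i $ j) \<le> b2" for i j
      unfolding b2_def n_def using h by (intro norm_matrix_mult_nth_le Sb Qm Qp; simp)+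
    have Y0b: "norm (Y 0 k $ j) \<le> b2" for k j
      unfolding Y0 using SQ by (cases k) auto
    have init: "norm (minor (Y 0) g) \<le> b3" for g
      unfolding minor_def b3_def using Y0b by (intro norm_det_le) simp
    have gapJ: "\<eta> \<le> Re (T $ j $ j)" if "j \<in> J" for j
      using gap that unfolding diagonal_gap_def by blast
    have gapJ': "\<eta> \<le> - Re (T $ j $ j)" if "j \<notin> J" for j
    proof -
      have "Re (T $ j $ j) \<le> - \<eta>" using gap that unfolding diagonal_gap_def by blast
      then show ?thesis by linarith
    qed
    have pos: "\<eta> \<le> Re (A0 k k)" if "k \<in> good_rows J" for k
      using that gapJ gapJ' by (cases k) (auto simp: A0_def)
    have neg: "Re (A0 k k) \<le> - \<eta>" if "k \<notin> good_rows J" for k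
      using that gapJ gapJ' by (cases k) (fastforce simp: A0_def)+
    have blkA: "A0 k l = 0" if "(k \<in> good_rows J) \<noteq> (l \<in> good_rows J)" for k l
      using that blk by (cases k; cases l) (auto simp: A0_def)
    have offA: "norm (A0 k l) \<le> \<eta> / c" if "k \<noteq> l" for k l
      using that off c0 \<eta>(1) by (cases k; cases l) (auto simp: A0_def)
    have pert: "norm (A s k l - A0 k l) \<le> \<delta>" if "s \<in> {0..h}" for s k l
      using that Em[of "s - h"] Ep[of "h - s"] \<delta>0 by (cases k; cases l) (auto simp: A_def A0_def)
    have "norm (exp (- (\<Sum>k\<in>good_rows J. A0 k k) * of_real h) * minor (Y h) f -
        (if range f \<subseteq> good_rows J then minor (Y 0) f else 0))
      \<le> (exp (- \<eta> * h) + c * \<delta> * (h + 1 / \<eta>)) * (exp (c * \<delta> * h) * (c * b3))"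
      unfolding c_def
      by (rule minors_asymptotics[OF h \<eta>(1) \<delta>0 card_good_rows ode pos neg blkA offA[unfolded c_def] pert init])
    also have "\<dots> \<le> (exp (- \<eta> * h) * (1 + c * D * (1 / (\<theta>' - \<eta>) + 1 / \<eta>))) * (exp (c * D / (\<theta>' - \<eta>)) * (c * b3))"
    proof (intro mult_mono)
      \<comment> \<open>The only place where the margin between \<open>\<eta>\<close> and
        \<open>\<theta>'\<close> is used up; it enters \<open>C1\<close> as
        \<open>1 / (\<theta>' - \<eta>)\<close>.\<close>
      have hd: "h * exp (- \<theta>' * h) \<le> exp (- \<eta> * h) / (\<theta>' - \<eta>)"
        using \<eta> by (intro mult_exp_le) simp
      have "exp (- \<theta>' * h) / \<eta> \<le> exp (- \<eta> * h) / \<eta>"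
        using \<eta> h by (intro divide_right_mono) auto
      with hd have "exp (- \<theta>' * h) * (h + 1 / \<eta>) \<le> exp (- \<eta> * h) * (1 / (\<theta>' - \<eta>) + 1 / \<eta>)"
        by (simp add: distrib_left distrib_right mult.commute)
      then have "c * D * (exp (- \<theta>' * h) * (h + 1 / \<eta>)) \<le> c * D * (exp (- \<eta> * h) * (1 / (\<theta>' - \<eta>) + 1 / \<eta>))"
        using c0 D0 by (intro mult_left_mono) auto
      then show "exp (- \<eta> * h) + c * \<delta> * (h + 1 / \<eta>) \<le> exp (- \<eta> * h) * (1 + c * D * (1 / (\<theta>' - \<eta>) + 1 / \<eta>))"
        by (simp add: \<delta>_def distrib_left mult_ac)
      have "exp (- \<eta> * h) / (\<theta>' - \<eta>) \<le> 1 / (\<theta>' - \<eta>)"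
        using \<eta> h by (intro divide_right_mono) auto
      with hd have "h * exp (- \<theta>' * h) \<le> 1 / (\<theta>' - \<eta>)" by linarith
      then have "c * D * (h * exp (- \<theta>' * h)) \<le> c * D * (1 / (\<theta>' - \<eta>))"
        using c0 D0 by (intro mult_left_mono) auto
      then show "exp (c * \<delta> * h) \<le> exp (c * D / (\<theta>' - \<eta>))"
        by (simp add: \<delta>_def mult_ac)
    qed (use c0 D0 b30 \<eta> in auto)
    also have "\<dots> = C1 * exp (- \<eta> * h)"
      by (simp add: C1_def)
    finally have 1: "norm (exp (- (\<Sum>k\<in>good_rows J. A0 k k) * of_real h) * minor (Y h) f -
        (if range f \<subseteq> good_rows J then minor (Y 0) f else 0)) \<le> C1 * exp (- \<eta> * h)" .
    \<comment> \<open>Distance of the initial entries from those of \<open>S\<close>, by the decay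
      of the conjugators at distance \<open>h\<close> from the origin.\<close>
    define e where "e = n * (b * (n * (B * (Cc * exp (- \<eta>' * h)))))"
    have e0: "e \<ge> 0" using n1 const by (simp add: e_def)
    have closeS: "norm ((S ** Q) $ i $ j - S $ i $ j) \<le> e"
      if "\<And>i j. norm ((Q - mat 1) $ i $ j) \<le> n * (B * (Cc * exp (- \<eta>' * h)))" for Q :: "complex^'n^'n" and i j
    proof -
      have "S ** (Q - mat 1) = S ** Q - S"
        unfolding matrix_eq
        by (simp add: matrix_vector_mul_assoc[symmetric] matrix_vector_mult_diff_rdistrib vec.diff)
      then have "(S ** Q) $ i $ j - S $ i $ j = (S ** (Q - mat 1)) $ i $ j"
        by simp
      then show ?thesis
        using norm_matrix_mult_nth_le[OF Sb that] by (simp add: e_def n_def)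
    qed
    have "norm (Y 0 k $ j - case_sum (\<lambda>i. S $ i) (\<lambda>i. S $ i) k $ j) \<le> e" for k j
    proof (cases k)
      case (Inl i)
      show ?thesis
        using closeS[of "Qm (- h)" i j] conjugator_at_inverse_close[OF Pm, of "- h"] h const
        by (simp add: Inl Y0 Qm_def n_def)
    next
      case (Inr i)
      show ?thesis
        using closeS[of "Qp h" i j] conjugator_at_inverse_close[OF Pp, of "h"] h const
        by (simp add: Inr Y0 Qp_def n_def)
    qed
    moreover have "norm (case_sum (\<lambda>i. S $ i) (\<lambda>i. S $ i) k $ j) \<le> b2" for k j
      using Sb b2(2) by (cases k) (auto intro: order_trans)
    ultimately have "norm (minor (Y 0) f - minor (case_sum (\<lambda>i. S $ i) (\<lambda>i. S $ i)) f)
        \<le> fact CARD('n) * (CARD('n) * b2 ^ CARD('n)) * e"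
      unfolding minor_def using Y0b b2(1) e0 by (intro norm_det_diff_le) auto
    also have "\<dots> = C2 * exp (- \<eta>' * h)" by (simp add: C2_def e_def)
    also have "\<dots> \<le> C2 * exp (- \<eta> * h)"
      using C20 \<eta> h by (intro mult_left_mono) auto
    finally have 2: "norm (minor (Y 0) f - minor (case_sum (\<lambda>i. S $ i) (\<lambda>i. S $ i)) f) \<le> C2 * exp (- \<eta> * h)" .
    have Yh: "Y h = case_sum (\<lambda>i. (S ** (matrix_inv (Pm 0) ** \<Psi> 0) ** matrix_inv (\<Psi> (- h))) $ i)
          (\<lambda>i. (S ** (matrix_inv (Pp 0) ** \<Psi> 0) ** matrix_inv (\<Psi> h)) $ i)"
      by (simp add: Y_def Ym_def Yp_def Qm_def Qp_def)
    have tri: "norm (v - w) \<le> norm (v - y) + norm (y - w)" for v w y :: complex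
      using norm_triangle_ineq[of "v - y" "y - w"] by simp
    let ?g = "\<lambda>y. if range f \<subseteq> good_rows J then minor y f else 0"
    have "norm (exp (- (\<Sum>k\<in>good_rows J. A0 k k) * of_real h) * minor (Y h) f - ?g (case_sum (\<lambda>i. S $ i) (\<lambda>i. S $ i)))
      \<le> norm (exp (- (\<Sum>k\<in>good_rows J. A0 k k) * of_real h) * minor (Y h) f - ?g (Y 0)) +
        norm (?g (Y 0) - ?g (case_sum (\<lambda>i. S $ i) (\<lambda>i. S $ i)))"
      by (rule tri)
    also have "\<dots> \<le> C1 * exp (- \<eta> * h) + C2 * exp (- \<eta> * h)"
    proof (rule add_mono[OF 1])
      show "norm (?g (Y 0) - ?g (case_sum (\<lambda>i. S $ i) (\<lambda>i. S $ i))) \<le> C2 * exp (- \<eta> * h)"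
        using 2 C20 by simp
    qed
    finally show ?thesis
      unfolding \<tau> Yh by (simp add: distrib_right)
  qed
  show ?thesis
    using main C10 C20 unfolding c_def by (intro exI[of _ "C1 + C2"]) auto
qed

section \<open>Expansion of the Evans function in minors\<close>

text \<open>Entries of the \<open>n\<close> by \<open>2n\<close> block matrix
  \<open>(Lm, - \<gamma> Lp)\<close> that multiplies the stacked pair of solutions.\<close>

definition evans_coeff :: "complex^'n^'n \<Rightarrow> complex^'n^'n \<Rightarrow> complex \<Rightarrow> 'n \<Rightarrow> 'n + 'n \<Rightarrow> complex" where
  "evans_coeff Lm Lp \<gamma> i k = (case k of Inl j \<Rightarrow> Lm $ i $ j | Inr j \<Rightarrow> - \<gamma> * Lp $ i $ j)"

lemma det_two_blocks:
  fixes Lm Lp Wm Wp :: "complex^'n^'n"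
  shows "det (Lm ** Wm - mat \<gamma> ** (Lp ** Wp)) =
    (\<Sum>f\<in>UNIV. (\<Prod>i\<in>UNIV. evans_coeff Lm Lp \<gamma> i (f i)) * minor (case_sum (\<lambda>i. Wm $ i) (\<lambda>i. Wp $ i)) f)"
proof -
  have mat: "(mat \<gamma> ** A) $ i $ j = \<gamma> * A $ i $ j" for A :: "complex^'n^'n" and i j
    by (simp add: matrix_matrix_mult_def mat_def if_distrib[where f = "\<lambda>x. x * _"] cong: if_cong)
  have "Lm ** Wm - mat \<gamma> ** (Lp ** Wp) =
      (\<chi> i j. \<Sum>k\<in>UNIV. evans_coeff Lm Lp \<gamma> i k * case_sum (\<lambda>i. Wm $ i) (\<lambda>i. Wp $ i) k $ j)"
    by (simp add: vec_eq_iff mat UNIV_sum_Plus evans_coeff_def)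
      (simp add: matrix_matrix_mult_def sum_negf sum_distrib_left mult.assoc)
  then show ?thesis
    by (simp only: det_rows_expand minor_def)
qed

text \<open>Both factors start with \<open>\<Psi> 0\<close>; each is rewritten with
  \<open>P ** R\<close> and its inverse inserted in front, separately for the two half-lines. The
  inserted left factors are bounded and become the coefficients, the rest is the conjugated solution
  at \<open>x = 0\<close>.\<close>

lemma balanced_periodic_evans_minors:
  fixes R S P\<^sub>m P\<^sub>p :: "complex^'n^'n"
  assumes "R ** S = mat 1" "invertible P\<^sub>m" "invertible P\<^sub>p"
  shows "balanced_periodic_evans \<Psi> (2 * h) \<gamma> =
    (\<Sum>f\<in>UNIV. (\<Prod>i\<in>UNIV. evans_coeff (P\<^sub>m ** R) (P\<^sub>p ** R) \<gamma> i (f i)) *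
      minor (case_sum (\<lambda>i. (S ** (matrix_inv P\<^sub>m ** \<Psi> 0) ** matrix_inv (\<Psi> (- h))) $ i)
          (\<lambda>i. (S ** (matrix_inv P\<^sub>p ** \<Psi> 0) ** matrix_inv (\<Psi> h)) $ i)) f)"
proof -
  have "P ** R ** (S ** (matrix_inv P ** \<Psi> 0) ** Q) = \<Psi> 0 ** Q" if "invertible P" for P Q :: "complex^'n^'n"
  proof -
    have "P ** R ** (S ** (matrix_inv P ** \<Psi> 0) ** Q) = P ** (R ** S) ** matrix_inv P ** \<Psi> 0 ** Q"
      by (simp add: matrix_mul_assoc)
    then show ?thesis
      by (simp add: assms(1) matrix_inv_inverse(2)[OF that])
  qed
  then show ?thesis
    using assms(2,3)
    by (simp add: balanced_periodic_evans_def det_two_blocks[symmetric])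
qed

text \<open>Keeping only the good selections amounts to cutting the coefficient matrices down to the
  columns in \<open>J\<close> and in \<open>- J\<close>, so the sum is again a determinant of the
  two-block kind. Its matrix factors as \<open>X ** R ** Dg ** S\<close>, with \<open>X\<close> the
  matrix built from the spectral projections and \<open>Dg\<close> diagonal with entries
  \<open>1\<close> on \<open>J\<close> and \<open>- \<gamma>\<close> elsewhere.\<close>

lemma good_minors_sum:
  fixes R S P\<^sub>m P\<^sub>p :: "complex^'n^'n"
  assumes RS: "R ** S = mat 1" "S ** R = mat 1"
  shows "(\<Sum>f\<in>UNIV. (\<Prod>i\<in>UNIV. evans_coeff (P\<^sub>m ** R) (P\<^sub>p ** R) \<gamma> i (f i)) *
      (if range f \<subseteq> good_rows J then minor (case_sum (\<lambda>i. S $ i) (\<lambda>i. S $ i)) f else 0)) =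
    (- \<gamma>) ^ card (- J) *
    det (P\<^sub>m ** (R ** block_proj J ** S) + P\<^sub>p ** (R ** block_proj (- J) ** S))"
proof -
  let ?Lm = "P\<^sub>m ** R" and ?Lp = "P\<^sub>p ** R"
  let ?X = "P\<^sub>m ** (R ** block_proj J ** S) + P\<^sub>p ** (R ** block_proj (- J) ** S)"
  define Dg :: "complex^'n^'n" where "Dg = (\<chi> i j. if i = j then (if i \<in> J then 1 else - \<gamma>) else 0)"
  have "(\<Prod>i\<in>UNIV. evans_coeff ?Lm ?Lp \<gamma> i (f i)) *
      (if range f \<subseteq> good_rows J then minor (case_sum (\<lambda>i. S $ i) (\<lambda>i. S $ i)) f else 0) =
      (\<Prod>i\<in>UNIV. evans_coeff (?Lm ** block_proj J) (?Lp ** block_proj (- J)) \<gamma> i (f i)) *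
      minor (case_sum (\<lambda>i. S $ i) (\<lambda>i. S $ i)) f" for f :: "'n \<Rightarrow> 'n + 'n"
  proof (cases "range f \<subseteq> good_rows J")
    case True
    have "evans_coeff (?Lm ** block_proj J) (?Lp ** block_proj (- J)) \<gamma> i (f i) = evans_coeff ?Lm ?Lp \<gamma> i (f i)" for i
    proof -
      have "f i \<in> good_rows J" using True by blast
      then show ?thesis
        by (cases "f i") (simp_all add: evans_coeff_def mult_block_proj)
    qed
    then show ?thesis using True by simp
  next
    case False
    then obtain i where "f i \<notin> good_rows J" by blast
    then have "evans_coeff (?Lm ** block_proj J) (?Lp ** block_proj (- J)) \<gamma> i (f i) = 0"
      by (cases "f i") (simp_all add: evans_coeff_def mult_block_proj)
    then have "(\<Prod>i\<in>UNIV. evans_coeff (?Lm ** block_proj J) (?Lp ** block_proj (- J)) \<gamma> i (f i)) = 0"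
      by (intro prod_zero) auto
    then show ?thesis using False by simp
  qed
  then have "(\<Sum>f\<in>UNIV. (\<Prod>i\<in>UNIV. evans_coeff ?Lm ?Lp \<gamma> i (f i)) *
      (if range f \<subseteq> good_rows J then minor (case_sum (\<lambda>i. S $ i) (\<lambda>i. S $ i)) f else 0)) =
      det ((?Lm ** block_proj J) ** S - mat \<gamma> ** ((?Lp ** block_proj (- J)) ** S))"
    unfolding det_two_blocks by (intro sum.cong refl) blast
  also have "(?Lm ** block_proj J) ** S - mat \<gamma> ** ((?Lp ** block_proj (- J)) ** S) = ?X ** R ** Dg ** S"
  proof -
    have XR: "?X ** R = ?Lm ** block_proj J + ?Lp ** block_proj (- J)"
    proof -
      have "S *v (R *v v) = v" for v by (simp add: matrix_vector_mul_assoc RS)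
      then show ?thesis
        unfolding matrix_eq by (simp add: matrix_vector_mul_assoc[symmetric] matrix_vector_mult_add_rdistrib)
    qed
    have mat: "mat \<gamma> ** A = (\<chi> i j. \<gamma> * A $ i $ j)" for A :: "complex^'n^'n"
      by (simp add: vec_eq_iff matrix_matrix_mult_def mat_def if_distrib[where f = "\<lambda>x. x * _"] cong: if_cong)
    have "(A ** Dg) $ i $ j = A $ i $ j * (if j \<in> J then 1 else - \<gamma>)" for A :: "complex^'n^'n" and i j
      by (simp add: Dg_def matrix_matrix_mult_def if_distrib[where f = "\<lambda>x. _ * x"] cong: if_cong)
    then have XRD: "?X ** R ** Dg = (\<chi> i j. (?Lm ** block_proj J) $ i $ j - \<gamma> * (?Lp ** block_proj (- J)) $ i $ j)"
      unfolding XR by (simp add: vec_eq_iff mult_block_proj)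
    show ?thesis
      unfolding XRD mat
      by (simp add: vec_eq_iff matrix_matrix_mult_def[of _ S] algebra_simps sum_subtractf sum_distrib_left)
  qed
  also have "det (?X ** R ** Dg ** S) = det ?X * det Dg * (det R * det S)"
    by (simp add: det_mul)
  also have "det R * det S = 1"
    using RS(1) by (metis det_mul det_I)
  also have "det Dg = (\<Prod>i\<in>UNIV. if i \<in> J then 1 else - \<gamma>)"
    by (subst det_diagonal) (simp_all add: Dg_def)
  also have "\<dots> = (- \<gamma>) ^ card (- J)"
    by (simp add: prod.If_cases Compl_eq[symmetric])
  finally show ?thesis by (simp add: mult.commute)
qed

text \<open>With \<open>X = 2 * h\<close> the two exponential prefactors combine to
  \<open>exp (- \<tau> * h)\<close>, where \<open>\<tau>\<close> is the growth rate of the good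
  minors, so the difference is a finite sum of minor errors with bounded coefficients. The modulus 1
  of \<open>\<gamma>\<close> makes both the prefactor and the coefficients bounded independently of
  it.\<close>

lemma periodic_evans_estimate:
  fixes L \<eta> \<eta>' \<theta>' B Cc Cd :: real
  assumes \<eta>: "0 < \<eta>" "\<eta> < \<eta>'" "\<eta>' < \<theta>'" and const: "B \<ge> 1" "Cc \<ge> 0" "Cd \<ge> 0"
  shows "\<exists>C\<ge>0. \<forall>(M :: complex^'n^'n) R0 J a0 a Pm Pp \<Psi> h \<gamma>.
    norm M \<le> L \<longrightarrow> hyperbolic_frame M R0 J \<longrightarrow> (\<forall>\<mu>\<in>eigenvalues M. \<eta> \<le> \<bar>Re \<mu>\<bar>) \<longrightarrow> h > 0 \<longrightarrow>
    conjugator_at {..0} a0 M \<eta>' B Cc Pm \<longrightarrow> conjugator_at {0..} a0 M \<eta>' B Cc Pp \<longrightarrow>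
    solution_operator a \<Psi> \<longrightarrow> continuous_on UNIV a \<longrightarrow>
    (\<forall>x. \<bar>x\<bar> \<le> h \<longrightarrow> norm (a x - a0 x) \<le> Cd * exp (- \<theta>' * h)) \<longrightarrow> norm \<gamma> = 1 \<longrightarrow>
    norm (rescaled_periodic_evans M \<Psi> (2 * h) \<gamma> - homoclinic_evans (Pm 0) (Pp 0) R0 J) \<le> C * exp (- \<eta> * h)"
proof -
  define F where "F = real (CARD('n \<Rightarrow> 'n + 'n))"
  \<comment> \<open>The largest off-diagonal size that the estimate for the minors
    tolerates.\<close>
  define \<kappa> where "\<kappa> = \<eta> / (2 * F * (real CARD('n) * real CARD('n + 'n)))"
  have "2 * F * (real CARD('n) * real CARD('n + 'n)) > 0"
    unfolding F_def by (simp only: zero_less_mult_iff of_nat_0_less_iff zero_less_card_finite) simp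
  then have "\<kappa> > 0" using \<eta>(1) by (simp add: \<kappa>_def)
  obtain b where "b \<ge> 1" and b: "\<And>(M :: complex^'n^'n) R0 J. norm M \<le> L \<Longrightarrow> hyperbolic_frame M R0 J \<Longrightarrow>
    (\<forall>\<mu>\<in>eigenvalues M. \<eta> \<le> \<bar>Re \<mu>\<bar>) \<Longrightarrow>
    (\<exists>R S T. block_form M J R S T \<and> diagonal_gap \<eta> J T \<and> (\<forall>j k. j \<noteq> k \<longrightarrow> norm (T $ j $ k) \<le> \<kappa>) \<and>
      (\<forall>i j. norm (R $ i $ j) \<le> b) \<and> (\<forall>i j. norm (S $ i $ j) \<le> b))"
    using uniform_block_form[OF \<eta>(1) \<open>\<kappa> > 0\<close>, of L, where 'n = 'n] by blast
  obtain C where "C \<ge> 0" and C: "\<And>(M :: complex^'n^'n) R S T J a0 a Pm Pp \<Psi> h f.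
    block_form M J R S T \<Longrightarrow> diagonal_gap \<eta> J T \<Longrightarrow>
    (\<forall>j k. j \<noteq> k \<longrightarrow> norm (T $ j $ k) \<le> \<kappa>) \<Longrightarrow>
    (\<forall>i j. norm (R $ i $ j) \<le> b) \<Longrightarrow> (\<forall>i j. norm (S $ i $ j) \<le> b) \<Longrightarrow> h > 0 \<Longrightarrow>
    conjugator_at {..0} a0 M \<eta>' B Cc Pm \<Longrightarrow> conjugator_at {0..} a0 M \<eta>' B Cc Pp \<Longrightarrow>
    solution_operator a \<Psi> \<Longrightarrow> continuous_on UNIV a \<Longrightarrow>
    (\<forall>x. \<bar>x\<bar> \<le> h \<longrightarrow> norm (a x - a0 x) \<le> Cd * exp (- \<theta>' * h)) \<Longrightarrow>
    norm (exp (- ((\<Sum>j\<in>J. T $ j $ j) - (\<Sum>j\<in>-J. T $ j $ j)) * of_real h) *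
        minor (case_sum (\<lambda>i. (S ** (matrix_inv (Pm 0) ** \<Psi> 0) ** matrix_inv (\<Psi> (- h))) $ i)
          (\<lambda>i. (S ** (matrix_inv (Pp 0) ** \<Psi> 0) ** matrix_inv (\<Psi> h)) $ i)) f -
      (if range f \<subseteq> good_rows J then minor (case_sum (\<lambda>i. S $ i) (\<lambda>i. S $ i)) f else 0))
    \<le> C * exp (- \<eta> * h)"
    using minors_limit[OF \<eta> const(1) \<open>b \<ge> 1\<close> const(2,3), where 'n = 'n] unfolding \<kappa>_def F_def by blast
  define b4 where "b4 = real CARD('n) * (B * b)"
  have "b4 \<ge> 0" using const \<open>b \<ge> 1\<close> by (simp add: b4_def)
  have "norm (rescaled_periodic_evans M \<Psi> (2 * h) \<gamma> - homoclinic_evans (Pm 0) (Pp 0) R0 J)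
      \<le> F * (b4 ^ CARD('n) * C) * exp (- \<eta> * h)"
    if M: "norm M \<le> L" and frame: "hyperbolic_frame M R0 J" and ev: "\<forall>\<mu>\<in>eigenvalues M. \<eta> \<le> \<bar>Re \<mu>\<bar>"
      and h: "h > 0" and Pm: "conjugator_at {..0} a0 M \<eta>' B Cc Pm" and Pp: "conjugator_at {0..} a0 M \<eta>' B Cc Pp"
      and sol: "solution_operator a \<Psi>" and cont: "continuous_on UNIV a"
      and close: "\<forall>x. \<bar>x\<bar> \<le> h \<longrightarrow> norm (a x - a0 x) \<le> Cd * exp (- \<theta>' * h)" and \<gamma>: "norm \<gamma> = 1"
    for M R0 :: "complex^'n^'n" and J a0 a Pm Pp \<Psi> h \<gamma>
  proof -
    obtain R S T where form: "block_form M J R S T" and gap: "diagonal_gap \<eta> J T"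
      and off: "\<forall>j k. j \<noteq> k \<longrightarrow> norm (T $ j $ k) \<le> \<kappa>"
      and Rb: "\<forall>i j. norm (R $ i $ j) \<le> b" and Sb: "\<forall>i j. norm (S $ i $ j) \<le> b"
      using b[OF M frame ev] by blast
    have RS: "R ** S = mat 1" "S ** R = mat 1"
      using form by (auto simp: block_form_def)
    have Pm0: "invertible (Pm 0)" "norm (Pm 0) \<le> B"
      using Pm by (auto simp: conjugator_at_def)
    have Pp0: "invertible (Pp 0)" "norm (Pp 0) \<le> B"
      using Pp by (auto simp: conjugator_at_def)
    define \<tau> where "\<tau> = (\<Sum>j\<in>J. T $ j $ j) - (\<Sum>j\<in>-J. T $ j $ j)"
    define m where "m f = minor (case_sum (\<lambda>i. (S ** (matrix_inv (Pm 0) ** \<Psi> 0) ** matrix_inv (\<Psi> (- h))) $ i)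
          (\<lambda>i. (S ** (matrix_inv (Pp 0) ** \<Psi> 0) ** matrix_inv (\<Psi> h)) $ i)) f" for f :: "'n \<Rightarrow> 'n + 'n"
    define g where "g f = (if range f \<subseteq> good_rows J then minor (case_sum (\<lambda>i. S $ i) (\<lambda>i. S $ i)) f else 0)"
      for f :: "'n \<Rightarrow> 'n + 'n"
    define l where "l f = (\<Prod>i\<in>UNIV. evans_coeff (Pm 0 ** R) (Pp 0 ** R) \<gamma> i (f i))" for f :: "'n \<Rightarrow> 'n + 'n"
    have mg: "norm (exp (- \<tau> * of_real h) * m f - g f) \<le> C * exp (- \<eta> * h)" for f
      unfolding \<tau>_def m_def g_def by (rule C[OF form gap off Rb Sb h Pm Pp sol cont close])
    have l: "norm (l f) \<le> b4 ^ CARD('n)" for f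
    proof -
      have Lb: "norm ((Pm 0 ** R) $ i $ j) \<le> b4" "norm ((Pp 0 ** R) $ i $ j) \<le> b4" for i j
        unfolding b4_def using Rb norm_matrix_nth_le[of "Pm 0"] norm_matrix_nth_le[of "Pp 0"] Pm0(2) Pp0(2)
        by (intro norm_matrix_mult_nth_le; blast intro: order_trans)+
      have "norm (evans_coeff (Pm 0 ** R) (Pp 0 ** R) \<gamma> i k) \<le> b4" for i k
        using Lb \<gamma> by (cases k) (simp_all add: evans_coeff_def norm_mult)
      then have "(\<Prod>i\<in>UNIV. norm (evans_coeff (Pm 0 ** R) (Pp 0 ** R) \<gamma> i (f i))) \<le> (\<Prod>i\<in>(UNIV::'n set). b4)"
        by (intro prod_mono) auto
      then show ?thesis by (simp add: l_def prod_norm)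
    qed
    have num: "num_stable_eigenvalues M = card (- J)"
      by (rule num_stable_eigenvalues_block[OF form gap \<eta>(1)])
    have tr: "trace (M ** unstable_projection M) = (\<Sum>j\<in>J. T $ j $ j)"
      "trace (M ** stable_projection M) = (\<Sum>j\<in>-J. T $ j $ j)"
      unfolding hyperbolic_block_projections(1,2)[OF form gap \<eta>(1)] by (rule trace_block_projection[OF form])+
    have "\<gamma> \<noteq> 0" using \<gamma> by auto
    define w where "w = (- \<gamma>) powi (- int (card (- J)))"
    have w: "norm w = 1" "w * (- \<gamma>) ^ card (- J) = 1"
      using \<gamma> \<open>\<gamma> \<noteq> 0\<close> by (simp_all add: w_def norm_inverse norm_power power_int_minus)
    have "rescaled_periodic_evans M \<Psi> (2 * h) \<gamma> = exp (- \<tau> * of_real h) * w * (\<Sum>f\<in>UNIV. l f * m f)"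
    proof -
      have "exp (- \<tau> * of_real h) = exp (- (\<Sum>j\<in>J. T $ j $ j) * of_real (2 * h) / 2) *
          exp ((\<Sum>j\<in>-J. T $ j $ j) * of_real (2 * h) / 2)"
        by (simp add: \<tau>_def exp_add[symmetric] algebra_simps)
      then show ?thesis
        unfolding rescaled_periodic_evans_def tr num w_def l_def m_def
          balanced_periodic_evans_minors[OF RS(1) Pm0(1) Pp0(1)] by simp
    qed
    also have "\<dots> = w * (\<Sum>f\<in>UNIV. l f * (exp (- \<tau> * of_real h) * m f))"
      by (simp add: sum_distrib_left mult_ac)
    finally have 1: "rescaled_periodic_evans M \<Psi> (2 * h) \<gamma> = w * (\<Sum>f\<in>UNIV. l f * (exp (- \<tau> * of_real h) * m f))" .
    have 2: "homoclinic_evans (Pm 0) (Pp 0) R0 J = w * (\<Sum>f\<in>UNIV. l f * g f)"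
      unfolding l_def g_def good_minors_sum[OF RS] homoclinic_evans_projections[OF frame form gap \<eta>(1)]
      using w(2) by (simp add: mult.assoc[symmetric])
    have "rescaled_periodic_evans M \<Psi> (2 * h) \<gamma> - homoclinic_evans (Pm 0) (Pp 0) R0 J =
        w * (\<Sum>f\<in>UNIV. l f * (exp (- \<tau> * of_real h) * m f - g f))"
      unfolding 1 2 by (simp add: right_diff_distrib sum_subtractf)
    also have "norm \<dots> \<le> (\<Sum>f\<in>(UNIV :: ('n \<Rightarrow> 'n + 'n) set). b4 ^ CARD('n) * (C * exp (- \<eta> * h)))"
      unfolding norm_mult w(1) mult_1
    proof (rule sum_norm_le)
      fix f
      show "norm (l f * (exp (- \<tau> * of_real h) * m f - g f)) \<le> b4 ^ CARD('n) * (C * exp (- \<eta> * h))"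
        unfolding norm_mult[of "l f"] using l mg \<open>b4 \<ge> 0\<close> by (intro mult_mono) auto
    qed
    also have "\<dots> = F * (b4 ^ CARD('n) * C) * exp (- \<eta> * h)" by (simp add: F_def)
    finally show ?thesis .
  qed
  moreover have "F * (b4 ^ CARD('n) * C) \<ge> 0"
    using \<open>b4 \<ge> 0\<close> \<open>C \<ge> 0\<close> by (simp add: F_def)
  ultimately show ?thesis by blast
qed

section \<open>Uniformity over compact sets of spectral parameters\<close>

lemma conjugator_at_mono:
  assumes "conjugator_at H a0 M \<eta>' B C P" "B \<le> B'" "C \<le> C'"
  shows "conjugator_at H a0 M \<eta>' B' C' P"
proof -
  have "C * exp (- \<eta>' * \<bar>x\<bar>) \<le> C' * exp (- \<eta>' * \<bar>x\<bar>)" for x :: real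
    using assms(3) by (intro mult_right_mono) auto
  then show ?thesis
    using assms(1,2) unfolding conjugator_at_def by (meson order_trans)
qed

lemma conjugator_on_at:
  assumes "conjugator_on H U A0 Ainf \<eta>' P"
  shows "\<exists>b. \<forall>z\<in>U. conjugator_at H (\<lambda>x. A0 x z) (Ainf z) \<eta>' b b (\<lambda>x. P x z)"
proof -
  obtain B where B: "\<And>x z. x \<in> H \<Longrightarrow> z \<in> U \<Longrightarrow> norm (P x z) \<le> B \<and> invertible (P x z) \<and> norm (matrix_inv (P x z)) \<le> B"
    using assms unfolding conjugator_on_def by blast
  obtain C where C: "\<And>x z. x \<in> H \<Longrightarrow> z \<in> U \<Longrightarrow> norm (P x z - mat 1) \<le> C * exp (- \<eta>' * \<bar>x\<bar>)"
    using assms unfolding conjugator_on_def by blast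
  have "conjugator_at H (\<lambda>x. A0 x z) (Ainf z) \<eta>' B C (\<lambda>x. P x z)" if "z \<in> U" for z
    using B C that assms unfolding conjugator_at_def conjugator_on_def by blast
  then have "conjugator_at H (\<lambda>x. A0 x z) (Ainf z) \<eta>' (max B C) (max B C) (\<lambda>x. P x z)" if "z \<in> U" for z
    using that by (meson conjugator_at_mono max.cobounded1 max.cobounded2)
  then show ?thesis by blast
qed

text \<open>Finitely many of the neighbourhoods cover \<open>K\<close>. A common bound is obtained
  only by using at \<open>z\<close> the conjugators belonging to one of the finitely many centres
  \<open>z0\<close>, hence the existential quantifier.\<close>

lemma local_conjugators_uniform:
  assumes "local_conjugators H1 \<Lambda> A0 Ainf \<eta>' P1" "local_conjugators H2 \<Lambda> A0 Ainf \<eta>' P2"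
    and "compact K" "K \<subseteq> \<Lambda>"
  shows "\<exists>b\<ge>1. \<forall>z\<in>K. \<exists>z0.
    conjugator_at H1 (\<lambda>x. A0 x z) (Ainf z) \<eta>' b b (\<lambda>x. P1 z0 x z) \<and>
    conjugator_at H2 (\<lambda>x. A0 x z) (Ainf z) \<eta>' b b (\<lambda>x. P2 z0 x z)"
proof -
  have "\<exists>U b. open U \<and> z0 \<in> U \<and> (\<forall>z\<in>U.
      conjugator_at H1 (\<lambda>x. A0 x z) (Ainf z) \<eta>' b b (\<lambda>x. P1 z0 x z) \<and>
      conjugator_at H2 (\<lambda>x. A0 x z) (Ainf z) \<eta>' b b (\<lambda>x. P2 z0 x z))" if "z0 \<in> K" for z0
  proof -
    obtain U1 where U1: "open U1" "z0 \<in> U1" "conjugator_on H1 U1 A0 Ainf \<eta>' (P1 z0)"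
      using assms(1,4) \<open>z0 \<in> K\<close> unfolding local_conjugators_def by blast
    obtain U2 where U2: "open U2" "z0 \<in> U2" "conjugator_on H2 U2 A0 Ainf \<eta>' (P2 z0)"
      using assms(2,4) \<open>z0 \<in> K\<close> unfolding local_conjugators_def by blast
    obtain b1 where b1: "\<And>z. z \<in> U1 \<Longrightarrow> conjugator_at H1 (\<lambda>x. A0 x z) (Ainf z) \<eta>' b1 b1 (\<lambda>x. P1 z0 x z)"
      using conjugator_on_at[OF U1(3)] by blast
    obtain b2 where b2: "\<And>z. z \<in> U2 \<Longrightarrow> conjugator_at H2 (\<lambda>x. A0 x z) (Ainf z) \<eta>' b2 b2 (\<lambda>x. P2 z0 x z)"
      using conjugator_on_at[OF U2(3)] by blast
    have "conjugator_at H1 (\<lambda>x. A0 x z) (Ainf z) \<eta>' (max b1 b2) (max b1 b2) (\<lambda>x. P1 z0 x z) \<and>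
        conjugator_at H2 (\<lambda>x. A0 x z) (Ainf z) \<eta>' (max b1 b2) (max b1 b2) (\<lambda>x. P2 z0 x z)"
      if "z \<in> U1 \<inter> U2" for z
      using that conjugator_at_mono[OF b1, of z "max b1 b2" "max b1 b2"]
        conjugator_at_mono[OF b2, of z "max b1 b2" "max b1 b2"] by simp
    then show ?thesis
      using U1 U2 by (intro exI[of _ "U1 \<inter> U2"] exI[of _ "max b1 b2"]) auto
  qed
  then obtain U b where U: "\<And>z0. z0 \<in> K \<Longrightarrow> open (U z0)" "\<And>z0. z0 \<in> K \<Longrightarrow> z0 \<in> U z0"
    and b: "\<And>z0 z. z0 \<in> K \<Longrightarrow> z \<in> U z0 \<Longrightarrow>
      conjugator_at H1 (\<lambda>x. A0 x z) (Ainf z) \<eta>' (b z0) (b z0) (\<lambda>x. P1 z0 x z) \<and>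
      conjugator_at H2 (\<lambda>x. A0 x z) (Ainf z) \<eta>' (b z0) (b z0) (\<lambda>x. P2 z0 x z)"
    by metis
  obtain F where F: "F \<subseteq> K" "finite F" "K \<subseteq> (\<Union>z0\<in>F. U z0)"
    using compactE_image[OF assms(3), of K U] U by blast
  define b0 where "b0 = Max (insert 1 (b ` F))"
  have "b0 \<ge> 1" using F(2) by (simp add: b0_def)
  moreover have "\<exists>z0. conjugator_at H1 (\<lambda>x. A0 x z) (Ainf z) \<eta>' b0 b0 (\<lambda>x. P1 z0 x z) \<and>
      conjugator_at H2 (\<lambda>x. A0 x z) (Ainf z) \<eta>' b0 b0 (\<lambda>x. P2 z0 x z)" if "z \<in> K" for z
  proof -
    obtain z0 where z0: "z0 \<in> F" "z \<in> U z0" using F(3) \<open>z \<in> K\<close> by blast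
    then have "b z0 \<le> b0" using F(2) by (simp add: b0_def)
    then show ?thesis
      using b[of z0 z] z0 F(1) by (meson conjugator_at_mono subsetD)
  qed
  ultimately show ?thesis by blast
qed

text \<open>The periods tend to infinity, so both bounds tend to 0 and limits are unique.\<close>

lemma eq_if_close_along_period:
  fixes v w :: "'a::real_normed_vector" and X :: "real \<Rightarrow> real"
  assumes "filterlim X at_top (at_right 0)" "\<eta> > 0"
    and "\<And>\<epsilon>. \<epsilon> > 0 \<Longrightarrow> norm (f \<epsilon> - v) \<le> C * exp (- \<eta> * X \<epsilon> / 2)"
    and "\<And>\<epsilon>. \<epsilon> > 0 \<Longrightarrow> norm (f \<epsilon> - w) \<le> C' * exp (- \<eta> * X \<epsilon> / 2)"
  shows "v = w"
proof -
  have "filterlim (\<lambda>\<epsilon>. (- \<eta> / 2) * X \<epsilon>) at_bot (at_right 0)"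
    using assms(2) by (intro filterlim_tendsto_neg_mult_at_bot[OF tendsto_const _ assms(1)]) simp
  then have e: "((\<lambda>\<epsilon>. exp (- \<eta> * X \<epsilon> / 2)) \<longlongrightarrow> 0) (at_right 0)"
    using filterlim_compose[OF exp_at_bot] by fastforce
  have pos: "\<forall>\<^sub>F \<epsilon> in at_right (0::real). \<epsilon> > 0"
    by (simp add: eventually_at_right_less)
  have lim: "(f \<longlongrightarrow> y) (at_right 0)"
    if "\<And>\<epsilon>. \<epsilon> > 0 \<Longrightarrow> norm (f \<epsilon> - y) \<le> D * exp (- \<eta> * X \<epsilon> / 2)" for y D
  proof (rule LIM_zero_cancel, rule Lim_null_comparison)
    show "\<forall>\<^sub>F \<epsilon> in at_right 0. norm (f \<epsilon> - y) \<le> D * exp (- \<eta> * X \<epsilon> / 2)"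
      using pos by eventually_elim (rule that)
    show "((\<lambda>\<epsilon>. D * exp (- \<eta> * X \<epsilon> / 2)) \<longlongrightarrow> 0) (at_right 0)"
      using tendsto_mult_right_zero[OF e] .
  qed
  show ?thesis
    using tendsto_unique[OF _ lim[OF assms(3)] lim[OF assms(4)]] by simp
qed

theorem proposition4p2:
  fixes A :: "real \<Rightarrow> real \<Rightarrow> complex \<Rightarrow> complex^'n^'n"
    and Ainf :: "complex \<Rightarrow> complex^'n^'n"
    and X :: "real \<Rightarrow> real"
    and Cb :: "real \<Rightarrow> real"
    and \<nu> \<theta>' \<eta>' \<eta> :: real
    and \<Lambda> K :: "complex set"
    and Pm Pp :: "complex \<Rightarrow> real \<Rightarrow> complex \<Rightarrow> complex^'n^'n"
    and R :: "complex \<Rightarrow> complex^'n^'n"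
    and J :: "complex \<Rightarrow> 'n set"
    and \<Psi> :: "real \<Rightarrow> real \<Rightarrow> complex \<Rightarrow> complex^'n^'n"
  assumes A_analytic: "\<And>\<epsilon> x i j. \<epsilon> \<ge> 0 \<Longrightarrow> (\<lambda>z. A \<epsilon> x z $ i $ j) analytic_on UNIV"
    and A_C1: "\<And>\<epsilon> z. \<epsilon> \<ge> 0 \<Longrightarrow> (\<lambda>x. A \<epsilon> x z) C1_differentiable_on UNIV"
    and A_cont: "\<And>x z. continuous_on {0<..} (\<lambda>\<epsilon>. A \<epsilon> x z)"
    and X_pos: "\<And>\<epsilon>. \<epsilon> > 0 \<Longrightarrow> X \<epsilon> > 0"
    and A_periodic: "\<And>\<epsilon> x z. \<epsilon> > 0 \<Longrightarrow> A \<epsilon> (x + X \<epsilon>) z = A \<epsilon> x z"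
    and consts_pos: "\<nu> > 0" "\<theta>' > 0" "\<And>M. M > 0 \<Longrightarrow> Cb M > 0"
    and H1: "filterlim X at_top (at_right 0)"
    and H2: "\<And>M x z. \<lbrakk>M > 0; norm z \<le> M\<rbrakk> \<Longrightarrow>
               norm (A 0 x z - Ainf z) \<le> Cb M * exp (- \<nu> * \<bar>x\<bar>)"
    and H3: "\<And>M \<epsilon> x z. \<lbrakk>M > 0; \<epsilon> > 0; norm z \<le> M; \<bar>x\<bar> \<le> X \<epsilon> / 2\<rbrakk> \<Longrightarrow>
               norm (A \<epsilon> x z - A 0 x z) \<le> Cb M * exp (- \<theta>' * X \<epsilon> / 2)"
    and curves: "\<exists>(m::nat) (c :: nat \<Rightarrow> real \<Rightarrow> complex). (\<forall>j<m. continuous_on UNIV (c j)) \<and>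
                   nonhyperbolic_set Ainf = (\<Union>j<m. range (c j))"
    and \<eta>'_bounds: "0 < \<eta>'" "\<eta>' < min \<theta>' \<nu>"
    and domain: "\<Lambda> \<in> domains_of_hyperbolicity Ainf"
    and compact_K: "compact K" "K \<subseteq> \<Lambda>"
    and conj_minus: "local_conjugators {..0} \<Lambda> (A 0) Ainf \<eta>' Pm"
    and conj_plus: "local_conjugators {0..} \<Lambda> (A 0) Ainf \<eta>' Pp"
    and frame: "\<And>z. z \<in> \<Lambda> \<Longrightarrow> hyperbolic_frame (Ainf z) (R z) (J z)"
    and sol: "\<And>\<epsilon> z. \<epsilon> > 0 \<Longrightarrow> solution_operator (\<lambda>x. A \<epsilon> x z) (\<lambda>x. \<Psi> \<epsilon> x z)"
    and \<eta>_bounds: "0 < \<eta>" "\<eta> < \<eta>'" "\<And>z. z \<in> K \<Longrightarrow> \<eta> < spectral_gap (Ainf z)"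
  shows "\<exists>C>0. \<forall>z\<in>K. \<forall>\<gamma>. norm \<gamma> = 1 \<longrightarrow> (\<forall>\<epsilon>>0.
           norm (rescaled_periodic_evans (Ainf z) (\<lambda>x. \<Psi> \<epsilon> x z) (X \<epsilon>) \<gamma>
                 - homoclinic_evans (Pm z 0 z) (Pp z 0 z) (R z) (J z))
           \<le> C * exp (- \<eta> * X \<epsilon> / 2))"
proof -
  have hyp: "hyperbolic_frame (Ainf z) (R z) (J z)" "\<And>\<mu>. \<mu> \<in> eigenvalues (Ainf z) \<Longrightarrow> \<eta> \<le> \<bar>Re \<mu>\<bar>"
    if "z \<in> K" for z
  proof -
    show frame_z: "hyperbolic_frame (Ainf z) (R z) (J z)"
      using frame compact_K(2) that by blast
    show "\<eta> \<le> \<bar>Re \<mu>\<bar>" if "\<mu> \<in> eigenvalues (Ainf z)" for \<mu>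
      using spectral_gap_le_eigenvalue[OF frame_z that] \<eta>_bounds(3)[OF \<open>z \<in> K\<close>] by linarith
  qed
  obtain m where m: "m > 0" "\<And>z. z \<in> K \<Longrightarrow> norm z \<le> m"
    using compact_imp_bounded[OF compact_K(1)] bounded_pos by blast
  \<comment> \<open>The bound for \<open>Ainf\<close> on \<open>K\<close> is drawn from
    \<open>A 0\<close> at \<open>x = 0\<close>, which is continuous in \<open>z\<close> by
    analyticity, together with (H2) at \<open>x = 0\<close>.\<close>
  have "continuous_on K (\<lambda>z. A 0 0 z $ i $ j)" for i j
    using A_analytic[of 0 0 i j] analytic_imp_holomorphic holomorphic_on_imp_continuous_on
      continuous_on_subset by blast
  then have "continuous_on K (\<lambda>z. \<chi> i j. A 0 0 z $ i $ j)"
    by (intro continuous_on_vec_lambda)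
  then have "bounded ((\<lambda>z. A 0 0 z) ` K)"
    using compact_K(1) by (intro compact_imp_bounded compact_continuous_image) simp
  then obtain L0 where L0: "\<And>z. z \<in> K \<Longrightarrow> norm (A 0 0 z) \<le> L0"
    unfolding bounded_iff by blast
  have L: "norm (Ainf z) \<le> L0 + Cb m" if "z \<in> K" for z
  proof -
    have "norm (A 0 0 z - Ainf z) \<le> Cb m"
      using H2[OF m(1) m(2)[OF that], of 0] by simp
    then show ?thesis
      using L0[OF that] norm_triangle_ineq2[of "Ainf z" "A 0 0 z"] by (simp add: norm_minus_commute)
  qed
  \<comment> \<open>Stated for arbitrary conjugators with bound \<open>b\<close>, since it is used
    twice: with the common bound on \<open>K\<close>, and with a bound that belongs to a single
    \<open>z\<close>.\<close>
  have estimate: "\<exists>C\<ge>0. \<forall>z\<in>K. \<forall>pm pp.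
      conjugator_at {..0} (\<lambda>x. A 0 x z) (Ainf z) \<eta>' b b pm \<longrightarrow>
      conjugator_at {0..} (\<lambda>x. A 0 x z) (Ainf z) \<eta>' b b pp \<longrightarrow>
      (\<forall>\<epsilon>>0. \<forall>\<gamma>. norm \<gamma> = 1 \<longrightarrow>
        norm (rescaled_periodic_evans (Ainf z) (\<lambda>x. \<Psi> \<epsilon> x z) (X \<epsilon>) \<gamma> - homoclinic_evans (pm 0) (pp 0) (R z) (J z))
        \<le> C * exp (- \<eta> * X \<epsilon> / 2))" if b1: "b \<ge> 1" for b
  proof -
    have const: "0 \<le> b" "0 \<le> Cb m" "\<eta>' < \<theta>'"
      using b1 consts_pos(3)[OF m(1)] \<eta>'_bounds(2) by simp_all
    obtain C where C: "C \<ge> 0" "\<And>(M :: complex^'n^'n) R0 J a0 a Pm Pp \<Psi> h \<gamma>.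
      norm M \<le> L0 + Cb m \<Longrightarrow> hyperbolic_frame M R0 J \<Longrightarrow> (\<forall>\<mu>\<in>eigenvalues M. \<eta> \<le> \<bar>Re \<mu>\<bar>) \<Longrightarrow> h > 0 \<Longrightarrow>
      conjugator_at {..0} a0 M \<eta>' b b Pm \<Longrightarrow> conjugator_at {0..} a0 M \<eta>' b b Pp \<Longrightarrow>
      solution_operator a \<Psi> \<Longrightarrow> continuous_on UNIV a \<Longrightarrow>
      (\<forall>x. \<bar>x\<bar> \<le> h \<longrightarrow> norm (a x - a0 x) \<le> Cb m * exp (- \<theta>' * h)) \<Longrightarrow> norm \<gamma> = 1 \<Longrightarrow>
      norm (rescaled_periodic_evans M \<Psi> (2 * h) \<gamma> - homoclinic_evans (Pm 0) (Pp 0) R0 J) \<le> C * exp (- \<eta> * h)"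
      using periodic_evans_estimate[OF \<eta>_bounds(1,2) const(3) b1 const(1,2), where 'n = 'n and L = "L0 + Cb m"]
      by blast
    have "norm (rescaled_periodic_evans (Ainf z) (\<lambda>x. \<Psi> \<epsilon> x z) (X \<epsilon>) \<gamma> - homoclinic_evans (pm 0) (pp 0) (R z) (J z))
        \<le> C * exp (- \<eta> * X \<epsilon> / 2)"
      if z: "z \<in> K" and pm: "conjugator_at {..0} (\<lambda>x. A 0 x z) (Ainf z) \<eta>' b b pm"
        and pp: "conjugator_at {0..} (\<lambda>x. A 0 x z) (Ainf z) \<eta>' b b pp" and \<epsilon>: "\<epsilon> > 0" and \<gamma>: "norm \<gamma> = 1"
      for z pm pp \<epsilon> \<gamma>
    proof -
      have ev: "\<forall>\<mu>\<in>eigenvalues (Ainf z). \<eta> \<le> \<bar>Re \<mu>\<bar>"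
        using hyp(2)[OF z] by blast
      have h: "X \<epsilon> / 2 > 0" using X_pos[OF \<epsilon>] by simp
      have cont: "continuous_on UNIV (\<lambda>x. A \<epsilon> x z)"
        using A_C1[of \<epsilon> z] \<epsilon> by (intro C1_differentiable_imp_continuous_on) simp
      have close: "\<forall>x. \<bar>x\<bar> \<le> X \<epsilon> / 2 \<longrightarrow> norm (A \<epsilon> x z - A 0 x z) \<le> Cb m * exp (- \<theta>' * (X \<epsilon> / 2))"
        using H3[OF m(1) \<epsilon> m(2)[OF z]] by simp
      show ?thesis
        using C(2)[OF L[OF z] hyp(1)[OF z] ev h pm pp sol[OF \<epsilon>] cont close \<gamma>] by simp
    qed
    with C(1) show ?thesis by blast
  qed
  obtain b where "b \<ge> 1" and b: "\<And>z. z \<in> K \<Longrightarrow> \<exists>z0.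
      conjugator_at {..0} (\<lambda>x. A 0 x z) (Ainf z) \<eta>' b b (\<lambda>x. Pm z0 x z) \<and>
      conjugator_at {0..} (\<lambda>x. A 0 x z) (Ainf z) \<eta>' b b (\<lambda>x. Pp z0 x z)"
    using local_conjugators_uniform[OF conj_minus conj_plus compact_K] by blast
  obtain C where "C \<ge> 0" and C: "\<And>z pm pp \<epsilon> \<gamma>. z \<in> K \<Longrightarrow>
      conjugator_at {..0} (\<lambda>x. A 0 x z) (Ainf z) \<eta>' b b pm \<Longrightarrow>
      conjugator_at {0..} (\<lambda>x. A 0 x z) (Ainf z) \<eta>' b b pp \<Longrightarrow> \<epsilon> > 0 \<Longrightarrow> norm \<gamma> = 1 \<Longrightarrow>
      norm (rescaled_periodic_evans (Ainf z) (\<lambda>x. \<Psi> \<epsilon> x z) (X \<epsilon>) \<gamma> - homoclinic_evans (pm 0) (pp 0) (R z) (J z))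
        \<le> C * exp (- \<eta> * X \<epsilon> / 2)"
    using estimate[OF \<open>b \<ge> 1\<close>] by blast
  \<comment> \<open>The conjugators that \<open>Pm\<close>, \<open>Pp\<close> assign to \<open>z\<close> itself have no bounds uniform in \<open>z\<close>, but as limits of
    the same periodic Evans function all conjugators at \<open>z\<close> yield the same homoclinic Evans function.\<close>
  have indep: "homoclinic_evans (Pm z0 0 z) (Pp z0 0 z) (R z) (J z) = homoclinic_evans (Pm z 0 z) (Pp z 0 z) (R z) (J z)"
    if z: "z \<in> K" and z0: "conjugator_at {..0} (\<lambda>x. A 0 x z) (Ainf z) \<eta>' b b (\<lambda>x. Pm z0 x z)"
      "conjugator_at {0..} (\<lambda>x. A 0 x z) (Ainf z) \<eta>' b b (\<lambda>x. Pp z0 x z)" for z z0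
  proof -
    obtain Um Up where U: "z \<in> Um" "conjugator_on {..0} Um (A 0) Ainf \<eta>' (Pm z)"
        "z \<in> Up" "conjugator_on {0..} Up (A 0) Ainf \<eta>' (Pp z)"
      using conj_minus conj_plus compact_K(2) z unfolding local_conjugators_def by blast
    obtain b1 b2 where "conjugator_at {..0} (\<lambda>x. A 0 x z) (Ainf z) \<eta>' b1 b1 (\<lambda>x. Pm z x z)"
        "conjugator_at {0..} (\<lambda>x. A 0 x z) (Ainf z) \<eta>' b2 b2 (\<lambda>x. Pp z x z)"
      using conjugator_on_at[OF U(2)] conjugator_on_at[OF U(4)] U(1,3) by blast
    then have at_z: "conjugator_at {..0} (\<lambda>x. A 0 x z) (Ainf z) \<eta>' (max 1 (max b1 b2)) (max 1 (max b1 b2)) (\<lambda>x. Pm z x z)"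
        "conjugator_at {0..} (\<lambda>x. A 0 x z) (Ainf z) \<eta>' (max 1 (max b1 b2)) (max 1 (max b1 b2)) (\<lambda>x. Pp z x z)"
      by (auto elim: conjugator_at_mono)
    obtain C' where C': "\<And>\<epsilon> \<gamma>. \<epsilon> > 0 \<Longrightarrow> norm \<gamma> = 1 \<Longrightarrow>
        norm (rescaled_periodic_evans (Ainf z) (\<lambda>x. \<Psi> \<epsilon> x z) (X \<epsilon>) \<gamma> - homoclinic_evans (Pm z 0 z) (Pp z 0 z) (R z) (J z))
        \<le> C' * exp (- \<eta> * X \<epsilon> / 2)"
      using estimate[of "max 1 (max b1 b2)"] at_z z by fastforce
    show ?thesis
    proof (rule eq_if_close_along_period[OF H1 \<eta>_bounds(1)])
      fix \<epsilon> :: real assume "\<epsilon> > 0"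
      then show "norm (rescaled_periodic_evans (Ainf z) (\<lambda>x. \<Psi> \<epsilon> x z) (X \<epsilon>) 1 -
          homoclinic_evans (Pm z0 0 z) (Pp z0 0 z) (R z) (J z)) \<le> C * exp (- \<eta> * X \<epsilon> / 2)"
        "norm (rescaled_periodic_evans (Ainf z) (\<lambda>x. \<Psi> \<epsilon> x z) (X \<epsilon>) 1 -
          homoclinic_evans (Pm z 0 z) (Pp z 0 z) (R z) (J z)) \<le> C' * exp (- \<eta> * X \<epsilon> / 2)"
        using C[OF z z0, of \<epsilon> 1] C'[of \<epsilon> 1] by simp_all
    qed
  qed
  have "norm (rescaled_periodic_evans (Ainf z) (\<lambda>x. \<Psi> \<epsilon> x z) (X \<epsilon>) \<gamma> - homoclinic_evans (Pm z 0 z) (Pp z 0 z) (R z) (J z))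
      \<le> (C + 1) * exp (- \<eta> * X \<epsilon> / 2)" if z: "z \<in> K" and \<gamma>: "norm \<gamma> = 1" and \<epsilon>: "\<epsilon> > 0" for z \<gamma> \<epsilon>
  proof -
    obtain z0 where z0: "conjugator_at {..0} (\<lambda>x. A 0 x z) (Ainf z) \<eta>' b b (\<lambda>x. Pm z0 x z)"
        "conjugator_at {0..} (\<lambda>x. A 0 x z) (Ainf z) \<eta>' b b (\<lambda>x. Pp z0 x z)"
      using b[OF z] by blast
    have "norm (rescaled_periodic_evans (Ainf z) (\<lambda>x. \<Psi> \<epsilon> x z) (X \<epsilon>) \<gamma> - homoclinic_evans (Pm z 0 z) (Pp z 0 z) (R z) (J z))
        \<le> C * exp (- \<eta> * X \<epsilon> / 2)"
      using C[OF z z0 \<epsilon> \<gamma>] by (simp only: indep[OF z z0])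
    \<comment> \<open>\<open>C\<close> may be 0, while a positive constant is claimed.\<close>
    also have "\<dots> \<le> (C + 1) * exp (- \<eta> * X \<epsilon> / 2)"
      by (intro mult_right_mono) auto
    finally show ?thesis .
  qed
  then show ?thesis
    using \<open>C \<ge> 0\<close> by (intro exI[of _ "C + 1"]) auto
qed

end
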